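(* Let $\mathcal N$ be a semifinite von Neumann algebra on a separable Hilbert space with a faithful normal semifinite trace $\tau$, and let $q\ge1$. (i) The formula $\|T\|_{\mathcal Z_q}^{+}:=\|T^q\|_{\mathcal Z_1}^{1/q}$ ($T\in\mathcal Z_q$) is equivalent to the semi-norm $\|\cdot\|_{\mathcal Z_q}$, i.e. there are constants $0<c\le c'<\infty$ with $c\|T\|^+_{\mathcal Z_q}\le\|T\|_{\mathcal Z_q}\le c'\|T\|^+_{\mathcal Z_q}$ for all $T\in\mathcal Z_q$. (ii) The space $\mathcal Z_q$ coincides as a set with the $q$-convexification of the operator space $\mathcal L^{(1,\infty)}$, $$\mathcal L^{1,\infty}_q=\Bigl\{T\in\mathcal N_+:\ \sup_{1<u<\infty}\Bigl(\frac{\int_0^u\mu_t(T)^q\,dt}{\log(1+u)}\Bigr)^{1/q}<\infty\Bigr\}.$$ If $\mathcal N$ is a type $I$ factor with the standard trace, or else $\mathcal N$ is semifinite and the trace $\tau$ is non-atomic, then the semi-norms $\|\cdot\|_{\mathcal Z_q}$ and $\operatorname{dist}_{\mathcal L_q^{1,\infty}}(\cdot,\mathcal L^{1,\infty}_{q,0})$ are equivalent (on $\mathcal Z_q$), where $\mathcal L^{1,\infty}_{q,0}$ is the closure of $L_1(\mathcal N,\tau)$ in $\mathcal L^{1,\infty}_q$.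
   Context: For $A\in\mathcal N$ and $t\ge0$, $\mu_t(A)=\inf\{s\ge 0:\tau(E^{|A|}(s,\infty))\le t\}$, where $E^{|A|}$ is the spectral measure of $|A|$. $\mathcal N_+$ is the set of positive elements of $\mathcal N$. For $q\ge1$, $\mathcal Z_q=\{T\in\mathcal N_+:\ \|T\|_{\mathcal Z_q}:=\limsup_{p\downarrow q}\bigl((p-q)\tau(T^p)\bigr)^{1/p}<\infty\}$, and $\|T\|_{\mathcal Z_1}=\limsup_{p\downarrow1}(p-1)\tau(T^p)$. The norm on $\mathcal L_q^{1,\infty}$ is $\sup_{1<u<\infty}\bigl(\int_0^u\mu_t(T)^q\,dt/\log(1+u)\bigr)^{1/q}$; for not necessarily positive $T\in\mathcal N$ membership in $\mathcal L_q^{1,\infty}$ and its norm are defined by the same formula (i.e. through $|T|$), and distance and closure are taken with respect to this norm. $L_1(\mathcal N,\tau)=\{A\in\mathcal N:\tau(|A|)<\infty\}$. *)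

theory Defs
  imports "HOL-Analysis.Analysis"
begin

section \<open>Complex Hilbert spaces and bounded operators\<close>

text \<open>
  The underlying real Hilbert space supplies the norm, the topology and completeness;
  \<open>inner_eq_Re_cinner\<close> ties the complex inner product (linear in the second argument) to it,
  so positive definiteness need not be restated.
\<close>

class chilbert_space = real_inner + complete_space +
  fixes scaleC :: "complex \<Rightarrow> 'a \<Rightarrow> 'a" (infixr "*\<^sub>C" 75)
    and cinner :: "'a \<Rightarrow> 'a \<Rightarrow> complex"
  assumes scaleC_add_right: "c *\<^sub>C (x + y) = c *\<^sub>C x + c *\<^sub>C y"
    and scaleC_add_left: "(c + d) *\<^sub>C x = c *\<^sub>C x + d *\<^sub>C x"
    and scaleC_scaleC: "c *\<^sub>C (d *\<^sub>C x) = (c * d) *\<^sub>C x"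
    and scaleR_eq_scaleC: "scaleR r x = complex_of_real r *\<^sub>C x"
    and cinner_commute: "cinner x y = cnj (cinner y x)"
    and cinner_add_right: "cinner x (y + z) = cinner x y + cinner x z"
    and cinner_scaleC_right: "cinner x (c *\<^sub>C y) = c * cinner x y"
    and inner_eq_Re_cinner: "inner x y = Re (cinner x y)"

text \<open>The library type \<open>'h \<Rightarrow>\<^sub>L 'h\<close> consists of the real-linear bounded operators;
  \<open>bops\<close> carves out the complex-linear ones, i.e. \<open>B(H)\<close>.\<close>

definition bops :: "('h::chilbert_space \<Rightarrow>\<^sub>L 'h) set" where
  "bops = {A::'h \<Rightarrow>\<^sub>L 'h. \<forall>c x. A (c *\<^sub>C x) = c *\<^sub>C A x}"

definition cadjoint :: "('h::chilbert_space \<Rightarrow>\<^sub>L 'h) \<Rightarrow> 'h \<Rightarrow>\<^sub>L 'h" where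
  "cadjoint A = (THE B::'h \<Rightarrow>\<^sub>L 'h. \<forall>x y. cinner (B x) y = cinner x (A y))"

definition positive_op :: "('h::chilbert_space \<Rightarrow>\<^sub>L 'h) \<Rightarrow> bool" where
  "positive_op A \<longleftrightarrow> A \<in> bops \<and> (\<forall>x. cinner x (A x) \<in> \<real>\<^sub>\<ge>\<^sub>0)"

definition op_le :: "('h::chilbert_space \<Rightarrow>\<^sub>L 'h) \<Rightarrow> ('h \<Rightarrow>\<^sub>L 'h) \<Rightarrow> bool" (infix "\<preceq>" 50) where
  "A \<preceq> B \<longleftrightarrow> positive_op (B - A)"

definition projection :: "('h::chilbert_space \<Rightarrow>\<^sub>L 'h) \<Rightarrow> bool" where
  "projection P \<longleftrightarrow> P \<in> bops \<and> P o\<^sub>L P = P \<and> cadjoint P = P"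


section \<open>Spectral measures and Borel functional calculus\<close>

definition vector_measure :: "(real set \<Rightarrow> 'h::chilbert_space \<Rightarrow>\<^sub>L 'h) \<Rightarrow> 'h \<Rightarrow> real measure" where
  "vector_measure E x = measure_of UNIV (sets borel) (\<lambda>S. ennreal (Re (cinner x (E S x))))"

text \<open>A compactly supported projection-valued measure \<open>E\<close> on the Borel sets of the real line
  with \<open>A = \<integral>\<lambda> dE(\<lambda>)\<close> (weakly; by polarisation the diagonal matrix elements suffice).
  The value \<open>0\<close> outside the Borel sets is a convention that makes \<open>E\<close> unique as a function.\<close>

definition is_spectral_measure ::
    "('h::chilbert_space \<Rightarrow>\<^sub>L 'h) \<Rightarrow> (real set \<Rightarrow> 'h \<Rightarrow>\<^sub>L 'h) \<Rightarrow> bool" where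
  "is_spectral_measure A E \<longleftrightarrow>
     (\<forall>S\<in>sets borel. projection (E S)) \<and>
     (\<forall>S. S \<notin> sets borel \<longrightarrow> E S = 0) \<and>
     E UNIV = id_blinfun \<and>
     (\<forall>F::nat \<Rightarrow> real set. range F \<subseteq> sets borel \<longrightarrow> disjoint_family F \<longrightarrow>
        (\<forall>x. (\<lambda>n. E (F n) x) sums E (\<Union>n. F n) x)) \<and>
     (\<exists>R. E {-R..R} = id_blinfun) \<and>
     (\<forall>x. cinner x (A x) = complex_of_real (\<integral>s. s \<partial>vector_measure E x))"

definition spectral_measure :: "('h::chilbert_space \<Rightarrow>\<^sub>L 'h) \<Rightarrow> real set \<Rightarrow> 'h \<Rightarrow>\<^sub>L 'h" where
  "spectral_measure A = (THE E. is_spectral_measure A E)"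

definition fun_calc :: "(real \<Rightarrow> real) \<Rightarrow> ('h::chilbert_space \<Rightarrow>\<^sub>L 'h) \<Rightarrow> 'h \<Rightarrow>\<^sub>L 'h" where
  "fun_calc f A = (THE B::'h \<Rightarrow>\<^sub>L 'h. B \<in> bops \<and>
     (\<forall>x. cinner x (B x) = complex_of_real (\<integral>s. f s \<partial>vector_measure (spectral_measure A) x)))"

text \<open>Intended for positive \<open>A\<close> and \<open>p > 0\<close>; note \<open>0 powr p = 0\<close>.\<close>

definition op_powr :: "('h::chilbert_space \<Rightarrow>\<^sub>L 'h) \<Rightarrow> real \<Rightarrow> 'h \<Rightarrow>\<^sub>L 'h" where
  "op_powr A p = fun_calc (\<lambda>s. s powr p) A"

definition op_abs :: "('h::chilbert_space \<Rightarrow>\<^sub>L 'h) \<Rightarrow> 'h \<Rightarrow>\<^sub>L 'h" where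
  "op_abs A = op_powr (cadjoint A o\<^sub>L A) (1 / 2)"


section \<open>Von Neumann algebras and traces\<close>

definition commutant :: "('h::chilbert_space \<Rightarrow>\<^sub>L 'h) set \<Rightarrow> ('h \<Rightarrow>\<^sub>L 'h) set" where
  "commutant S = {B \<in> bops. \<forall>A\<in>S. A o\<^sub>L B = B o\<^sub>L A}"

definition von_neumann_algebra :: "('h::chilbert_space \<Rightarrow>\<^sub>L 'h) set \<Rightarrow> bool" where
  "von_neumann_algebra N \<longleftrightarrow>
     N \<subseteq> bops \<and> (\<forall>A\<in>N. cadjoint A \<in> N) \<and> commutant (commutant N) = N"

definition pos_part :: "('h::chilbert_space \<Rightarrow>\<^sub>L 'h) set \<Rightarrow> ('h \<Rightarrow>\<^sub>L 'h) set" where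
  "pos_part N = {A \<in> N. positive_op A}"

definition projections :: "('h::chilbert_space \<Rightarrow>\<^sub>L 'h) set \<Rightarrow> ('h \<Rightarrow>\<^sub>L 'h) set" where
  "projections N = {P \<in> N. projection P}"

text \<open>Only the values of \<open>\<tau>\<close> on the positive cone of \<open>N\<close> are meaningful.\<close>

definition trace_on ::
    "('h::chilbert_space \<Rightarrow>\<^sub>L 'h) set \<Rightarrow> (('h \<Rightarrow>\<^sub>L 'h) \<Rightarrow> ennreal) \<Rightarrow> bool" where
  "trace_on N \<tau> \<longleftrightarrow>
     (\<forall>A\<in>pos_part N. \<forall>B\<in>pos_part N. \<tau> (A + B) = \<tau> A + \<tau> B) \<and>
     (\<forall>A\<in>pos_part N. \<forall>r\<ge>0. \<tau> (r *\<^sub>R A) = ennreal r * \<tau> A) \<and>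
     (\<forall>A\<in>N. \<tau> (cadjoint A o\<^sub>L A) = \<tau> (A o\<^sub>L cadjoint A))"

definition faithful_trace ::
    "('h::chilbert_space \<Rightarrow>\<^sub>L 'h) set \<Rightarrow> (('h \<Rightarrow>\<^sub>L 'h) \<Rightarrow> ennreal) \<Rightarrow> bool" where
  "faithful_trace N \<tau> \<longleftrightarrow> (\<forall>A\<in>pos_part N. \<tau> A = 0 \<longrightarrow> A = 0)"

definition is_lub_in ::
    "('h::chilbert_space \<Rightarrow>\<^sub>L 'h) set \<Rightarrow> ('h \<Rightarrow>\<^sub>L 'h) set \<Rightarrow> ('h \<Rightarrow>\<^sub>L 'h) \<Rightarrow> bool" where
  "is_lub_in X D S \<longleftrightarrow>
     S \<in> X \<and> (\<forall>A\<in>D. A \<preceq> S) \<and> (\<forall>R\<in>X. (\<forall>A\<in>D. A \<preceq> R) \<longrightarrow> S \<preceq> R)"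

definition normal_trace ::
    "('h::chilbert_space \<Rightarrow>\<^sub>L 'h) set \<Rightarrow> (('h \<Rightarrow>\<^sub>L 'h) \<Rightarrow> ennreal) \<Rightarrow> bool" where
  "normal_trace N \<tau> \<longleftrightarrow>
     (\<forall>D S. D \<subseteq> pos_part N \<longrightarrow> D \<noteq> {} \<longrightarrow>
        (\<forall>A\<in>D. \<forall>B\<in>D. \<exists>C\<in>D. A \<preceq> C \<and> B \<preceq> C) \<longrightarrow>
        is_lub_in (pos_part N) D S \<longrightarrow> \<tau> S = (SUP A\<in>D. \<tau> A))"

definition semifinite_trace ::
    "('h::chilbert_space \<Rightarrow>\<^sub>L 'h) set \<Rightarrow> (('h \<Rightarrow>\<^sub>L 'h) \<Rightarrow> ennreal) \<Rightarrow> bool" where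
  "semifinite_trace N \<tau> \<longleftrightarrow>
     (\<forall>A\<in>pos_part N. A \<noteq> 0 \<longrightarrow> (\<exists>B\<in>pos_part N. B \<noteq> 0 \<and> B \<preceq> A \<and> \<tau> B < \<infinity>))"

definition fns_trace ::
    "('h::chilbert_space \<Rightarrow>\<^sub>L 'h) set \<Rightarrow> (('h \<Rightarrow>\<^sub>L 'h) \<Rightarrow> ennreal) \<Rightarrow> bool" where
  "fns_trace N \<tau> \<longleftrightarrow> trace_on N \<tau> \<and> faithful_trace N \<tau> \<and> normal_trace N \<tau> \<and> semifinite_trace N \<tau>"

definition semifinite_von_neumann_algebra :: "('h::chilbert_space \<Rightarrow>\<^sub>L 'h) set \<Rightarrow> bool" where
  "semifinite_von_neumann_algebra N \<longleftrightarrow> von_neumann_algebra N \<and> (\<exists>\<tau>. fns_trace N \<tau>)"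

definition factor :: "('h::chilbert_space \<Rightarrow>\<^sub>L 'h) set \<Rightarrow> bool" where
  "factor N \<longleftrightarrow> von_neumann_algebra N \<and>
     (\<forall>Z \<in> N \<inter> commutant N. \<exists>c. \<forall>x. Z x = c *\<^sub>C x)"

text \<open>\<open>P\<close> is an abelian projection if the reduced algebra \<open>P N P\<close> is commutative.\<close>

definition abelian_projection ::
    "('h::chilbert_space \<Rightarrow>\<^sub>L 'h) set \<Rightarrow> ('h \<Rightarrow>\<^sub>L 'h) \<Rightarrow> bool" where
  "abelian_projection N P \<longleftrightarrow> P \<in> projections N \<and>
     (\<forall>A\<in>N. \<forall>B\<in>N. (P o\<^sub>L A o\<^sub>L P) o\<^sub>L (P o\<^sub>L B o\<^sub>L P) = (P o\<^sub>L B o\<^sub>L P) o\<^sub>L (P o\<^sub>L A o\<^sub>L P))"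

definition type_I :: "('h::chilbert_space \<Rightarrow>\<^sub>L 'h) set \<Rightarrow> bool" where
  "type_I N \<longleftrightarrow> von_neumann_algebra N \<and>
     (\<forall>Z \<in> projections (N \<inter> commutant N). Z \<noteq> 0 \<longrightarrow>
        (\<exists>P. abelian_projection N P \<and> P \<noteq> 0 \<and> P \<preceq> Z))"

definition minimal_projection ::
    "('h::chilbert_space \<Rightarrow>\<^sub>L 'h) set \<Rightarrow> ('h \<Rightarrow>\<^sub>L 'h) \<Rightarrow> bool" where
  "minimal_projection N P \<longleftrightarrow> P \<in> projections N \<and> P \<noteq> 0 \<and>
     (\<forall>Q\<in>projections N. Q \<preceq> P \<longrightarrow> Q = 0 \<or> Q = P)"

text \<open>The standard trace of a type I factor \<open>N \<cong> B(K)\<close> is the operator trace of \<open>B(K)\<close>, i.e. the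
  faithful normal semifinite trace normalised to be \<open>1\<close> on the minimal (rank one) projections.\<close>

definition standard_trace ::
    "('h::chilbert_space \<Rightarrow>\<^sub>L 'h) set \<Rightarrow> (('h \<Rightarrow>\<^sub>L 'h) \<Rightarrow> ennreal) \<Rightarrow> bool" where
  "standard_trace N \<tau> \<longleftrightarrow> fns_trace N \<tau> \<and> (\<forall>P. minimal_projection N P \<longrightarrow> \<tau> P = 1)"

definition non_atomic ::
    "('h::chilbert_space \<Rightarrow>\<^sub>L 'h) set \<Rightarrow> (('h \<Rightarrow>\<^sub>L 'h) \<Rightarrow> ennreal) \<Rightarrow> bool" where
  "non_atomic N \<tau> \<longleftrightarrow>
     (\<forall>P\<in>projections N. 0 < \<tau> P \<longrightarrow> (\<exists>Q\<in>projections N. Q \<preceq> P \<and> 0 < \<tau> Q \<and> \<tau> Q < \<tau> P))"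


section \<open>The spaces\<close>

definition gen_sval ::
    "(('h::chilbert_space \<Rightarrow>\<^sub>L 'h) \<Rightarrow> ennreal) \<Rightarrow> ('h \<Rightarrow>\<^sub>L 'h) \<Rightarrow> real \<Rightarrow> real" where
  "gen_sval \<tau> A t = Inf {s. 0 \<le> s \<and> \<tau> (spectral_measure (op_abs A) {s<..}) \<le> ennreal t}"

text \<open>Power with a positive exponent on \<open>[0, \<infinity>]\<close>.\<close>

definition epowr :: "ennreal \<Rightarrow> real \<Rightarrow> ennreal" where
  "epowr x a = (if x = \<infinity> then \<infinity> else ennreal (enn2real x powr a))"

definition Z_norm ::
    "(('h::chilbert_space \<Rightarrow>\<^sub>L 'h) \<Rightarrow> ennreal) \<Rightarrow> real \<Rightarrow> ('h \<Rightarrow>\<^sub>L 'h) \<Rightarrow> ennreal" where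
  "Z_norm \<tau> q T = Limsup (at_right q) (\<lambda>p. epowr (ennreal (p - q) * \<tau> (op_powr T p)) (1 / p))"

definition Z_space ::
    "('h::chilbert_space \<Rightarrow>\<^sub>L 'h) set \<Rightarrow> (('h \<Rightarrow>\<^sub>L 'h) \<Rightarrow> ennreal) \<Rightarrow> real \<Rightarrow> ('h \<Rightarrow>\<^sub>L 'h) set" where
  "Z_space N \<tau> q = {T \<in> pos_part N. Z_norm \<tau> q T < \<infinity>}"

text \<open>For \<open>q = 1\<close> the seminorm is customarily written without the \<open>p\<close>-th root.\<close>

definition Z1_norm ::
    "(('h::chilbert_space \<Rightarrow>\<^sub>L 'h) \<Rightarrow> ennreal) \<Rightarrow> ('h \<Rightarrow>\<^sub>L 'h) \<Rightarrow> ennreal" where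
  "Z1_norm \<tau> T = Limsup (at_right 1) (\<lambda>p. ennreal (p - 1) * \<tau> (op_powr T p))"

definition Z_norm_plus ::
    "(('h::chilbert_space \<Rightarrow>\<^sub>L 'h) \<Rightarrow> ennreal) \<Rightarrow> real \<Rightarrow> ('h \<Rightarrow>\<^sub>L 'h) \<Rightarrow> ennreal" where
  "Z_norm_plus \<tau> q T = epowr (Z1_norm \<tau> (op_powr T q)) (1 / q)"

definition L_norm ::
    "(('h::chilbert_space \<Rightarrow>\<^sub>L 'h) \<Rightarrow> ennreal) \<Rightarrow> real \<Rightarrow> ('h \<Rightarrow>\<^sub>L 'h) \<Rightarrow> ennreal" where
  "L_norm \<tau> q T = (SUP u\<in>{1<..}.
     epowr ((\<integral>\<^sup>+t\<in>{0..u}. ennreal (gen_sval \<tau> T t powr q) \<partial>lborel) / ennreal (ln (1 + u))) (1 / q))"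

text \<open>\<open>L_space\<close> contains all elements of \<open>N\<close> of finite norm; it is the ambient normed space for
  distances and closures.  \<open>L_space_pos\<close> is the set of its positive elements.\<close>

definition L_space ::
    "('h::chilbert_space \<Rightarrow>\<^sub>L 'h) set \<Rightarrow> (('h \<Rightarrow>\<^sub>L 'h) \<Rightarrow> ennreal) \<Rightarrow> real \<Rightarrow> ('h \<Rightarrow>\<^sub>L 'h) set" where
  "L_space N \<tau> q = {T \<in> N. L_norm \<tau> q T < \<infinity>}"

definition L_space_pos ::
    "('h::chilbert_space \<Rightarrow>\<^sub>L 'h) set \<Rightarrow> (('h \<Rightarrow>\<^sub>L 'h) \<Rightarrow> ennreal) \<Rightarrow> real \<Rightarrow> ('h \<Rightarrow>\<^sub>L 'h) set" where
  "L_space_pos N \<tau> q = {T \<in> pos_part N. L_norm \<tau> q T < \<infinity>}"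

definition L1 ::
    "('h::chilbert_space \<Rightarrow>\<^sub>L 'h) set \<Rightarrow> (('h \<Rightarrow>\<^sub>L 'h) \<Rightarrow> ennreal) \<Rightarrow> ('h \<Rightarrow>\<^sub>L 'h) set" where
  "L1 N \<tau> = {A \<in> N. \<tau> (op_abs A) < \<infinity>}"

definition L_space_0 ::
    "('h::chilbert_space \<Rightarrow>\<^sub>L 'h) set \<Rightarrow> (('h \<Rightarrow>\<^sub>L 'h) \<Rightarrow> ennreal) \<Rightarrow> real \<Rightarrow> ('h \<Rightarrow>\<^sub>L 'h) set" where
  "L_space_0 N \<tau> q = {A \<in> L_space N \<tau> q. \<forall>e>0. \<exists>B\<in>L1 N \<tau>. L_norm \<tau> q (A - B) < ennreal e}"

definition L_dist ::
    "(('h::chilbert_space \<Rightarrow>\<^sub>L 'h) \<Rightarrow> ennreal) \<Rightarrow> real \<Rightarrow> ('h \<Rightarrow>\<^sub>L 'h) \<Rightarrow> ('h \<Rightarrow>\<^sub>L 'h) set \<Rightarrow> ennreal" where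
  "L_dist \<tau> q T X = (INF S\<in>X. L_norm \<tau> q (T - S))"

definition equivalent_on :: "'a set \<Rightarrow> ('a \<Rightarrow> ennreal) \<Rightarrow> ('a \<Rightarrow> ennreal) \<Rightarrow> bool" where
  "equivalent_on X f g \<longleftrightarrow>
     (\<exists>c c'::real. 0 < c \<and> c \<le> c' \<and> (\<forall>T\<in>X. ennreal c * f T \<le> g T \<and> g T \<le> ennreal c' * f T))"

end

theory Submission
  imports Defs "HOL-Probability.Helly_Selection" "HOL-Probability.Probability_Mass_Function"
    "HOL-Real_Asymp.Real_Asymp"
begin

text \<open>
  Everything is reduced to the decreasing function \<open>\<mu>\<^sub>t\<close>. The spectral theorem identifies \<open>\<tau>(T\<^sup>p)\<close>
  with \<open>\<integral> \<mu>\<^sub>t\<^sup>p dt\<close>. Let \<open>G\<close> be the limsup of \<open>\<integral>\<^sub>0\<^sup>u \<mu>\<^sub>t\<^sup>q dt / log (1 + u)\<close> for \<open>u \<rightarrow> \<infinity>\<close>. Choosing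
  \<open>p = q + 1 / log u\<close> bounds \<open>G\<close> by the limsup of \<open>(p - q) \<tau>(T\<^sup>p)\<close>, and an integration by parts gives
  the converse bound. Cutting \<open>T\<close> off at a small spectral level shows that the distance to
  \<open>L\<^sub>1\<close> is at most \<open>G\<^sup>1\<^sup>/\<^sup>q\<close>; the reverse bound follows from \<open>\<mu>\<^sub>2\<^sub>t(X + Y) \<le> 2 max (\<mu>\<^sub>t(X)) (\<mu>\<^sub>t(Y))\<close>.
  The spectral measure of a positive contraction comes from Hausdorff's moment problem for the
  sequences \<open>\<langle>x, A\<^sup>k x\<rangle>\<close>.
\<close>

section \<open>Moment problems on compact intervals\<close>

text \<open>Equivalence of seminorms tolerates constants, so every comparison of two limsups is
  proved as an implication between eventual bounds: a bound K on one side gives a bound c K^\<alpha>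
  on the other, and infinite values take care of themselves. On the operator side the device is to
  build an operator from its quadratic form. Moments determine measures on a compact interval, so
  each linear relation satisfied by all the forms <x, A^k x> is inherited by the measures of Borel
  sets and then by integrals. Additivity, commutation, idempotence and multiplicativity all become
  the vanishing of one explicit signed combination of measures on its moments or on the Borel sets.
  The estimate for \<mu> of a sum has to bound the trace of a projection P by the traces of two
  projections Q and R whose forms together are bounded below on the range of P. This is done by
  cutting P along spectral projections of compressions such as PQP, and comparing the pieces with Q
  and R through partial isometries in the algebra.\<close>

lemma binomial_difference_sum:
  fixes D :: "nat \<Rightarrow> nat \<Rightarrow> real"
  assumes D: "\<And>l k. D l k = D (Suc l) k + D l (Suc k)"
  shows "(\<Sum>i\<le>n. real (n choose i) * D (l + (n - i)) (k + i)) = D l k"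
proof (induction n arbitrary: l k)
  case 0
  show ?case by simp
next
  case (Suc n)
  \<comment> \<open>With \<open>D l k\<close> read as the integral of t^k (1-t)^l, the claim is the
    expansion of (t + (1-t))^n. Pascal's rule separates one factor, and the recurrence for
    \<open>D\<close> recombines the two halves.\<close>
  have "(\<Sum>i\<le>Suc n. real (Suc n choose i) * D (l + (Suc n - i)) (k + i))
      = D (l + Suc n) k + (\<Sum>i\<le>n. real (n choose i) * D (l + (n - i)) (k + Suc i))
        + (\<Sum>i\<le>n. real (n choose Suc i) * D (l + (n - i)) (k + Suc i))"
    by (subst sum.atMost_Suc_shift) (simp add: algebra_simps sum.distrib)
  also have "D (l + Suc n) k + (\<Sum>i\<le>n. real (n choose i) * D (l + (n - i)) (k + Suc i))
        + (\<Sum>i\<le>n. real (n choose Suc i) * D (l + (n - i)) (k + Suc i))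
     = (\<Sum>i\<le>n. real (n choose i) * D (l + (n - i)) (Suc k + i))
        + (\<Sum>i\<le>Suc n. real (n choose i) * D (l + (Suc n - i)) (k + i))"
    by (simp add: sum.atMost_Suc_shift del: sum.atMost_Suc)
  also have "(\<Sum>i\<le>Suc n. real (n choose i) * D (l + (Suc n - i)) (k + i))
      = (\<Sum>i\<le>n. real (n choose i) * D (Suc l + (n - i)) (k + i))"
    by (simp add: Suc_diff_le)
  finally show ?case using Suc.IH[of l "Suc k"] Suc.IH[of "Suc l" k] D[of l k] by simp
qed

text \<open>The ratio is the product of the factors (j-i)/(n-i). Each lies in [0,1] within i/(n-i)
  of j/n, and products of numbers in [0,1] differ by at most the sum of the differences of their
  factors. Against the Bernstein weights used next, the ratio has an exactly computable mean,
  whereas the moments call for the power of j/n.\<close>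

lemma choose_ratio_power_diff:
  assumes "j \<le> n" "2 * k < n"
  shows "\<bar>real (j choose k) / real (n choose k) - (real j / real n) ^ k\<bar>
         \<le> (\<Sum>i<k. real i / (real n - real i))"
proof -
  have ratio: "real (j choose k) / real (n choose k) = (\<Prod>i<k. real (j - i) / real (n - i))"
  proof (cases "k \<le> j")
    case True
    have "real (j choose k) / real (n choose k)
        = (\<Prod>i<k. (real (j - i) / real (k - i)) / (real (n - i) / real (k - i)))"
      using True assms by (simp add: binomial_altdef_of_nat prod_dividef lessThan_atLeast0)
    also have "\<dots> = (\<Prod>i<k. real (j - i) / real (n - i))"
      by (rule prod.cong) (use assms in auto)
    finally show ?thesis .
  next
    case False
    then have "(\<Prod>i<k. real (j - i) / real (n - i)) = 0"
      by (intro prod_zero) (auto intro!: bexI[of _ j])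
    with False show ?thesis by (simp add: binomial_eq_0)
  qed
  have "\<bar>(\<Prod>i<k. real (j - i) / real (n - i)) - (\<Prod>i<k. real j / real n)\<bar>
        \<le> (\<Sum>i<k. \<bar>real (j - i) / real (n - i) - real j / real n\<bar>)"
    unfolding real_norm_def[symmetric]
    by (rule norm_prod_diff) (use assms in \<open>auto simp: divide_le_eq_1\<close>)
  also have "\<dots> \<le> (\<Sum>i<k. real i / (real n - real i))"
  proof (rule sum_mono)
    fix i assume "i \<in> {..<k}"
    then have i: "i < n" "2 * i < n" using assms by auto
    show "\<bar>real (j - i) / real (n - i) - real j / real n\<bar> \<le> real i / (real n - real i)"
    proof (cases "i \<le> j")
      case True
      have "real (j - i) / real (n - i) - real j / real n
          = - (real i / (real n - real i)) * ((real n - real j) / real n)"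
        using i True by (simp add: of_nat_diff field_simps)
      then have "\<bar>real (j - i) / real (n - i) - real j / real n\<bar>
          = (real i / (real n - real i)) * ((real n - real j) / real n)"
        using i assms by (simp add: abs_mult abs_divide)
      also have "\<dots> \<le> (real i / (real n - real i)) * 1"
        using i assms by (intro mult_left_mono) (auto simp: divide_le_eq_1)
      finally show ?thesis by simp
    next
      case False
      then have "real j / real n \<le> real i / (real n - real i)"
        using i by (intro frac_le) auto
      with False show ?thesis by simp
    qed
  qed
  finally show ?thesis by (simp add: ratio)
qed

text \<open>\<open>D l k\<close> plays the integral of t^k (1-t)^l, and the recurrence is 1 = t +
  (1-t). Bernstein's construction: the numbers \<open>(n choose i) * D (n - i) i\<close>, normalised
  by \<open>D 0 0\<close>, form a probability law on the points i/n. These laws are tight because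
  they live on [0,1], and a weak limit has the prescribed moments up to the normalisation.\<close>

theorem hausdorff_moment_exists:
  fixes D :: "nat \<Rightarrow> nat \<Rightarrow> real"
  assumes D: "\<And>l k. D l k = D (Suc l) k + D l (Suc k)" and D_nonneg: "\<And>l k. 0 \<le> D l k"
  shows "\<exists>M. finite_measure M \<and> sets M = sets borel \<and> emeasure M (- {0..1::real}) = 0 \<and>
             (\<forall>k. (\<integral>t. t ^ k \<partial>M) = D 0 k)"
proof (cases "D 0 0 = 0")
  case True
  have "D 0 k = 0" for k
  proof (induction k)
    case (Suc k)
    then show ?case using D[of 0 k] D_nonneg[of 0 "Suc k"] D_nonneg[of 1 k] by simp
  qed (use True in simp)
  then show ?thesis
    by (intro exI[of _ "null_measure borel"]) (auto intro!: finite_measureI integral_eq_zero_AE AE_I')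
next
  case False
  define d where "d = D 0 0"
  have d: "d > 0" using False D_nonneg[of 0 0] by (simp add: d_def)
  define c where "c n i = (if i \<le> n then real (n choose i) * D (n - i) i / d else 0)" for n i
  have c_nonneg: "0 \<le> c n i" for n i using d D_nonneg by (simp add: c_def)
  have c_sum: "(\<Sum>i\<le>n. c n i) = 1" for n
    using binomial_difference_sum[of D n 0 0, OF D] d
    by (simp add: c_def d_def flip: sum_divide_distrib)
  have c_nn: "(\<integral>\<^sup>+i. ennreal (c n i) \<partial>count_space UNIV) = 1" for n
  proof -
    have "(\<integral>\<^sup>+i. ennreal (c n i) \<partial>count_space UNIV) = (\<Sum>i\<in>{..n}. ennreal (c n i))"
      by (rule nn_integral_count_space') (auto simp: c_def)
    also have "\<dots> = 1" using c_nonneg by (simp add: sum_ennreal c_sum)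
    finally show ?thesis .
  qed
  define p where "p n = embed_pmf (c n)" for n
  have pmf_p: "pmf (p n) i = c n i" for n i
    unfolding p_def by (rule Probability_Mass_Function.pmf_embed_pmf) (auto simp: c_nonneg c_nn)
  have set_p: "set_pmf (p n) \<subseteq> {..n}" for n
    by (auto simp: set_pmf_eq pmf_p c_def split: if_splits)
  \<comment> \<open>\<open>Suc n\<close> avoids the points i/0.\<close>
  define \<mu> where "\<mu> n = distr (measure_pmf (p (Suc n))) borel (\<lambda>i. real i / real (Suc n))" for n
  have real_distr: "real_distribution (\<mu> n)" for n
    unfolding \<mu>_def by (intro real_distribution.intro prob_space.intro
        real_distribution_axioms.intro measure_pmf.prob_space_distr) auto
  have \<mu>_int: "(\<integral>t. f t \<partial>\<mu> n) = (\<Sum>i\<le>Suc n. f (real i / real (Suc n)) * c (Suc n) i)"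
    if [measurable]: "f \<in> borel_measurable borel" for f :: "real \<Rightarrow> real" and n
  proof -
    have "(\<integral>t. f t \<partial>\<mu> n) = (\<integral>i. f (real i / real (Suc n)) \<partial>measure_pmf (p (Suc n)))"
      unfolding \<mu>_def by (subst integral_distr) auto
    also have "\<dots> = (\<Sum>i\<in>{..Suc n}. f (real i / real (Suc n)) * pmf (p (Suc n)) i)"
      using set_p[of "Suc n"] by (intro integral_measure_pmf_real) blast+
    finally show ?thesis by (simp only: pmf_p)
  qed
  have \<mu>_supp: "measure (\<mu> n) {0..1} = 1" for n
  proof -
    interpret real_distribution "\<mu> n" by (rule real_distr)
    have "measure (\<mu> n) {0..1} = (\<integral>t. indicator {0..1} t \<partial>\<mu> n)" by simp
    also have "\<dots> = (\<Sum>i\<le>Suc n. c (Suc n) i)"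
      by (subst \<mu>_int) (auto intro!: sum.cong simp: indicator_def divide_le_eq_1)
    finally show ?thesis by (simp only: c_sum)
  qed
  have "tight \<mu>"
    unfolding tight_def
  proof (intro conjI allI impI real_distr)
    fix e :: real assume e: "e > 0"
    have "measure (\<mu> n) {-1<..1} > 1 - e" for n
    proof -
      interpret real_distribution "\<mu> n" by (rule real_distr)
      have "measure (\<mu> n) {0..1} \<le> measure (\<mu> n) {-1<..1}" by (rule finite_measure_mono) auto
      then show ?thesis using e \<mu>_supp[of n] by simp
    qed
    then show "\<exists>a b. a < b \<and> (\<forall>n. 1 - e < measure (\<mu> n) {a<..b})"
      by (intro exI[of _ "-1"] exI[of _ 1]) auto
  qed
  from tight_imp_convergent_subsubsequence[OF this, of id] obtain r M where
    r: "strict_mono (r :: nat \<Rightarrow> nat)" and M: "real_distribution M" and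
    conv: "weak_conv_m (\<lambda>n. \<mu> (r n)) M"
    by (auto simp: o_def strict_mono_def)
  interpret M: real_distribution M by fact
  \<comment> \<open>Clamping makes t^k a bounded continuous function on the whole line and changes
    nothing on the support of the approximating laws. Pushing the limit forward along
    \<open>h\<close> at the end confines it to [0,1].\<close>
  define h where "h t = max 0 (min 1 t)" for t :: real
  have h_meas [measurable]: "h \<in> borel_measurable borel" unfolding h_def by measurable
  have lim1: "(\<lambda>n. \<integral>t. h t ^ k \<partial>\<mu> (r n)) \<longlonglongrightarrow> (\<integral>t. h t ^ k \<partial>M)" for k
  proof (rule weak_conv_imp_integral_bdd_continuous_conv[where B = 1])
    show "real_distribution (\<mu> (r n))" for n by (rule real_distr)
    show "isCont (\<lambda>t. h t ^ k) x" for x unfolding h_def by (intro continuous_intros)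
    show "norm (h t ^ k) \<le> 1" for t by (auto simp: h_def abs_le_iff power_le_one)
  qed (use M conv in auto)
  have "(\<lambda>n. (\<integral>t. h t ^ k \<partial>\<mu> n) - D 0 k / d) \<longlonglongrightarrow> 0" for k
  proof (rule Lim_null_comparison)
    show "\<forall>\<^sub>F n in sequentially. norm ((\<integral>t. h t ^ k \<partial>\<mu> n) - D 0 k / d)
            \<le> (\<Sum>i<k. real i / (real (Suc n) - real i))"
      using eventually_ge_at_top[of "2 * k"]
    proof eventually_elim
      case (elim n)
      let ?n = "Suc n"
      \<comment> \<open>The exact factorial moment: (n choose j)(j choose k) = (n choose k)(n-k
        choose j-k), and after the shift j = i + k a complete binomial sum remains, which equals
        \<open>D 0 k\<close>.\<close>
      have "(\<Sum>j\<le>?n. real (j choose k) * real (?n choose j) * D (?n - j) j)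
          = (\<Sum>j=k..?n. real (?n choose k) * (real (?n - k choose (j - k)) * D (?n - j) j))"
      proof (rule sum.mono_neutral_cong_right)
        fix j assume j: "j \<in> {k..?n}"
        then have "real (?n choose j) * real (j choose k) = real (?n choose k) * real (?n - k choose (j - k))"
          unfolding of_nat_mult[symmetric] by (subst choose_mult) auto
        then show "real (j choose k) * real (?n choose j) * D (?n - j) j
            = real (?n choose k) * (real (?n - k choose (j - k)) * D (?n - j) j)"
          by (simp add: mult_ac)
      qed (auto simp: binomial_eq_0)
      also have "\<dots> = (\<Sum>i\<le>?n - k. real (?n choose k) * (real (?n - k choose i) * D (0 + (?n - k - i)) (k + i)))"
        by (rule sum.reindex_bij_witness[where i = "\<lambda>i. i + k" and j = "\<lambda>j. j - k"]) (use elim in auto)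
      also have "\<dots> = real (?n choose k) * D 0 k"
        by (simp only: sum_distrib_left[symmetric] binomial_difference_sum[of D, OF D])
      finally have "(\<Sum>j\<le>?n. real (j choose k) / real (?n choose k) * c ?n j) = D 0 k / d"
        using elim by (simp add: c_def sum_divide_distrib[symmetric] field_simps zero_less_binomial_iff
            flip: sum_distrib_left sum_distrib_right)
      moreover have "(\<integral>t. h t ^ k \<partial>\<mu> n) = (\<Sum>j\<le>?n. (real j / real ?n) ^ k * c ?n j)"
        by (subst \<mu>_int) (auto intro!: sum.cong simp: h_def max_def min_def divide_le_eq_1 simp del: of_nat_Suc)
      ultimately have "\<bar>(\<integral>t. h t ^ k \<partial>\<mu> n) - D 0 k / d\<bar>
          = \<bar>\<Sum>j\<le>?n. ((real j / real ?n) ^ k - real (j choose k) / real (?n choose k)) * c ?n j\<bar>"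
        by (simp only: sum_subtractf left_diff_distrib)
      also have "\<dots> \<le> (\<Sum>j\<le>?n. \<bar>((real j / real ?n) ^ k - real (j choose k) / real (?n choose k)) * c ?n j\<bar>)"
        by (rule sum_abs)
      also have "\<dots> \<le> (\<Sum>j\<le>?n. (\<Sum>i<k. real i / (real ?n - real i)) * c ?n j)"
      proof (rule sum_mono)
        fix j assume "j \<in> {..?n}"
        then have "\<bar>real (j choose k) / real (?n choose k) - (real j / real ?n) ^ k\<bar>
         \<le> (\<Sum>i<k. real i / (real ?n - real i))"
          using elim by (intro choose_ratio_power_diff) auto
        then show "\<bar>((real j / real ?n) ^ k - real (j choose k) / real (?n choose k)) * c ?n j\<bar>
           \<le> (\<Sum>i<k. real i / (real ?n - real i)) * c ?n j"
          unfolding abs_mult using c_nonneg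
          by (subst abs_minus_commute) (auto intro!: mult_right_mono)
      qed
      also have "\<dots> = (\<Sum>i<k. real i / (real ?n - real i))"
        by (simp only: sum_distrib_left[symmetric] c_sum mult_1_right)
      finally show ?case by simp
    qed
    have "(\<lambda>n. \<Sum>i<k. real i / (real (Suc n) - real i)) \<longlonglongrightarrow> (\<Sum>i<k. 0)"
    proof (rule tendsto_sum)
      fix i
      have "filterlim (\<lambda>n. - real i + real (Suc n)) at_top sequentially"
        by (rule filterlim_tendsto_add_at_top[OF tendsto_const])
           (rule filterlim_compose[OF filterlim_real_sequentially filterlim_Suc])
      then show "(\<lambda>n. real i / (real (Suc n) - real i)) \<longlonglongrightarrow> 0"
        by (intro tendsto_divide_0[OF tendsto_const] filterlim_at_top_imp_at_infinity) simp
    qed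
    then show "(\<lambda>n. \<Sum>i<k. real i / (real (Suc n) - real i)) \<longlonglongrightarrow> 0" by simp
  qed
  then have "(\<lambda>n. \<integral>t. h t ^ k \<partial>\<mu> n) \<longlonglongrightarrow> D 0 k / d" for k
    by (simp add: LIM_zero_iff)
  from LIMSEQ_subseq_LIMSEQ[OF this r] have lim2: "(\<lambda>n. \<integral>t. h t ^ k \<partial>\<mu> (r n)) \<longlonglongrightarrow> D 0 k / d" for k
    by (simp add: o_def)
  have mom: "(\<integral>t. h t ^ k \<partial>M) = D 0 k / d" for k
    using LIMSEQ_unique[OF lim1 lim2] .
  define M' where "M' = density (distr M borel h) (\<lambda>_. ennreal d)"
  have "finite_measure M'"
    unfolding M'_def using M.emeasure_finite[of UNIV]
    by (intro finite_measureI) (auto simp: emeasure_density_const emeasure_distr ennreal_mult_eq_top_iff)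
  moreover have "emeasure M' (- {0..1}) = 0"
  proof -
    have "h -` (- {0..1}) \<inter> space M = {}" by (auto simp: h_def)
    then show ?thesis by (simp add: M'_def emeasure_distr emeasure_density_const)
  qed
  moreover have "(\<integral>t. t ^ k \<partial>M') = D 0 k" for k
  proof -
    have "(\<integral>t. t ^ k \<partial>M') = d * (\<integral>t. t ^ k \<partial>distr M borel h)"
      unfolding M'_def using d by (subst integral_real_density) auto
    also have "\<dots> = D 0 k" using d by (simp add: integral_distr mom)
    finally show ?thesis .
  qed
  ultimately show ?thesis by (intro exI[of _ M']) (auto simp: M'_def)
qed

section \<open>Signed combinations of measures and their moments\<close>

lemma signed_integral_zero:
  fixes \<nu> :: "'i \<Rightarrow> real measure" and f :: "real \<Rightarrow> real"
  assumes I: "finite I" and fin: "\<And>i. i \<in> I \<Longrightarrow> finite_measure (\<nu> i)"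
    and sets_\<nu>: "\<And>i. i \<in> I \<Longrightarrow> sets (\<nu> i) = sets borel"
    and zero: "\<And>S. S \<in> sets borel \<Longrightarrow> (\<Sum>i\<in>I. c i * measure (\<nu> i) S) = 0"
    and f: "f \<in> borel_measurable borel" and int: "\<And>i. i \<in> I \<Longrightarrow> integrable (\<nu> i) f"
  shows "(\<Sum>i\<in>I. c i * (\<integral>t. f t \<partial>\<nu> i)) = 0"
proof -
  have meas: "g \<in> borel_measurable (\<nu> i)" if "g \<in> borel_measurable borel" "i \<in> I" for i and g :: "real \<Rightarrow> real"
    using that by (subst measurable_cong_sets[OF sets_\<nu> refl])
  \<comment> \<open>A signed measure is a finite family of positive ones with coefficients. In the
    induction over nonnegative functions, integrability has to hold for every member of the family;
    it passes from \<open>g\<close> to its building blocks because they are dominated by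
    \<open>g\<close>.\<close>
  have nonneg_case: "(\<Sum>i\<in>I. c i * (\<integral>t. g t \<partial>\<nu> i)) = 0"
    if g: "g \<in> borel_measurable borel" "\<And>t. 0 \<le> g t" and "\<And>i. i \<in> I \<Longrightarrow> integrable (\<nu> i) g" for g :: "real \<Rightarrow> real"
    using g that(3)
  proof (induction rule: borel_measurable_induct_real)
    case (set A)
    then show ?case using zero[of A] sets_\<nu> by (simp add: sets_eq_imp_space_eq[of _ borel] cong: sum.cong)
  next
    case (mult u k)
    show ?case
    proof (cases "k = 0")
      case False
      then have "\<And>i. i \<in> I \<Longrightarrow> integrable (\<nu> i) u" using mult.prems by simp
      from mult.IH[OF this] show ?thesis
        by (simp add: mult.left_commute[of _ k] flip: sum_distrib_left)
    qed simp
  next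
    case (add u v)
    have ge: "\<bar>u t\<bar> \<le> \<bar>v t + u t\<bar>" "\<bar>v t\<bar> \<le> \<bar>v t + u t\<bar>" for t
      using add.hyps(2)[of t] add.hyps(4)[of t] by simp_all
    have "integrable (\<nu> i) u" if "i \<in> I" for i
      by (rule Bochner_Integration.integrable_bound[OF add.prems[OF that]]) (simp_all add: ge meas[OF _ that] add.hyps(1,3))
    moreover have "integrable (\<nu> i) v" if "i \<in> I" for i
      by (rule Bochner_Integration.integrable_bound[OF add.prems[OF that]]) (simp_all add: ge meas[OF _ that] add.hyps(1,3))
    ultimately show ?case using add.IH by (simp add: distrib_left sum.distrib)
  next
    case (seq U)
    have le: "U n t \<le> g t" for n t
      using seq(3,4) by (intro incseq_le) (auto simp: incseq_def le_fun_def)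
    have int_U: "integrable (\<nu> i) (U n)" if "i \<in> I" for i n
      by (rule Bochner_Integration.integrable_bound[OF seq.prems[OF that]]) (simp_all add: le meas[OF _ that] g(2) seq.hyps(1,2))
    have "(\<lambda>n. \<integral>t. U n t \<partial>\<nu> i) \<longlonglongrightarrow> (\<integral>t. g t \<partial>\<nu> i)" if "i \<in> I" for i
    proof (rule integral_dominated_convergence[where w = g])
      show "g \<in> borel_measurable (\<nu> i)" "\<And>n. U n \<in> borel_measurable (\<nu> i)"
        using g seq.hyps(1) by (auto intro: meas[OF _ that])
      show "AE t in \<nu> i. (\<lambda>n. U n t) \<longlonglongrightarrow> g t" using seq.hyps(4) by simp
      show "AE t in \<nu> i. norm (U n t) \<le> g t" for n using seq.hyps(2) le by simp
    qed (rule seq.prems[OF that])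
    then have "(\<lambda>n. \<Sum>i\<in>I. c i * (\<integral>t. U n t \<partial>\<nu> i)) \<longlonglongrightarrow> (\<Sum>i\<in>I. c i * (\<integral>t. g t \<partial>\<nu> i))"
      by (intro tendsto_sum tendsto_mult_left) blast
    moreover have "(\<Sum>i\<in>I. c i * (\<integral>t. U n t \<partial>\<nu> i)) = 0" for n
      using seq.IH int_U by blast
    ultimately show ?case by (simp add: LIMSEQ_const_iff)
  qed
  have "(\<Sum>i\<in>I. c i * (\<integral>t. max 0 (f t) \<partial>\<nu> i)) = 0" "(\<Sum>i\<in>I. c i * (\<integral>t. max 0 (- f t) \<partial>\<nu> i)) = 0"
    using f int by (intro nonneg_case; simp)+
  moreover have "(\<integral>t. f t \<partial>\<nu> i) = (\<integral>t. max 0 (f t) \<partial>\<nu> i) - (\<integral>t. max 0 (- f t) \<partial>\<nu> i)" if "i \<in> I" for i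
  proof -
    have "(\<integral>t. f t \<partial>\<nu> i) = (\<integral>t. max 0 (f t) - max 0 (- f t) \<partial>\<nu> i)"
      by (rule Bochner_Integration.integral_cong) auto
    also have "\<dots> = (\<integral>t. max 0 (f t) \<partial>\<nu> i) - (\<integral>t. max 0 (- f t) \<partial>\<nu> i)"
      using int[OF that] by (intro Bochner_Integration.integral_diff) auto
    finally show ?thesis .
  qed
  ultimately show ?thesis by (simp add: right_diff_distrib sum_subtractf)
qed

lemma integrable_bounded_on_support:
  fixes f :: "real \<Rightarrow> real"
  assumes "finite_measure M" "sets M = sets borel" "emeasure M (- {a..b}) = 0"
    and "f \<in> borel_measurable borel" "\<And>t. t \<in> {a..b} \<Longrightarrow> \<bar>f t\<bar> \<le> B"
  shows "integrable M f"
proof -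
  have "AE t in M. t \<in> {a..b}"
    using assms(2,3) by (intro AE_I[where N = "- {a..b}"]) auto
  then show ?thesis
    using assms by (intro finite_measure.integrable_const_bound[where B = B]) (auto cong: measurable_cong_sets)
qed

text \<open>Weierstrass approximation leads from polynomials to continuous functions, uniformly on
  the interval that carries all the measures. Continuous steps converging to the indicator of a
  half-line give the half-lines, and these are an intersection-stable generator of the Borel
  sets.\<close>

theorem signed_moment_zero:
  fixes \<nu> :: "'i \<Rightarrow> real measure"
  assumes I: "finite I" and fin: "\<And>i. i \<in> I \<Longrightarrow> finite_measure (\<nu> i)"
    and sets_\<nu>: "\<And>i. i \<in> I \<Longrightarrow> sets (\<nu> i) = sets borel"
    and supp: "\<And>i. i \<in> I \<Longrightarrow> emeasure (\<nu> i) (- {a..b}) = 0"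
    and mom: "\<And>k. (\<Sum>i\<in>I. c i * (\<integral>t. t ^ k \<partial>\<nu> i)) = 0"
    and S: "S \<in> sets borel"
  shows "(\<Sum>i\<in>I. c i * measure (\<nu> i) S) = 0"
proof -
  have space_\<nu>: "space (\<nu> i) = UNIV" if "i \<in> I" for i
    using sets_eq_imp_space_eq[OF sets_\<nu>[OF that]] by simp
  have meas: "g \<in> borel_measurable (\<nu> i)" if "g \<in> borel_measurable borel" "i \<in> I" for i and g :: "real \<Rightarrow> real"
    using that by (subst measurable_cong_sets[OF sets_\<nu> refl])
  have int: "integrable (\<nu> i) g" if "continuous_on UNIV g" "i \<in> I" for i and g :: "real \<Rightarrow> real"
  proof -
    have "bounded (g ` {a..b})"
      by (rule compact_imp_bounded, rule compact_continuous_image)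
         (use that continuous_on_subset in auto)
    then obtain B where "\<And>t. t \<in> {a..b} \<Longrightarrow> \<bar>g t\<bar> \<le> B"
      unfolding bounded_iff by (metis imageI real_norm_def)
    then show ?thesis
      using that fin sets_\<nu> supp by (intro integrable_bounded_on_support[of _ a b]) (auto intro: borel_measurable_continuous_onI)
  qed
  have AE_supp: "AE t in \<nu> i. t \<in> {a..b}" if "i \<in> I" for i
    using that supp sets_\<nu> by (intro AE_I[where N = "- {a..b}"]) auto
  have cont_zero: "(\<Sum>i\<in>I. c i * (\<integral>t. g t \<partial>\<nu> i)) = 0" if g: "continuous_on UNIV g" for g :: "real \<Rightarrow> real"
  proof -
    define K where "K = (\<Sum>i\<in>I. \<bar>c i\<bar> * measure (\<nu> i) UNIV)"
    have K: "K \<ge> 0" unfolding K_def by (intro sum_nonneg) auto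
    have "\<bar>\<Sum>i\<in>I. c i * (\<integral>t. g t \<partial>\<nu> i)\<bar> \<le> e * K" if e: "e > 0" for e
    proof -
      obtain p where p: "real_polynomial_function p" "\<And>x. x \<in> {a..b} \<Longrightarrow> \<bar>g x - p x\<bar> < e"
        using Stone_Weierstrass_real_polynomial_function[of "{a..b}" g e] g e
        by (metis compact_Icc continuous_on_subset subset_UNIV)
      then obtain \<alpha> n where p_eq: "p = (\<lambda>x. \<Sum>k\<le>n. \<alpha> k * x ^ k)"
        by (auto simp: real_polynomial_function_iff_sum)
      have p_cont: "continuous_on UNIV p" unfolding p_eq by (intro continuous_intros)
      have "(\<Sum>i\<in>I. c i * (\<integral>t. p t \<partial>\<nu> i)) = (\<Sum>i\<in>I. \<Sum>k\<le>n. \<alpha> k * (c i * (\<integral>t. t ^ k \<partial>\<nu> i)))"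
      proof (rule sum.cong[OF refl])
        fix i assume i: "i \<in> I"
        have "(\<integral>t. p t \<partial>\<nu> i) = (\<Sum>k\<le>n. \<alpha> k * (\<integral>t. t ^ k \<partial>\<nu> i))"
          unfolding p_eq using i by (subst Bochner_Integration.integral_sum) (auto intro!: int continuous_intros)
        then show "c i * (\<integral>t. p t \<partial>\<nu> i) = (\<Sum>k\<le>n. \<alpha> k * (c i * (\<integral>t. t ^ k \<partial>\<nu> i)))"
          by (simp add: sum_distrib_left mult_ac)
      qed
      also have "\<dots> = (\<Sum>k\<le>n. \<alpha> k * (\<Sum>i\<in>I. c i * (\<integral>t. t ^ k \<partial>\<nu> i)))"
        by (subst sum.swap) (simp add: sum_distrib_left)
      finally have p_zero: "(\<Sum>i\<in>I. c i * (\<integral>t. p t \<partial>\<nu> i)) = 0" by (simp add: mom)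
      have "\<bar>\<Sum>i\<in>I. c i * (\<integral>t. g t \<partial>\<nu> i)\<bar> = \<bar>\<Sum>i\<in>I. c i * (\<integral>t. g t - p t \<partial>\<nu> i)\<bar>"
        using p_zero g p_cont
        by (simp add: Bochner_Integration.integral_diff[OF int int] right_diff_distrib sum_subtractf)
      also have "\<dots> \<le> (\<Sum>i\<in>I. \<bar>c i * (\<integral>t. g t - p t \<partial>\<nu> i)\<bar>)" by (rule sum_abs)
      also have "\<dots> \<le> (\<Sum>i\<in>I. \<bar>c i\<bar> * (e * measure (\<nu> i) UNIV))"
      proof (rule sum_mono)
        fix i assume i: "i \<in> I"
        interpret finite_measure "\<nu> i" by (rule fin[OF i])
        have "\<bar>\<integral>t. g t - p t \<partial>\<nu> i\<bar> \<le> (\<integral>t. \<bar>g t - p t\<bar> \<partial>\<nu> i)" by (rule integral_abs_bound)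
        also have "\<dots> \<le> (\<integral>t. e \<partial>\<nu> i)"
        proof (rule integral_mono_AE)
          show "integrable (\<nu> i) (\<lambda>t. \<bar>g t - p t\<bar>)"
            using g p_cont i by (intro int continuous_intros)
          show "AE t in \<nu> i. \<bar>g t - p t\<bar> \<le> e"
            using AE_supp[OF i] by eventually_elim (use p in \<open>auto intro: less_imp_le\<close>)
        qed simp
        also have "\<dots> = e * measure (\<nu> i) UNIV" using space_\<nu>[OF i] by simp
        finally show "\<bar>c i * (\<integral>t. g t - p t \<partial>\<nu> i)\<bar> \<le> \<bar>c i\<bar> * (e * measure (\<nu> i) UNIV)"
          by (simp add: abs_mult mult_left_mono)
      qed
      also have "\<dots> = e * K" by (simp add: K_def sum_distrib_left mult_ac)
      finally show ?thesis .
    qed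
    then have "\<bar>\<Sum>i\<in>I. c i * (\<integral>t. g t \<partial>\<nu> i)\<bar> \<le> 0 + e" if "e > 0" for e
    proof -
      \<comment> \<open>Division by \<open>K + 1\<close> because the total mass \<open>K\<close> may
        be 0.\<close>
      have "e / (K + 1) * K \<le> e" using K that by (simp add: field_simps)
      with \<open>\<And>e. e > 0 \<Longrightarrow> \<bar>\<Sum>i\<in>I. c i * (\<integral>t. g t \<partial>\<nu> i)\<bar> \<le> e * K\<close>[of "e / (K + 1)"] K that
      show ?thesis by (auto intro: order_trans)
    qed
    then have "\<bar>\<Sum>i\<in>I. c i * (\<integral>t. g t \<partial>\<nu> i)\<bar> \<le> 0" by (rule field_le_epsilon)
    then show ?thesis by simp
  qed
  have atMost_zero: "(\<Sum>i\<in>I. c i * measure (\<nu> i) {..x}) = 0" for x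
  proof -
    define s where "s n = cts_step x (x + 1 / real (Suc n))" for n
    have s_cont: "continuous_on UNIV (s n)" for n
      using cts_step_uniformly_continuous[of x "x + 1 / real (Suc n)"]
      by (auto simp: s_def intro!: uniformly_continuous_imp_continuous)
    have s_lim: "(\<lambda>n. s n t) \<longlonglongrightarrow> indicator {..x} t" for t
    proof (cases "t \<le> x")
      case False
      then have "t - x > 0" by simp
      then obtain N where N: "1 / real (Suc N) < t - x" using nat_approx_posE by blast
      have "\<forall>\<^sub>F n in sequentially. s n t = indicator {..x} t"
        using eventually_ge_at_top[of N]
      proof eventually_elim
        case (elim n)
        have "1 / real (Suc n) \<le> 1 / real (Suc N)" using elim by (intro divide_left_mono) auto
        then show ?case using N False by (simp add: s_def cts_step_def)
      qed
      then show ?thesis by (rule tendsto_eventually)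
    qed (simp add: s_def cts_step_def)
    have "(\<lambda>n. \<integral>t. s n t \<partial>\<nu> i) \<longlonglongrightarrow> (\<integral>t. indicator {..x} t \<partial>\<nu> i)" if i: "i \<in> I" for i
    proof (rule integral_dominated_convergence[where w = "\<lambda>_. 1"])
      interpret finite_measure "\<nu> i" by (rule fin[OF i])
      show "integrable (\<nu> i) (\<lambda>_. 1)" by simp
      show "AE t in \<nu> i. norm (s n t) \<le> 1" for n
      proof (rule AE_I2)
        fix t
        have "\<bar>cts_step u v t\<bar> \<le> 1" if "u < v" for u v
          using that by (auto simp: cts_step_def divide_le_eq_1)
        then show "norm (s n t) \<le> 1" by (simp add: s_def)
      qed
      show "s n \<in> borel_measurable (\<nu> i)" for n
        by (rule meas[OF borel_measurable_continuous_onI[OF s_cont] i])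
      show "(\<lambda>t. indicat_real {..x} t) \<in> borel_measurable (\<nu> i)" by (rule meas[OF _ i]) simp
      show "AE t in \<nu> i. (\<lambda>n. s n t) \<longlonglongrightarrow> indicat_real {..x} t" using s_lim by simp
    qed
    then have "(\<lambda>n. \<Sum>i\<in>I. c i * (\<integral>t. s n t \<partial>\<nu> i)) \<longlonglongrightarrow> (\<Sum>i\<in>I. c i * (\<integral>t. indicator {..x} t \<partial>\<nu> i))"
      by (intro tendsto_sum tendsto_mult_left) blast
    with cont_zero[OF s_cont] show ?thesis by (simp add: LIMSEQ_const_iff space_\<nu> cong: sum.cong)
  qed
  have UNIV_zero: "(\<Sum>i\<in>I. c i * measure (\<nu> i) UNIV) = 0"
    using mom[of 0] by (simp add: space_\<nu> cong: sum.cong)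
  have "Int_stable (range (\<lambda>x::real. {..x}))" by (auto simp: Int_stable_def)
  moreover have "range (\<lambda>x::real. {..x}) \<subseteq> Pow UNIV" by simp
  moreover have "S \<in> sigma_sets UNIV (range (\<lambda>x::real. {..x}))"
    using S by (simp add: borel_eq_atMost)
  ultimately show ?thesis
  proof (induction rule: sigma_sets_induct_disjoint)
    case (compl A)
    then have A: "A \<in> sets borel" by (simp add: borel_eq_atMost)
    have "measure (\<nu> i) (UNIV - A) = measure (\<nu> i) UNIV - measure (\<nu> i) A" if "i \<in> I" for i
      using finite_measure.finite_measure_compl[OF fin[OF that], of A] A sets_\<nu>[OF that] space_\<nu>[OF that] by simp
    then show ?case using UNIV_zero compl by (simp add: right_diff_distrib sum_subtractf cong: sum.cong)
  next
    case (union A)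
    then have A: "range A \<subseteq> sets borel" by (simp add: borel_eq_atMost)
    have "(\<lambda>n. c i * measure (\<nu> i) (A n)) sums (c i * measure (\<nu> i) (\<Union>n. A n))" if "i \<in> I" for i
      using finite_measure.finite_measure_UNION[OF fin[OF that], of A] A sets_\<nu>[OF that] union
      by (intro sums_mult) auto
    then have "(\<lambda>n. \<Sum>i\<in>I. c i * measure (\<nu> i) (A n)) sums (\<Sum>i\<in>I. c i * measure (\<nu> i) (\<Union>n. A n))"
      by (rule sums_sum)
    then show ?case using union by (auto dest: sums_unique2[OF sums_zero])
  qed (use atMost_zero in auto)
qed

section \<open>Measures and functions adapted to a compact interval\<close>

definition finite_borel_on :: "real \<Rightarrow> real \<Rightarrow> real measure \<Rightarrow> bool" where
  "finite_borel_on a b M \<longleftrightarrow> finite_measure M \<and> sets M = sets borel \<and> emeasure M (- {a..b}) = 0"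

lemma finite_borel_onD:
  assumes "finite_borel_on a b M"
  shows "finite_measure M" "sets M = sets borel" "space M = UNIV" "emeasure M (- {a..b}) = 0"
    "AE t in M. t \<in> {a..b}"
proof -
  show *: "finite_measure M" "sets M = sets borel" "emeasure M (- {a..b}) = 0"
    using assms by (auto simp: finite_borel_on_def)
  show "space M = UNIV" using sets_eq_imp_space_eq[OF *(2)] by simp
  show "AE t in M. t \<in> {a..b}"
    using * by (intro AE_I[where N = "- {a..b}"]) auto
qed

lemma finite_borel_on_measurable:
  "finite_borel_on a b M \<Longrightarrow> f \<in> borel_measurable borel \<Longrightarrow> f \<in> borel_measurable M"
  by (subst measurable_cong_sets[OF finite_borel_onD(2) refl])

text \<open>Boundedness is asked only on the interval, so that polynomials and powers qualify;
  measurability is global, so that one function can be paired with every measure.\<close>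

definition bounded_borel_on :: "real \<Rightarrow> real \<Rightarrow> (real \<Rightarrow> real) \<Rightarrow> bool" where
  "bounded_borel_on a b f \<longleftrightarrow> f \<in> borel_measurable borel \<and> (\<exists>B. \<forall>t\<in>{a..b}. \<bar>f t\<bar> \<le> B)"

lemma bounded_borel_on_integrable:
  "finite_borel_on a b M \<Longrightarrow> bounded_borel_on a b f \<Longrightarrow> integrable M f"
  unfolding finite_borel_on_def bounded_borel_on_def
  using integrable_bounded_on_support by blast

lemma finite_borel_on_density:
  assumes M: "finite_borel_on a b M" and f: "bounded_borel_on a b f" and f_nonneg: "\<And>t. 0 \<le> f t"
  shows "finite_borel_on a b (density M f)"
    and "g \<in> borel_measurable borel \<Longrightarrow> (\<integral>t. g t \<partial>density M f) = (\<integral>t. f t * g t \<partial>M)"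
    and "S \<in> sets borel \<Longrightarrow> measure (density M f) S = (\<integral>t. f t * indicator S t \<partial>M)"
proof -
  note M' = finite_borel_onD[OF M]
  have f_meas: "f \<in> borel_measurable M"
    using f M by (auto simp: bounded_borel_on_def finite_borel_on_measurable)
  have int_f: "integrable M f" by (rule bounded_borel_on_integrable[OF M f])
  have "emeasure (density M f) UNIV < \<infinity>"
    using f_meas int_f f_nonneg M'(2,3)
    by (simp add: emeasure_density nn_integral_eq_integral)
  then have fin: "finite_measure (density M f)"
    using M'(3) by (intro finite_measureI) (auto simp: space_density)
  have "AE t in M. t \<in> - {a..b} \<longrightarrow> ennreal (f t) = 0"
    using M'(5) by eventually_elim auto
  then have "emeasure (density M f) (- {a..b}) = 0"
    using f_meas M'(2) by (subst emeasure_density) (auto simp: nn_integral_0_iff_AE elim!: eventually_mono split: split_indicator)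
  then show D: "finite_borel_on a b (density M f)"
    using fin M'(2) by (auto simp: finite_borel_on_def)
  show int_g: "(\<integral>t. g t \<partial>density M f) = (\<integral>t. f t * g t \<partial>M)" if "g \<in> borel_measurable borel" for g
    using that M f_meas f_nonneg by (intro integral_real_density) (auto simp: finite_borel_on_measurable)
  show "measure (density M f) S = (\<integral>t. f t * indicator S t \<partial>M)" if "S \<in> sets borel"
    using int_g[of "indicator S"] that M'(2,3) by (simp add: space_density)
qed

text \<open>Lists of coefficient-measure pairs let a polarisation be written down explicitly;
  indexing by positions keeps apart entries that happen to be the same measure.\<close>

lemma sum_list_signed:
  "(\<Sum>(c, M)\<leftarrow>L. c * F M) = (\<Sum>i<length L. fst (L ! i) * F (snd (L ! i)))" for F :: "'a \<Rightarrow> real"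
  by (simp add: sum_list_sum_nth case_prod_beta atLeast0LessThan)

lemma signed_integral_zero_list:
  assumes L: "\<And>c M. (c, M) \<in> set L \<Longrightarrow> finite_borel_on a b M"
    and zero: "\<And>S. S \<in> sets borel \<Longrightarrow> (\<Sum>(c, M)\<leftarrow>L. c * measure M S) = 0"
    and f: "bounded_borel_on a b f"
  shows "(\<Sum>(c, M)\<leftarrow>L. c * (\<integral>t. f t \<partial>M)) = 0"
proof -
  have M: "finite_borel_on a b (snd (L ! i))" if "i < length L" for i
    using L[of "fst (L ! i)" "snd (L ! i)"] that by simp
  show ?thesis
    unfolding sum_list_signed
    by (rule signed_integral_zero)
       (use zero f M in \<open>auto simp: sum_list_signed bounded_borel_on_def[of _ _ f] dest: finite_borel_onD
         intro: bounded_borel_on_integrable[OF _ f]\<close>)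
qed

lemma signed_moment_zero_list:
  assumes L: "\<And>c M. (c, M) \<in> set L \<Longrightarrow> finite_borel_on a b M"
    and mom: "\<And>k. (\<Sum>(c, M)\<leftarrow>L. c * (\<integral>t. t ^ k \<partial>M)) = 0"
    and S: "S \<in> sets borel"
  shows "(\<Sum>(c, M)\<leftarrow>L. c * measure M S) = 0"
proof -
  have M: "finite_borel_on a b (snd (L ! i))" if "i < length L" for i
    using L[of "fst (L ! i)" "snd (L ! i)"] that by simp
  show ?thesis
    unfolding sum_list_signed
    by (rule signed_moment_zero[where a = a and b = b])
       (use mom S M in \<open>auto simp: sum_list_signed dest: finite_borel_onD\<close>)
qed

section \<open>Operators on a complex Hilbert space\<close>

text \<open>The representing vector is the minimiser of the energy <x,x> - 2 f(x). Minimising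
  sequences are Cauchy by the parallelogram law, and the first variation at the minimiser
  vanishes.\<close>

theorem riesz_representation:
  fixes f :: "'a::{real_inner, complete_space} \<Rightarrow> real"
  assumes f: "bounded_linear f"
  shows "\<exists>y. \<forall>x. f x = inner y x"
proof -
  interpret f: bounded_linear f by fact
  define J where "J x = inner x x - 2 * f x" for x
  obtain K where K: "\<And>x. \<bar>f x\<bar> \<le> norm x * K" "K > 0" using f.pos_bounded by auto
  have J_bdd: "J x \<ge> - K\<^sup>2" for x
  proof -
    have "0 \<le> (norm x - K)\<^sup>2" by simp
    also have "\<dots> = (norm x)\<^sup>2 - 2 * (norm x * K) + K\<^sup>2" by (simp add: power2_eq_square algebra_simps)
    also have "\<dots> \<le> J x + K\<^sup>2" using K(1)[of x] by (simp add: J_def power2_norm_eq_inner)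
    finally show ?thesis by simp
  qed
  define m where "m = (INF x. J x)"
  have bdd: "bdd_below (range J)" using J_bdd by (intro bdd_belowI) auto
  have m_le: "m \<le> J x" for x unfolding m_def by (rule cINF_lower[OF bdd]) simp
  have "\<exists>x. J x < m + 1 / real (Suc n)" for n
  proof -
    have "(INF x. J x) < m + 1 / real (Suc n)" by (simp add: m_def)
    then show ?thesis using cINF_less_iff[OF _ bdd] by auto
  qed
  then obtain X where X: "\<And>n. J (X n) < m + 1 / real (Suc n)" by metis
  have par: "(norm (x - z))\<^sup>2 \<le> 2 * (J x - m) + 2 * (J z - m)" for x z
  proof -
    have "(norm (x - z))\<^sup>2 = 2 * J x + 2 * J z - 4 * J ((1/2) *\<^sub>R (x + z))"
      by (simp add: J_def power2_norm_eq_inner inner_add_left inner_add_right inner_diff_left inner_diff_right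
          f.add f.scaleR inner_commute[of z x] add_divide_distrib)
    also have "\<dots> \<le> 2 * (J x - m) + 2 * (J z - m)" using m_le[of "(1/2) *\<^sub>R (x + z)"] by simp
    finally show ?thesis .
  qed
  have "Cauchy X"
  proof (rule metric_CauchyI)
    fix e :: real assume e: "e > 0"
    then have "e\<^sup>2 / 4 > 0" by simp
    then obtain N where N: "1 / real (Suc N) < e\<^sup>2 / 4" using nat_approx_posE by blast
    have "dist (X i) (X j) < e" if "i \<ge> N" "j \<ge> N" for i j
    proof -
      have "1 / real (Suc i) \<le> 1 / real (Suc N)" "1 / real (Suc j) \<le> 1 / real (Suc N)"
        using that by (auto intro!: divide_left_mono)
      then have "(norm (X i - X j))\<^sup>2 < e\<^sup>2" using par[of "X i" "X j"] X[of i] X[of j] N by simp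
      then show ?thesis using e by (simp add: dist_norm power2_less_imp_less)
    qed
    then show "\<exists>M. \<forall>m\<ge>M. \<forall>n\<ge>M. dist (X m) (X n) < e" by blast
  qed
  then obtain y where y: "X \<longlonglongrightarrow> y" using Cauchy_convergent convergent_def by blast
  have "(\<lambda>n. J (X n)) \<longlonglongrightarrow> J y"
    unfolding J_def by (intro tendsto_intros y f.tendsto)
  moreover have "(\<lambda>n. m + 1 / real (Suc n)) \<longlonglongrightarrow> m + 0"
    by (intro tendsto_intros LIMSEQ_inverse_real_of_nat[unfolded inverse_eq_divide])
  ultimately have "J y \<le> m"
    using X by (intro LIMSEQ_le[of "\<lambda>n. J (X n)" _ "\<lambda>n. m + 1 / real (Suc n)"]) (auto intro: less_imp_le)
  then have min: "J y \<le> J x" for x using m_le order_trans by blast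
  have "f x = inner y x" for x
  proof (rule ccontr)
    assume neq: "f x \<noteq> inner y x"
    define d where "d = f x - inner y x"
    then have d: "d \<noteq> 0" using neq by simp
    have x: "inner x x > 0" using neq by (cases "x = 0") (auto simp: f.zero)
    \<comment> \<open>The step length d/<x,x> minimises the energy along the line through y in
      direction x.\<close>
    have "J (y + (d / inner x x) *\<^sub>R x) = J y - d\<^sup>2 / inner x x"
      using x by (simp add: J_def d_def inner_add_left inner_add_right f.add f.scaleR inner_commute[of x y]
          field_simps power2_eq_square)
    moreover have "d\<^sup>2 / inner x x > 0" using d x by simp
    ultimately show False using min[of "y + (d / inner x x) *\<^sub>R x"] by simp
  qed
  then show ?thesis by blast
qed

lemma bounded_bilinear_representation:
  fixes b :: "'a::{real_inner, complete_space} \<Rightarrow> 'a \<Rightarrow> real"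
  assumes b: "bounded_bilinear b"
  shows "\<exists>C::'a \<Rightarrow>\<^sub>L 'a. \<forall>x y. b x y = inner x (C y)"
proof -
  interpret b: bounded_bilinear b by fact
  obtain c where c: "\<And>x y. b x y = inner (c y) x"
    using riesz_representation[OF b.bounded_linear_left] by metis
  obtain K where K: "\<And>x y. \<bar>b x y\<bar> \<le> norm x * norm y * K" "K > 0"
    using b.pos_bounded by auto
  have "bounded_linear c"
  proof (rule bounded_linear_intro)
    show "c (x + y) = c x + c y" for x y
      by (rule vector_eq_rdot[THEN iffD1]) (simp add: inner_add_left b.add_right flip: c)
    show "c (r *\<^sub>R x) = r *\<^sub>R c x" for r x
      by (rule vector_eq_rdot[THEN iffD1]) (simp add: b.scaleR_right flip: c)
    show "norm (c y) \<le> norm y * K" for y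
    proof (cases "c y = 0")
      case False
      have "norm (c y) * norm (c y) = b (c y) y" by (simp add: c flip: power2_norm_eq_inner power2_eq_square)
      also have "\<dots> \<le> norm (c y) * norm y * K" using K(1)[of "c y" y] by simp
      finally show ?thesis using False by (simp add: mult.assoc)
    qed (use K in simp)
  qed
  then show ?thesis
    by (intro exI[of _ "Blinfun c"]) (simp add: c bounded_linear_Blinfun_apply inner_commute)
qed

section \<open>The complex structure in terms of the real inner product\<close>

lemma blinfun_eq_iff: "A = B \<longleftrightarrow> (\<forall>x. blinfun_apply A x = blinfun_apply B x)"
  by (auto intro: blinfun_eqI)

lemma cinner_scaleC_left: "cinner (c *\<^sub>C x) y = cnj c * cinner x (y::'h::chilbert_space)"
  by (metis cinner_commute cinner_scaleC_right complex_cnj_mult)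

lemma Im_cinner: "Im (cinner x y) = inner (\<i> *\<^sub>C x) (y::'h::chilbert_space)"
  by (simp add: inner_eq_Re_cinner cinner_scaleC_left)

lemma cinner_eqI:
  fixes x y :: "'h::chilbert_space"
  assumes "inner x y = inner x' y'" "inner (\<i> *\<^sub>C x) y = inner (\<i> *\<^sub>C x') y'"
  shows "cinner x y = cinner x' y'"
  using assms by (intro complex_eqI) (simp_all add: Im_cinner flip: inner_eq_Re_cinner)

lemma inner_scaleC_i: "inner (\<i> *\<^sub>C x) (y::'h::chilbert_space) = - inner x (\<i> *\<^sub>C y)"
  by (simp add: inner_eq_Re_cinner cinner_scaleC_left cinner_scaleC_right)

lemma scaleC_i_i: "\<i> *\<^sub>C (\<i> *\<^sub>C x) = - (x::'h::chilbert_space)"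
proof -
  have "\<i> *\<^sub>C (\<i> *\<^sub>C x) = complex_of_real (-1) *\<^sub>C x" by (simp add: scaleC_scaleC)
  also have "\<dots> = - x" by (simp only: scaleR_eq_scaleC[symmetric]) simp
  finally show ?thesis .
qed

lemma scaleC_conv: "c *\<^sub>C (x::'h::chilbert_space) = Re c *\<^sub>R x + Im c *\<^sub>R (\<i> *\<^sub>C x)"
proof -
  have "c *\<^sub>C x = (complex_of_real (Re c) + complex_of_real (Im c) * \<i>) *\<^sub>C x"
    by (metis complex_eq mult.commute)
  then show ?thesis by (simp only: scaleC_add_left scaleR_eq_scaleC scaleC_scaleC)
qed

text \<open>As a real-linear operator, multiplication by i turns complex linearity into a
  commutation relation (\<open>bops_iff_commute\<close>). Every rule saying that f(A) commutes with
  whatever commutes with A then also shows that f(A) is complex linear.\<close>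

definition mult_i :: "'h::chilbert_space \<Rightarrow>\<^sub>L 'h" where
  "mult_i = Blinfun (\<lambda>x. \<i> *\<^sub>C x)"

lemma mult_i_apply [simp]: "blinfun_apply mult_i x = \<i> *\<^sub>C (x::'h::chilbert_space)"
proof -
  have "bounded_linear (\<lambda>x::'h. \<i> *\<^sub>C x)"
  proof (rule bounded_linear_intro[where K = 1])
    show "norm (\<i> *\<^sub>C x) \<le> norm x * 1" for x :: 'h
      by (simp add: norm_eq_sqrt_inner inner_scaleC_i scaleC_i_i)
  qed (simp_all add: scaleC_add_right scaleR_eq_scaleC scaleC_scaleC mult.commute)
  then show ?thesis by (simp add: mult_i_def bounded_linear_Blinfun_apply)
qed

lemma bops_iff: "A \<in> bops \<longleftrightarrow> (\<forall>x. A (\<i> *\<^sub>C x) = \<i> *\<^sub>C A x)"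
proof
  assume *: "\<forall>x. A (\<i> *\<^sub>C x) = \<i> *\<^sub>C A x"
  then have "A (c *\<^sub>C x) = c *\<^sub>C A x" for c x
    by (simp add: scaleC_conv[of c] blinfun.add_right blinfun.scaleR_right)
  then show "A \<in> bops" by (simp add: bops_def)
qed (simp add: bops_def)

lemma bops_iff_commute: "A \<in> bops \<longleftrightarrow> A o\<^sub>L mult_i = mult_i o\<^sub>L A"
  by (auto simp: bops_iff blinfun_eq_iff)

definition sym_op :: "('h::real_inner \<Rightarrow>\<^sub>L 'h) \<Rightarrow> bool" where
  "sym_op A \<longleftrightarrow> (\<forall>x y. inner (A x) y = inner x (A y))"

lemma sym_opD: "sym_op A \<Longrightarrow> inner (A x) y = inner x (A y)"
  by (simp add: sym_op_def)

text \<open>Polarisation. Symmetry matters over the reals: the skew operator \<open>mult_i\<close>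
  has zero quadratic form.\<close>

lemma sym_op_eqI:
  assumes A: "sym_op A" and B: "sym_op B" and eq: "\<And>x. inner x (A x) = inner x (B x)"
  shows "A = B"
proof -
  have "inner x (A y) = inner x (B y)" for x y
  proof -
    have "inner x (C y) = (inner (x + y) (C (x + y)) - inner (x - y) (C (x - y))) / 4"
      if "sym_op C" for C :: "'a \<Rightarrow>\<^sub>L 'a"
      using sym_opD[OF that, of x y]
      by (simp add: inner_add_left inner_add_right inner_diff_left inner_diff_right blinfun.add_right
          blinfun.diff_right inner_commute[of y])
    then show ?thesis using A B eq by metis
  qed
  then show ?thesis by (intro blinfun_eqI) (metis vector_eq_ldot)
qed

lemma real_adjoint_exists: "\<exists>B::'h \<Rightarrow>\<^sub>L 'h. \<forall>x y. inner (B x) y = inner x (A y)"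
  for A :: "'h::chilbert_space \<Rightarrow>\<^sub>L 'h"
proof -
  have "bounded_bilinear (\<lambda>x y. inner (A x) y)"
    by (rule bounded_bilinear.comp1[OF bounded_bilinear_inner blinfun.bounded_linear_right])
  from bounded_bilinear_representation[OF this] obtain C :: "'h \<Rightarrow>\<^sub>L 'h" where "\<forall>x y. inner (A x) y = inner x (C y)" by blast
  then show ?thesis by (intro exI[of _ C]) (metis inner_commute)
qed

text \<open>For a complex-linear operator the real adjoint commutes with i, and imaginary parts are
  real inner products with i x. The real identity therefore already yields the complex one.\<close>

lemma cadjoint_eqI:
  fixes A B :: "'h::chilbert_space \<Rightarrow>\<^sub>L 'h"
  assumes A: "A \<in> bops" and B: "\<And>x y. inner (B x) y = inner x (A y)"
  shows "cadjoint A = B"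
  unfolding cadjoint_def
proof (rule the_equality)
  have "B (\<i> *\<^sub>C x) = \<i> *\<^sub>C B x" for x
  proof (rule vector_eq_rdot[THEN iffD1], intro allI)
    show "inner (B (\<i> *\<^sub>C x)) y = inner (\<i> *\<^sub>C B x) y" for y
      using A by (simp add: B inner_scaleC_i bops_iff)
  qed
  then show "\<forall>x y. cinner (B x) y = cinner x (A y)"
    by (auto intro!: cinner_eqI simp: B simp flip: B)
next
  fix C :: "'h \<Rightarrow>\<^sub>L 'h" assume "\<forall>x y. cinner (C x) y = cinner x (A y)"
  then have "inner (C x) y = inner (B x) y" for x y by (metis B inner_eq_Re_cinner)
  then show "C = B" by (intro blinfun_eqI) (metis vector_eq_rdot)
qed

lemma cadjoint:
  fixes A :: "'h::chilbert_space \<Rightarrow>\<^sub>L 'h"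
  assumes A: "A \<in> bops"
  shows cadjoint_inner: "inner (cadjoint A x) y = inner x (A y)"
    and cadjoint_inner_right: "inner x (cadjoint A y) = inner (A x) y"
    and cadjoint_bops: "cadjoint A \<in> bops"
proof -
  obtain B :: "'h \<Rightarrow>\<^sub>L 'h" where B: "\<And>x y. inner (B x) y = inner x (A y)" using real_adjoint_exists[of A] by blast
  have eq: "cadjoint A = B" by (rule cadjoint_eqI[OF A B])
  show *: "inner (cadjoint A x) y = inner x (A y)" for x y by (simp add: eq B)
  show "inner x (cadjoint A y) = inner (A x) y" by (metis * inner_commute)
  have "B (\<i> *\<^sub>C x) = \<i> *\<^sub>C B x" for x
  proof (rule vector_eq_rdot[THEN iffD1], intro allI)
    show "inner (B (\<i> *\<^sub>C x)) y = inner (\<i> *\<^sub>C B x) y" for y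
      using A by (simp add: B inner_scaleC_i bops_iff)
  qed
  then show "cadjoint A \<in> bops" by (simp add: eq bops_iff)
qed

lemma cadjoint_sym: "A \<in> bops \<Longrightarrow> sym_op A \<Longrightarrow> cadjoint A = A"
  by (rule cadjoint_eqI) (auto simp: sym_op_def)

lemma cadjoint_cadjoint: "A \<in> bops \<Longrightarrow> cadjoint (cadjoint A) = A"
  by (rule cadjoint_eqI) (auto simp: cadjoint_inner_right cadjoint_bops)

lemma projection_iff:
  "projection P \<longleftrightarrow> P \<in> bops \<and> (\<forall>x. P (P x) = P x) \<and> sym_op P"
  unfolding projection_def
  by (auto simp: blinfun_eq_iff cadjoint_sym sym_op_def) (metis blinfun_eqI cadjoint_inner)+

text \<open>Polarising the vanishing imaginary part of <x, A x> gives an antisymmetry in x and y;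
  replacing x by i x turns it into symmetry for the real inner product.\<close>

lemma sym_op_of_real_form:
  assumes A: "A \<in> bops" and real: "\<And>x. cinner x (A x) \<in> \<real>"
  shows "sym_op A"
proof -
  have zero: "inner (\<i> *\<^sub>C x) (A x) = 0" for x
    using real[of x] by (simp add: complex_is_Real_iff Im_cinner)
  have anti: "inner (\<i> *\<^sub>C x) (A y) = - inner (\<i> *\<^sub>C y) (A x)" for x y
    using zero[of "x + y"] zero[of x] zero[of y]
    by (simp add: scaleC_add_right blinfun.add_right inner_add_left inner_add_right)
  have "inner (A x) y = inner x (A y)" for x y
    using anti[of "\<i> *\<^sub>C x" y] A
    by (simp add: scaleC_i_i bops_iff inner_scaleC_i) (simp add: inner_commute)
  then show ?thesis by (simp add: sym_op_def)
qed

lemma cinner_sym: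
  assumes "A \<in> bops" "sym_op A"
  shows "cinner x (A x) = complex_of_real (inner x (A x))"
proof -
  have "inner (\<i> *\<^sub>C x) (A x) = - inner (\<i> *\<^sub>C x) (A x)"
    using assms by (metis bops_iff inner_commute inner_scaleC_i sym_opD)
  then show ?thesis by (intro complex_eqI) (simp_all add: Im_cinner flip: inner_eq_Re_cinner)
qed

lemma positive_op_iff:
  "positive_op A \<longleftrightarrow> A \<in> bops \<and> sym_op A \<and> (\<forall>x. 0 \<le> inner x (A x))"
proof
  assume "positive_op A"
  then have A: "A \<in> bops" "\<And>x. cinner x (A x) \<in> \<real>\<^sub>\<ge>\<^sub>0" by (auto simp: positive_op_def)
  then have "cinner x (A x) \<in> \<real>" for x using A(2)[of x] nonneg_Reals_subset_Reals by blast
  with A show "A \<in> bops \<and> sym_op A \<and> (\<forall>x. 0 \<le> inner x (A x))"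
    by (auto intro: sym_op_of_real_form simp: inner_eq_Re_cinner complex_nonneg_Reals_iff)
qed (auto simp: positive_op_def cinner_sym)

lemma bops_intros:
  "id_blinfun \<in> (bops :: ('h \<Rightarrow>\<^sub>L 'h) set)" "0 \<in> (bops :: ('h \<Rightarrow>\<^sub>L 'h) set)" "A \<in> bops \<Longrightarrow> B \<in> bops \<Longrightarrow> A + B \<in> bops"
  "A \<in> bops \<Longrightarrow> B \<in> bops \<Longrightarrow> A - B \<in> bops" "A \<in> bops \<Longrightarrow> r *\<^sub>R A \<in> bops"
  "A \<in> bops \<Longrightarrow> B \<in> bops \<Longrightarrow> A o\<^sub>L B \<in> bops"
  for A B :: "'h::chilbert_space \<Rightarrow>\<^sub>L 'h"
proof -
  have zero: "\<i> *\<^sub>C 0 = (0::'h)"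
    by (metis mult_i_apply blinfun.zero_right)
  have "\<i> *\<^sub>C (x - y) = \<i> *\<^sub>C x - \<i> *\<^sub>C y" "\<i> *\<^sub>C (r *\<^sub>R x) = r *\<^sub>R (\<i> *\<^sub>C x)" for x y :: 'h and r
    using blinfun.diff_right[of mult_i] blinfun.scaleR_right[of mult_i] by simp_all
  then show "id_blinfun \<in> (bops :: ('h \<Rightarrow>\<^sub>L 'h) set)" "0 \<in> (bops :: ('h \<Rightarrow>\<^sub>L 'h) set)"
   "A \<in> bops \<Longrightarrow> B \<in> bops \<Longrightarrow> A + B \<in> bops"
  "A \<in> bops \<Longrightarrow> B \<in> bops \<Longrightarrow> A - B \<in> bops" "A \<in> bops \<Longrightarrow> r *\<^sub>R A \<in> bops"
  "A \<in> bops \<Longrightarrow> B \<in> bops \<Longrightarrow> A o\<^sub>L B \<in> bops"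
    by (simp_all add: zero bops_iff blinfun.add_left blinfun.diff_left blinfun.scaleR_left scaleC_add_right)
qed

text \<open>The hypothesis \<open>lin\<close> says that \<open>q\<close> satisfies every linear relation which holds for all the
  quadratic forms \<open>\<lambda>x. inner x (B x)\<close>, \<open>B \<in> \<B>\<close>; it yields additivity and homogeneity of the polar form of \<open>q\<close> and the
  commutation rule in one stroke.\<close>

lemma quadratic_form_representation:
  fixes q :: "'h::chilbert_space \<Rightarrow> real" and \<B> :: "('h \<Rightarrow>\<^sub>L 'h) set"
  assumes sym: "\<And>B. B \<in> \<B> \<Longrightarrow> sym_op B"
    and lin: "\<And>L. (\<And>B. B \<in> \<B> \<Longrightarrow> (\<Sum>(c, u)\<leftarrow>L. c * inner u (B u)) = 0) \<Longrightarrow> (\<Sum>(c, u)\<leftarrow>L. c * q u) = 0"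
    and bound: "\<And>x. \<bar>q x\<bar> \<le> K * (norm x)\<^sup>2"
  shows "\<exists>C. sym_op C \<and> (\<forall>x. inner x (C x) = q x) \<and> (\<forall>D. (\<forall>B\<in>\<B>. B o\<^sub>L D = D o\<^sub>L B) \<longrightarrow> C o\<^sub>L D = D o\<^sub>L C)"
proof -
  define b where "b x y = (q (x + y) - q (x - y)) / 4" for x y
  have comm: "inner y (B x) = inner x (B y)" if "B \<in> \<B>" for B x y
    using sym_opD[OF sym[OF that]] by (metis inner_commute)
  note expand = inner_add_left inner_add_right inner_diff_left inner_diff_right
        blinfun.add_right blinfun.diff_right blinfun.scaleR_right
  have b_comm: "b x y = b y x" for x y
    using lin[of "[(1, x - y), (-1, y - x)]"]
    by (simp add: expand b_def add.commute)
  have b_add: "b x (y + z) = b x y + b x z" for x y z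
    using lin[of "[(1, x + (y + z)), (-1, x - (y + z)), (-1, x + y), (1, x - y), (-1, x + z), (1, x - z)]"]
    by (simp add: expand comm b_def field_simps)
  have b_scale: "b x (r *\<^sub>R y) = r * b x y" for x y r
    using lin[of "[(1, x + r *\<^sub>R y), (-1, x - r *\<^sub>R y), (- r, x + y), (r, x - y)]"]
    by (simp add: expand comm b_def field_simps)
  have b_diag: "b x x = q x" for x
    using lin[of "[(1, x + x), (-1, x - x), (-4, x)]"] by (simp add: expand b_def)
  have b_bound1: "\<bar>b x y\<bar> \<le> (K * 2 * ((norm x)\<^sup>2 + (norm y)\<^sup>2)) / 4" for x y
  proof -
    have "\<bar>b x y\<bar> \<le> (\<bar>q (x + y)\<bar> + \<bar>q (x - y)\<bar>) / 4" by (simp add: b_def)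
    also have "\<dots> \<le> (K * (norm (x + y))\<^sup>2 + K * (norm (x - y))\<^sup>2) / 4"
      using bound[of "x + y"] bound[of "x - y"] by (intro divide_right_mono add_mono) auto
    also have "\<dots> = (K * 2 * ((norm x)\<^sup>2 + (norm y)\<^sup>2)) / 4"
      by (simp add: power2_norm_eq_inner expand inner_commute[of y x] algebra_simps)
    finally show ?thesis .
  qed
  \<comment> \<open>Normalising both vectors upgrades the bound by |x|^2 + |y|^2 to one by |x|
    |y|.\<close>
  have b_bound: "\<bar>b x y\<bar> \<le> norm x * norm y * K" for x y
  proof (cases "x = 0 \<or> y = 0")
    case True
    have "b x 0 = 0" for x using b_scale[of x 0 0] by simp
    then show ?thesis using True b_comm[of 0 y] by auto
  next
    case False
    define x' y' where "x' = (1 / norm x) *\<^sub>R x" and "y' = (1 / norm y) *\<^sub>R y"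
    have xy: "x = norm x *\<^sub>R x'" "y = norm y *\<^sub>R y'" "norm x' = 1" "norm y' = 1"
      using False by (auto simp: x'_def y'_def)
    have "b x y = norm x * (norm y * b x' y')"
      by (metis xy(1,2) b_scale b_comm)
    moreover have "\<bar>b x' y'\<bar> \<le> K" using b_bound1[of x' y'] xy by simp
    ultimately show ?thesis
      by (simp add: abs_mult mult_left_mono mult.assoc)
  qed
  have "bounded_bilinear b"
  proof
    show "b (x + y) z = b x z + b y z" "b z (x + y) = b z x + b z y" for x y z
      using b_add[of z x y] by (simp_all add: b_comm[of _ z])
    show "b (r *\<^sub>R x) y = r *\<^sub>R b x y" "b x (r *\<^sub>R y) = r *\<^sub>R b x y" for x y r
      using b_scale[of x r y] b_scale[of y r x] by (simp_all add: b_comm[of _ y])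
    show "\<exists>K. \<forall>x y. norm (b x y) \<le> norm x * norm y * K" using b_bound by auto
  qed
  from bounded_bilinear_representation[OF this] obtain C :: "'h \<Rightarrow>\<^sub>L 'h" where C: "\<And>x y. b x y = inner x (C y)" by blast
  have "sym_op C" unfolding sym_op_def by (metis C b_comm inner_commute)
  moreover have "inner x (C x) = q x" for x by (simp add: b_diag flip: C)
  moreover have "C o\<^sub>L D = D o\<^sub>L C" if D: "\<And>B. B \<in> \<B> \<Longrightarrow> B o\<^sub>L D = D o\<^sub>L B" for D
  proof (rule blinfun_eqI, rule vector_eq_ldot[THEN iffD1], intro allI)
    fix x y
    obtain D' :: "'h \<Rightarrow>\<^sub>L 'h" where D': "\<And>x y. inner (D' x) y = inner x (D y)" using real_adjoint_exists[of D] by blast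
    have DB: "B (D y) = D (B y)" if "B \<in> \<B>" for B y
      using D[OF that] by (metis blinfun_apply_blinfun_compose)
    have D'': "inner x (D (B y)) = inner y (B (D' x))" if "B \<in> \<B>" for B
      using comm[OF that] D' by metis
    \<comment> \<open>\<open>D'\<close> is the real adjoint of \<open>D\<close>. For each B in the
      family the polar forms at (x, D y) and at (D' x, y) agree, so by \<open>lin\<close> they agree
      for \<open>q\<close> as well.\<close>
    have "inner x (C (D y)) = inner (D' x) (C y)"
      unfolding C[symmetric]
      using lin[of "[(1, x + D y), (-1, x - D y), (-1, D' x + y), (1, D' x - y)]"]
      by (simp add: expand comm DB D'' b_def field_simps)
    then show "inner x ((C o\<^sub>L D) y) = inner x ((D o\<^sub>L C) y)" by (simp add: D')
  qed
  ultimately show ?thesis by blast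
qed

section \<open>Projection-valued measures\<close>

lemma projectionD:
  assumes "projection P"
  shows "P \<in> bops" "P (P x) = P x" "sym_op P" "inner x (P x) = (norm (P x))\<^sup>2" "positive_op P"
proof -
  show *: "P \<in> bops" "P (P x) = P x" "sym_op P" for x using assms by (auto simp: projection_iff)
  show **: "inner x (P x) = (norm (P x))\<^sup>2" for x
    using sym_opD[OF *(3), of x "P x"] *(2) by (simp add: power2_norm_eq_inner)
  show "positive_op P" using * ** by (auto simp: positive_op_iff)
qed

lemma sym_op_compose: "sym_op A \<Longrightarrow> sym_op B \<Longrightarrow> A o\<^sub>L B = B o\<^sub>L A \<Longrightarrow> sym_op (A o\<^sub>L B)"
  for A B :: "'h::real_inner \<Rightarrow>\<^sub>L 'h"
  unfolding sym_op_def blinfun_eq_iff by simp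

lemma bounded_borel_on_indicator: "S \<in> sets borel \<Longrightarrow> bounded_borel_on a b (indicator S)"
  by (auto simp: bounded_borel_on_def intro!: exI[of _ 1] split: split_indicator)

lemma bounded_borel_on_mult:
  assumes "bounded_borel_on a b f" "bounded_borel_on a b g"
  shows "bounded_borel_on a b (\<lambda>t. f t * g t)"
proof -
  obtain B C where "\<forall>t\<in>{a..b}. \<bar>f t\<bar> \<le> B" "\<forall>t\<in>{a..b}. \<bar>g t\<bar> \<le> C"
    using assms by (auto simp: bounded_borel_on_def)
  then have "\<forall>t\<in>{a..b}. \<bar>f t * g t\<bar> \<le> B * C"
    by (auto simp: abs_mult intro!: mult_mono intro: order_trans[OF abs_ge_zero])
  then show ?thesis using assms by (auto simp: bounded_borel_on_def)
qed

lemma bounded_borel_on_add: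
  assumes "bounded_borel_on a b f" "bounded_borel_on a b g"
  shows "bounded_borel_on a b (\<lambda>t. f t + g t)"
proof -
  obtain B C where "\<forall>t\<in>{a..b}. \<bar>f t\<bar> \<le> B" "\<forall>t\<in>{a..b}. \<bar>g t\<bar> \<le> C"
    using assms by (auto simp: bounded_borel_on_def)
  then have "\<forall>t\<in>{a..b}. \<bar>f t + g t\<bar> \<le> B + C" by (fastforce intro: order_trans[OF abs_triangle_ineq])
  then show ?thesis using assms by (auto simp: bounded_borel_on_def)
qed

lemma bounded_borel_on_const: "bounded_borel_on a b (\<lambda>_. c)"
  by (auto simp: bounded_borel_on_def)

locale pvm =
  fixes E :: "real set \<Rightarrow> 'h::chilbert_space \<Rightarrow>\<^sub>L 'h" and a b :: real
  assumes proj: "S \<in> sets borel \<Longrightarrow> projection (E S)"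
    and UNIV_eq: "E UNIV = id_blinfun"
    and sums: "range F \<subseteq> sets borel \<Longrightarrow> disjoint_family F \<Longrightarrow> (\<lambda>n. E (F n) x) sums E (\<Union>n. F n) x"
    and supp: "E {a..b} = id_blinfun"
begin

lemma E_sym: "S \<in> sets borel \<Longrightarrow> sym_op (E S)"
  and E_bops: "S \<in> sets borel \<Longrightarrow> E S \<in> bops"
  using projectionD[OF proj] by auto

lemma E_empty: "E {} = 0"
proof (rule blinfun_eqI)
  fix x
  have "(\<lambda>n::nat. E {} x) sums E {} x" using sums[of "\<lambda>_. {}"] by (simp add: disjoint_family_on_def)
  then have "(\<lambda>n::nat. E {} x) \<longlonglongrightarrow> 0" by (intro summable_LIMSEQ_zero sums_summable)
  then show "E {} x = blinfun_apply 0 x" by (simp add: LIMSEQ_const_iff)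
qed

lemma E_Un:
  assumes "S \<in> sets borel" "T \<in> sets borel" "S \<inter> T = {}"
  shows "E (S \<union> T) = E S + E T"
proof (rule blinfun_eqI)
  fix x
  have "(\<lambda>n. E (binaryset S T n) x) sums E (\<Union>n. binaryset S T n) x"
    using assms by (intro sums) (auto simp: binaryset_def disjoint_family_on_def)
  moreover have "(\<lambda>n. E (binaryset S T n) x) sums (\<Sum>n\<in>{0,1}. E (binaryset S T n) x)"
    by (rule sums_finite) (auto simp: binaryset_def E_empty)
  ultimately have "E (\<Union>n. binaryset S T n) x = (\<Sum>n\<in>{0,1}. E (binaryset S T n) x)"
    by (rule sums_unique2)
  then show "E (S \<union> T) x = (E S + E T) x"
    by (simp add: UN_binaryset_eq blinfun.add_left) (simp add: binaryset_def)
qed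

text \<open>Orthogonality comes from \<open>E (S \<union> T)\<close> being a contraction: for z in
  the range of \<open>E T\<close> it forces <z, E S z> + |z|^2 \<le> |z|^2.\<close>

lemma E_disjoint:
  assumes S: "S \<in> sets borel" and T: "T \<in> sets borel" and disj: "S \<inter> T = {}"
  shows "E S (E T x) = 0"
proof -
  have ST: "projection (E (S \<union> T))" using S T by (intro proj) auto
  define z where "z = E T x"
  have z: "E T z = z" using projectionD(2)[OF proj[OF T]] by (simp add: z_def)
  have sum: "E (S \<union> T) z = E S z + z" by (simp add: E_Un S T disj blinfun.add_left z)
  have "inner z (E (S \<union> T) z) \<le> (norm z)\<^sup>2"
  proof -
    have "(norm (E (S \<union> T) z))\<^sup>2 = inner z (E (S \<union> T) z)" using projectionD(4)[OF ST] by simp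
    also have "\<dots> \<le> norm z * norm (E (S \<union> T) z)" by (rule norm_cauchy_schwarz)
    finally have "norm (E (S \<union> T) z) \<le> norm z"
      by (cases "E (S \<union> T) z = 0") (auto simp: power2_eq_square)
    then show ?thesis using norm_cauchy_schwarz[of z "E (S \<union> T) z"]
      by (smt (verit) mult_left_mono norm_ge_zero power2_eq_square)
  qed
  then have "(norm (E S z))\<^sup>2 \<le> 0"
    using projectionD(4)[OF proj[OF S], of z] by (simp add: sum inner_add_right power2_norm_eq_inner)
  then show ?thesis by (simp add: z_def)
qed

lemma E_Int:
  assumes S: "S \<in> sets borel" and T: "T \<in> sets borel"
  shows "E S (E T x) = E (S \<inter> T) x"
proof -
  have dec: "E A = E (A \<inter> B) + E (A - B)" if "A \<in> sets borel" "B \<in> sets borel" for A B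
  proof -
    have "A = (A \<inter> B) \<union> (A - B)" by auto
    then show ?thesis using that E_Un[of "A \<inter> B" "A - B"] by (metis Diff_disjoint Int_Diff Int_assoc Int_empty_right sets.Diff sets.Int inf_commute)
  qed
  have "E S (E T x) = E S (E (S \<inter> T) x) + E S (E (T - S) x)"
    using dec[OF T S] by (simp add: blinfun.add_left blinfun.add_right Int_commute)
  also have "E S (E (T - S) x) = 0" using S T by (intro E_disjoint) auto
  also have "E S (E (S \<inter> T) x) = E (S \<inter> T) (E (S \<inter> T) x) + E (S - T) (E (S \<inter> T) x)"
    using dec[OF S T] by (simp add: blinfun.add_left)
  also have "E (S - T) (E (S \<inter> T) x) = 0" using S T by (intro E_disjoint) auto
  also have "E (S \<inter> T) (E (S \<inter> T) x) = E (S \<inter> T) x" using S T by (intro projectionD(2) proj) auto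
  finally show ?thesis by simp
qed

lemma E_commute: "S \<in> sets borel \<Longrightarrow> T \<in> sets borel \<Longrightarrow> E S o\<^sub>L E T = E T o\<^sub>L E S"
  by (simp add: blinfun_eq_iff E_Int Int_commute)

lemma E_null_outside: "E (- {a..b}) = 0"
  using E_Un[of "{a..b}" "- {a..b}"] by (simp add: UNIV_eq supp)

lemma E_subset_supp: "S \<in> sets borel \<Longrightarrow> {a..b} \<subseteq> S \<Longrightarrow> E S = id_blinfun"
  using E_Int[of S "{a..b}"] by (simp add: blinfun_eq_iff supp inf_absorb2)

abbreviation V :: "'h \<Rightarrow> real measure" where "V \<equiv> vector_measure E"

lemma sets_V: "sets (V x) = sets borel" and space_V: "space (V x) = UNIV"
  using sets.sigma_sets_eq[of "borel :: real measure"] by (simp_all add: vector_measure_def)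

lemma emeasure_V:
  assumes S: "S \<in> sets borel"
  shows "emeasure (V x) S = ennreal (inner x (E S x))"
  unfolding vector_measure_def inner_eq_Re_cinner
proof (rule emeasure_measure_of_sigma)
  show "sigma_algebra UNIV (sets (borel :: real measure))"
    using sets.sigma_algebra_axioms[of "borel :: real measure"] by simp
  show "positive (sets borel) (\<lambda>S. ennreal (Re (cinner x (E S x))))"
    by (simp add: positive_def E_empty flip: inner_eq_Re_cinner)
  show "countably_additive (sets borel) (\<lambda>S. ennreal (Re (cinner x (E S x))))"
    unfolding inner_eq_Re_cinner[symmetric]
  proof (rule countably_additiveI)
    fix F :: "nat \<Rightarrow> real set" assume F: "range F \<subseteq> sets borel" "disjoint_family F"
    have "(\<lambda>n. inner x (E (F n) x)) sums inner x (E (\<Union>n. F n) x)"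
      using sums[OF F] by (rule bounded_linear.sums[OF bounded_linear_inner_right])
    moreover have "0 \<le> inner x (E (F n) x)" for n
      using F by (subst projectionD(4)[OF proj]) auto
    ultimately show "(\<Sum>n. ennreal (inner x (E (F n) x))) = ennreal (inner x (E (\<Union>n. F n) x))"
      by (intro suminf_ennreal_eq)
  qed
qed (rule S)

lemma measure_V: "S \<in> sets borel \<Longrightarrow> measure (V x) S = inner x (E S x)"
  using projectionD(4)[OF proj, of S x] by (simp add: measure_def emeasure_V)

lemma V_finite_borel: "finite_borel_on a b (V x)"
  by (auto simp: finite_borel_on_def sets_V space_V emeasure_V E_null_outside intro!: finite_measureI)

text \<open>Supplies the hypothesis \<open>lin\<close> of
  \<open>quadratic_form_representation\<close>: a linear relation between the forms of all
  \<open>E S\<close> is one between vector measures, hence one between integrals.\<close>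

lemma V_signed:
  assumes "\<And>S. S \<in> sets borel \<Longrightarrow> (\<Sum>(c, u)\<leftarrow>L. c * inner u (E S u)) = 0" and f: "bounded_borel_on a b f"
  shows "(\<Sum>(c, u)\<leftarrow>L. c * (\<integral>t. f t \<partial>V u)) = 0"
proof -
  have "(\<Sum>(c, M)\<leftarrow>map (\<lambda>(c, u). (c, V u)) L. c * (\<integral>t. f t \<partial>M)) = 0"
  proof (rule signed_integral_zero_list[OF _ _ f])
    show "(\<Sum>(c, M)\<leftarrow>map (\<lambda>(c, u). (c, V u)) L. c * measure M S) = 0" if "S \<in> sets borel" for S
      using assms(1)[OF that] that by (simp add: o_def case_prod_unfold measure_V)
  qed (auto intro: V_finite_borel)
  then show ?thesis by (simp add: o_def case_prod_unfold)
qed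

section \<open>Integration of bounded functions against a projection-valued measure\<close>

lemma psi_exists:
  assumes f: "bounded_borel_on a b f"
  shows "\<exists>C. sym_op C \<and> (\<forall>x. inner x (C x) = (\<integral>t. f t \<partial>V x)) \<and>
    (\<forall>D. (\<forall>B\<in>E ` sets borel. B o\<^sub>L D = D o\<^sub>L B) \<longrightarrow> C o\<^sub>L D = D o\<^sub>L C)"
proof -
  obtain B where B: "\<And>t. t \<in> {a..b} \<Longrightarrow> \<bar>f t\<bar> \<le> B" using f unfolding bounded_borel_on_def by blast
  show ?thesis
  proof (rule quadratic_form_representation)
    show "\<bar>\<integral>t. f t \<partial>V x\<bar> \<le> \<bar>B\<bar> * (norm x)\<^sup>2" for x
    proof -
      interpret finite_measure "V x" using finite_borel_onD(1)[OF V_finite_borel] .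
      have "\<bar>\<integral>t. f t \<partial>V x\<bar> \<le> (\<integral>t. \<bar>f t\<bar> \<partial>V x)" by (rule integral_abs_bound)
      also have "\<dots> \<le> (\<integral>t. \<bar>B\<bar> \<partial>V x)"
      proof (rule integral_mono_AE)
        show "integrable (V x) (\<lambda>t. \<bar>f t\<bar>)"
          using bounded_borel_on_integrable[OF V_finite_borel f] by simp
        show "AE t in V x. \<bar>f t\<bar> \<le> \<bar>B\<bar>"
          using finite_borel_onD(5)[OF V_finite_borel, of x] by eventually_elim (use B in force)
      qed simp
      also have "\<dots> = \<bar>B\<bar> * (norm x)\<^sup>2"
        by (simp add: space_V measure_V UNIV_eq power2_norm_eq_inner)
      finally show ?thesis .
    qed
    show "(\<Sum>(c, u)\<leftarrow>L. c * (\<integral>t. f t \<partial>V u)) = 0"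
      if "\<And>B. B \<in> E ` sets borel \<Longrightarrow> (\<Sum>(c, u)\<leftarrow>L. c * inner u (B u)) = 0" for L
      using that by (intro V_signed[OF _ f]) auto
  qed (auto intro: E_sym)
qed

text \<open>The operator integral of f with respect to \<open>E\<close>. The commutation clause is
  carried along in the choice; \<open>D\<close> ranges over all real-linear operators, so that
  \<open>mult_i\<close> is included and \<open>psi f\<close> turns out complex linear.\<close>

definition psi :: "(real \<Rightarrow> real) \<Rightarrow> 'h \<Rightarrow>\<^sub>L 'h" where
  "psi f = (SOME C. sym_op C \<and> (\<forall>x. inner x (C x) = (\<integral>t. f t \<partial>V x)) \<and>
    (\<forall>D. (\<forall>B\<in>E ` sets borel. B o\<^sub>L D = D o\<^sub>L B) \<longrightarrow> C o\<^sub>L D = D o\<^sub>L C))"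

lemma psi:
  assumes f: "bounded_borel_on a b f"
  shows psi_sym: "sym_op (psi f)" and psi_inner: "inner x (psi f x) = (\<integral>t. f t \<partial>V x)"
    and psi_commute: "(\<And>S. S \<in> sets borel \<Longrightarrow> E S o\<^sub>L D = D o\<^sub>L E S) \<Longrightarrow> psi f o\<^sub>L D = D o\<^sub>L psi f"
  using someI_ex[OF psi_exists[OF f]] unfolding psi_def[symmetric] by auto

lemma psi_eqI:
  assumes "bounded_borel_on a b f" "sym_op C" "\<And>x. inner x (C x) = (\<integral>t. f t \<partial>V x)"
  shows "psi f = C"
  using assms psi_sym psi_inner by (intro sym_op_eqI) auto

lemma psi_bops: "bounded_borel_on a b f \<Longrightarrow> psi f \<in> bops"
  unfolding bops_iff_commute using E_bops by (intro psi_commute) (auto simp: bops_iff_commute)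

lemma psi_positive:
  assumes f: "bounded_borel_on a b f" and "\<And>t. t \<in> {a..b} \<Longrightarrow> 0 \<le> f t"
  shows "positive_op (psi f)"
  unfolding positive_op_iff
proof (intro conjI allI psi_sym psi_bops f)
  fix x
  have "AE t in V x. 0 \<le> f t"
    using finite_borel_onD(5)[OF V_finite_borel, of x] by eventually_elim (use assms in auto)
  then show "0 \<le> inner x (psi f x)" by (simp add: psi_inner[OF f] integral_nonneg_AE)
qed

lemma psi_commute_E:
  assumes f: "bounded_borel_on a b f" and S: "S \<in> sets borel"
  shows "psi f o\<^sub>L E S = E S o\<^sub>L psi f"
  by (rule psi_commute[OF f]) (rule E_commute[OF _ S])

lemma psi_commute_psi:
  assumes f: "bounded_borel_on a b f" and g: "bounded_borel_on a b g"
  shows "psi f o\<^sub>L psi g = psi g o\<^sub>L psi f"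
  by (rule psi_commute[OF f]) (simp add: psi_commute_E[OF g])

lemma psi_indicator: "S \<in> sets borel \<Longrightarrow> psi (indicator S) = E S"
  by (rule psi_eqI) (auto simp: bounded_borel_on_indicator E_sym measure_V sets_V space_V)

lemma psi_add:
  assumes f: "bounded_borel_on a b f" and g: "bounded_borel_on a b g"
  shows "psi (\<lambda>t. f t + g t) = psi f + psi g"
  using assms psi_sym[OF f] psi_sym[OF g]
  by (intro psi_eqI) (auto simp: bounded_borel_on_add psi_inner blinfun.add_left inner_add_right
      bounded_borel_on_integrable[OF V_finite_borel] sym_op_def inner_add_left)

lemma psi_scale:
  assumes f: "bounded_borel_on a b f"
  shows "psi (\<lambda>t. c * f t) = c *\<^sub>R psi f"
  using psi_sym[OF f] bounded_borel_on_mult[OF bounded_borel_on_const f]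
  by (intro psi_eqI) (auto simp: psi_inner[OF f] blinfun.scaleR_left sym_op_def)

lemma psi_cong:
  assumes f: "bounded_borel_on a b f" and g: "g \<in> borel_measurable borel"
    and eq: "\<And>t. t \<in> {a..b} \<Longrightarrow> f t = g t"
  shows "psi f = psi g"
proof -
  have g': "bounded_borel_on a b g" using f g eq by (auto simp: bounded_borel_on_def)
  have "(\<integral>t. g t \<partial>V x) = (\<integral>t. f t \<partial>V x)" for x
  proof (rule integral_cong_AE)
    show "AE t in V x. g t = f t"
      using finite_borel_onD(5)[OF V_finite_borel, of x] by eventually_elim (use eq in auto)
  qed (use f g in \<open>auto simp: bounded_borel_on_def intro: finite_borel_on_measurable[OF V_finite_borel]\<close>)
  then show ?thesis using psi_sym[OF g'] psi_inner[OF g'] by (intro psi_eqI[OF f]) auto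
qed

text \<open>The measure 1_S dV_x is the polarisation of \<open>V\<close> at the pair (E S x, x),
  because <E S x, E T x> = <x, E (S \<inter> T) x>. Both sides are integrals of f against this one
  signed measure.\<close>

lemma inner_E_psi:
  assumes f: "bounded_borel_on a b f" and S: "S \<in> sets borel"
  shows "inner x (E S (psi f x)) = (\<integral>t. indicator S t * f t \<partial>V x)"
proof -
  let ?y = "E S x"
  note ind = bounded_borel_on_indicator[OF S]
  have nn: "0 \<le> indicat_real S t" for t by simp
  let ?M = "density (V x) (\<lambda>t. ennreal (indicat_real S t))"
  let ?L = "[(1/4, V (?y + x)), (-1/4, V (?y - x)), (-1, ?M)]"
  have "(\<Sum>(c, M)\<leftarrow>?L. c * (\<integral>t. f t \<partial>M)) = 0"
  proof (rule signed_integral_zero_list[OF _ _ f])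
    show "finite_borel_on a b M" if "(c, M) \<in> set ?L" for c M
      using that V_finite_borel finite_borel_on_density(1)[OF V_finite_borel ind nn] by auto
    fix T :: "real set" assume T: "T \<in> sets borel"
    have "measure ?M T = inner x (E (S \<inter> T) x)"
      using finite_borel_on_density(3)[OF V_finite_borel ind nn T] S T
      by (simp add: measure_V space_V indicator_inter_arith[symmetric])
    moreover have "inner (?y + x) (E T (?y + x)) - inner (?y - x) (E T (?y - x)) = 4 * inner x (E (S \<inter> T) x)"
      using sym_opD[OF E_sym[OF T], of x ?y] sym_opD[OF E_sym[OF S], of x "E T x"]
      by (simp add: blinfun.add_right blinfun.diff_right inner_add_left inner_add_right
          inner_diff_left inner_diff_right E_Int S T Int_commute)
    ultimately show "(\<Sum>(c, M)\<leftarrow>?L. c * measure M T) = 0"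
      using T by (simp add: measure_V)
  qed
  moreover have "(\<integral>t. f t \<partial>?M) = (\<integral>t. indicator S t * f t \<partial>V x)"
    using f by (intro finite_borel_on_density(2)[OF V_finite_borel ind nn]) (auto simp: bounded_borel_on_def)
  moreover have "inner (?y + x) (psi f (?y + x)) - inner (?y - x) (psi f (?y - x)) = 4 * inner ?y (psi f x)"
    using sym_opD[OF psi_sym[OF f], of x ?y]
    by (simp add: blinfun.add_right blinfun.diff_right inner_add_left inner_add_right
          inner_diff_left inner_diff_right inner_commute)
  ultimately show ?thesis
    using sym_opD[OF E_sym[OF S], of x "psi f x"] by (simp add: psi_inner[OF f, symmetric])
qed

text \<open>The same comparison with f dV_x instead of 1_S dV_x: by \<open>inner_E_psi\<close> it is
  the polarisation of \<open>V\<close> at (x, psi f x). Nonnegativity of f makes f dV_x a positive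
  measure.\<close>

lemma psi_mult_nonneg:
  assumes f: "bounded_borel_on a b f" and g: "bounded_borel_on a b g" and f_nonneg: "\<And>t. 0 \<le> f t"
  shows "psi g o\<^sub>L psi f = psi (\<lambda>t. g t * f t)"
proof -
  have "inner x (psi g (psi f x)) = (\<integral>t. g t * f t \<partial>V x)" for x
  proof -
    let ?y = "psi f x"
    let ?M = "density (V x) (\<lambda>t. ennreal (f t))"
    let ?L = "[(1/4, V (x + ?y)), (-1/4, V (x - ?y)), (-1, ?M)]"
    have "(\<Sum>(c, M)\<leftarrow>?L. c * (\<integral>t. g t \<partial>M)) = 0"
    proof (rule signed_integral_zero_list[OF _ _ g])
      show "finite_borel_on a b M" if "(c, M) \<in> set ?L" for c M
        using that V_finite_borel finite_borel_on_density(1)[OF V_finite_borel f f_nonneg] by auto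
      fix T :: "real set" assume T: "T \<in> sets borel"
      have "measure ?M T = inner x (E T ?y)"
        using finite_borel_on_density(3)[OF V_finite_borel f f_nonneg T] T
        by (simp add: inner_E_psi f mult.commute)
      moreover have "inner (x + ?y) (E T (x + ?y)) - inner (x - ?y) (E T (x - ?y)) = 4 * inner x (E T ?y)"
        using sym_opD[OF E_sym[OF T], of x ?y]
        by (simp add: blinfun.add_right blinfun.diff_right inner_add_left inner_add_right
            inner_diff_left inner_diff_right inner_commute[of ?y])
      ultimately show "(\<Sum>(c, M)\<leftarrow>?L. c * measure M T) = 0"
        using T by (simp add: measure_V)
    qed
    moreover have "(\<integral>t. g t \<partial>?M) = (\<integral>t. f t * g t \<partial>V x)"
      using g by (intro finite_borel_on_density(2)[OF V_finite_borel f f_nonneg]) (auto simp: bounded_borel_on_def)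
    moreover have "inner (x + ?y) (psi g (x + ?y)) - inner (x - ?y) (psi g (x - ?y)) = 4 * inner x (psi g ?y)"
      using sym_opD[OF psi_sym[OF g], of x ?y]
      by (simp add: blinfun.add_right blinfun.diff_right inner_add_left inner_add_right
            inner_diff_left inner_diff_right inner_commute[of ?y])
    ultimately show ?thesis by (simp add: psi_inner[OF g, symmetric] mult.commute)
  qed
  then show ?thesis
    by (intro psi_eqI[symmetric] sym_op_compose bounded_borel_on_mult psi_sym f g psi_commute_psi) simp
qed

lemma psi_mult:
  assumes f: "bounded_borel_on a b f" and g: "bounded_borel_on a b g"
  shows "psi g o\<^sub>L psi f = psi (\<lambda>t. g t * f t)"
proof -
  \<comment> \<open>The density argument covers nonnegative f, so a general f is split into its
    positive and negative parts.\<close>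
  define p n where "p t = max 0 (f t)" and "n t = max 0 (- f t)" for t
  have pn: "bounded_borel_on a b p" "bounded_borel_on a b n" "\<And>t. 0 \<le> p t" "\<And>t. 0 \<le> n t"
    using f unfolding bounded_borel_on_def p_def n_def
    by (auto intro!: borel_measurable_max) (metis abs_ge_minus_self abs_ge_self abs_ge_zero atLeastAtMost_iff max.bounded_iff max_def order_trans abs_le_iff abs_of_nonneg max.cobounded1)+
  have n': "bounded_borel_on a b (\<lambda>t. - 1 * n t)"
    by (rule bounded_borel_on_mult[OF bounded_borel_on_const pn(2)])
  have f_eq: "f = (\<lambda>t. p t + - 1 * n t)" by (auto simp: p_def n_def max_def)
  have "psi f = psi p + (- 1) *\<^sub>R psi n"
    by (subst f_eq) (simp only: psi_add[OF pn(1) n'] psi_scale[OF pn(2)])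
  then have "psi g o\<^sub>L psi f = (psi g o\<^sub>L psi p) + (- 1) *\<^sub>R (psi g o\<^sub>L psi n)"
    by (simp add: blinfun_eq_iff blinfun.add_left blinfun.add_right blinfun.scaleR_left blinfun.scaleR_right
        blinfun.minus_left blinfun.minus_right blinfun.diff_left blinfun.diff_right)
  also have "\<dots> = psi (\<lambda>t. g t * p t) + (- 1) *\<^sub>R psi (\<lambda>t. g t * n t)"
    by (simp only: psi_mult_nonneg pn g)
  also have "\<dots> = psi (\<lambda>t. g t * p t + - 1 * (g t * n t))"
    using bounded_borel_on_mult[OF g pn(1)] bounded_borel_on_mult[OF g pn(2)]
      bounded_borel_on_mult[OF bounded_borel_on_const bounded_borel_on_mult[OF g pn(2)]]
    by (simp only: psi_add psi_scale)
  also have "(\<lambda>t. g t * p t + - 1 * (g t * n t)) = (\<lambda>t. g t * f t)" by (subst f_eq) (auto simp: algebra_simps)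
  finally show ?thesis .
qed

text \<open>Transport of \<open>E\<close> along f; for the spectral measure of A this produces the
  spectral measure of f(A).\<close>

lemma pvm_image:
  assumes f: "f \<in> borel_measurable borel" and range: "\<And>t. t \<in> {a..b} \<Longrightarrow> f t \<in> {c..d}"
  shows "pvm (\<lambda>S. E (f -` S)) c d"
proof
  show "projection (E (f -` S))" if "S \<in> sets borel" for S
    using measurable_sets[OF f that] by (intro proj) simp
  show "(\<lambda>n. E (f -` F n) x) sums E (f -` (\<Union>n. F n)) x"
    if "range F \<subseteq> sets borel" "disjoint_family F" for F :: "nat \<Rightarrow> real set" and x
    unfolding vimage_UN using that measurable_sets[OF f]
    by (intro sums) (auto simp: disjoint_family_on_def)
  show "E (f -` {c..d}) = id_blinfun"
    using measurable_sets[OF f, of "{c..d}"] range by (intro E_subset_supp) auto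
qed (simp add: UNIV_eq)

end

section \<open>The spectral theorem for positive operators\<close>

primrec opow :: "('a::real_normed_vector \<Rightarrow>\<^sub>L 'a) \<Rightarrow> nat \<Rightarrow> 'a \<Rightarrow>\<^sub>L 'a" where
  "opow A 0 = id_blinfun"
| "opow A (Suc k) = A o\<^sub>L opow A k"

lemma opow_commute: "A o\<^sub>L D = D o\<^sub>L A \<Longrightarrow> opow A k o\<^sub>L D = D o\<^sub>L opow A k"
  by (induction k) (simp_all add: blinfun_eq_iff)

lemma opow_commute_self: "opow A k (A x) = A (opow A k x)"
  using opow_commute[of A A k] by (simp add: blinfun_eq_iff)

lemma opow_add: "opow A j (opow A k x) = opow A (j + k) x"
  by (induction j) simp_all

lemma opow_sym: "sym_op A \<Longrightarrow> sym_op (opow A k)"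
proof (induction k)
  case (Suc k)
  then show ?case using opow_commute_self[of A k] by (simp add: sym_op_def)
qed (simp add: sym_op_def)

lemma opow_scale: "opow (c *\<^sub>R A) k x = c ^ k *\<^sub>R opow A k x"
  by (induction k arbitrary: x) (simp_all add: blinfun.scaleR_left blinfun.scaleR_right)

text \<open>Two equal factors can be distributed over the two sides of the inner product, which
  lowers an exponent by 2 and replaces x by A x or (1-A) x. There remain the exponents 0 and 1, and
  A(1-A) \<ge> 0 follows from A(1-A) = A(1-A)A + (1-A)A(1-A). No square root of A is taken; its
  existence would presuppose the calculus under construction.\<close>

lemma opow_opow_positive:
  assumes sym: "sym_op A" and pos: "\<And>x. 0 \<le> inner x (A x)" and le: "\<And>x. inner x (A x) \<le> inner x x"
  shows "0 \<le> inner x (opow A k (opow (id_blinfun - A) l x))"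
proof -
  define B where "B = id_blinfun - A"
  have B: "B x = x - A x" for x by (simp add: B_def blinfun.diff_left)
  have B_sym: "sym_op B" using sym by (simp add: sym_op_def B inner_diff_left inner_diff_right)
  have B_pos: "0 \<le> inner x (B x)" for x using le[of x] by (simp add: B inner_diff_right)
  have AB: "A (B x) = B (A x)" for x by (simp add: B blinfun.diff_right)
  then have comm: "opow A k (B y) = B (opow A k y)" "A (opow B l y) = opow B l (A y)" for k l y
    using opow_commute[of A B k] opow_commute[of B A l] by (simp_all add: blinfun_eq_iff)
  have comm2: "opow A k (opow B l y) = opow B l (opow A k y)" for k l y
    using opow_commute[of B "opow A k" l] comm(1)[of k] by (simp add: blinfun_eq_iff)
  have AB_pos: "0 \<le> inner x (A (B x))" for x
  proof -
    have "A (B x) = A (B (A x)) + B (A (B x))" by (simp add: B blinfun.diff_right)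
    then have "inner x (A (B x)) = inner x (A (B (A x)) + B (A (B x)))" by (rule arg_cong)
    then have "inner x (A (B x)) = inner (A x) (B (A x)) + inner (B x) (A (B x))"
      using sym_opD[OF sym, of x] sym_opD[OF B_sym, of x] by (simp add: inner_add_right)
    then show ?thesis using pos[of "B x"] B_pos[of "A x"] by simp
  qed
  have "0 \<le> inner x (opow A k (opow B l x))"
  proof (induction "k + l" arbitrary: k l x rule: less_induct)
    case less
    consider k' where "k = Suc (Suc k')" | l' where "l = Suc (Suc l')"
      | "k = 0 \<or> k = 1" "l = 0 \<or> l = 1"
      by (metis One_nat_def not0_implies_Suc)
    then show ?case
    proof cases
      case 1
      have "inner x (opow A k (opow B l x)) = inner (A x) (opow A k' (opow B l (A x)))"
        by (simp add: 1 sym_opD[OF sym] comm(2)[symmetric] opow_commute_self)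
      then show ?thesis using less[of k' l "A x"] 1 by simp
    next
      case 2
      have "inner x (opow A k (opow B l x)) = inner (B x) (opow A k (opow B l' (B x)))"
        by (simp add: 2 sym_opD[OF B_sym] comm(1) opow_commute_self)
      then show ?thesis using less[of k l' "B x"] 2 by simp
    next
      case 3
      then show ?thesis using pos B_pos AB_pos by auto
    qed
  qed
  then show ?thesis by (simp add: B_def)
qed

text \<open>After rescaling to 0 \<le> A' \<le> 1 the numbers <x, A'^k (1-A')^l x> form an array as
  in Hausdorff's theorem, and the resulting measure is stretched back by \<open>M\<close>. The
  summand 1 in \<open>M\<close> keeps the scale positive when A = 0.\<close>

lemma moment_measure_exists:
  assumes "positive_op A"
  shows "\<exists>\<nu>. finite_borel_on 0 (norm A + 1) \<nu> \<and> (\<forall>k. (\<integral>t. t ^ k \<partial>\<nu>) = inner x (opow A k x))"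
proof -
  define M where "M = norm A + 1"
  have M: "M > 0" "norm A \<le> M" by (auto simp: M_def add_nonneg_pos)
  define A' where "A' = (1 / M) *\<^sub>R A"
  have A: "sym_op A" "\<And>x. 0 \<le> inner x (A x)" using assms by (auto simp: positive_op_iff)
  have A'_sym: "sym_op A'" using A by (simp add: A'_def sym_op_def blinfun.scaleR_left)
  have pos: "0 \<le> inner x (A' x)" for x using A M by (simp add: A'_def blinfun.scaleR_left)
  have le: "inner x (A' x) \<le> inner x x" for x
  proof -
    have "inner x (A x) \<le> norm x * norm (A x)" by (rule norm_cauchy_schwarz)
    also have "\<dots> \<le> norm x * (M * norm x)"
      using M by (intro mult_left_mono order_trans[OF norm_blinfun mult_right_mono]) auto
    also have "\<dots> = M * inner x x" by (simp add: power2_norm_eq_inner[symmetric] power2_eq_square)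
    finally show ?thesis using M by (simp add: A'_def blinfun.scaleR_left field_simps)
  qed
  define D where "D l k = inner x (opow A' k (opow (id_blinfun - A') l x))" for l k
  have comm: "A' (opow (id_blinfun - A') l y) = opow (id_blinfun - A') l (A' y)" for l y
    using opow_commute[of "id_blinfun - A'" A' l]
    by (simp add: blinfun_eq_iff blinfun.diff_left blinfun.diff_right)
  have "D l k = D (Suc l) k + D l (Suc k)" for l k
  proof -
    have "opow (id_blinfun - A') (Suc l) x + A' (opow (id_blinfun - A') l x) = opow (id_blinfun - A') l x"
      by (simp add: blinfun.diff_left)
    then have "opow A' k (opow (id_blinfun - A') l x)
       = opow A' k (opow (id_blinfun - A') (Suc l) x + A' (opow (id_blinfun - A') l x))" by (rule arg_cong[OF sym])
    also have "\<dots> = opow A' k (opow (id_blinfun - A') (Suc l) x) + opow A' (Suc k) (opow (id_blinfun - A') l x)"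
      by (simp only: blinfun.add_right opow_commute_self opow.simps(2) blinfun_apply_blinfun_compose)
    finally have "opow A' k (opow (id_blinfun - A') l x)
       = opow A' k (opow (id_blinfun - A') (Suc l) x) + opow A' (Suc k) (opow (id_blinfun - A') l x)" .
    then show ?thesis unfolding D_def inner_add_right[symmetric] by (rule arg_cong)
  qed
  moreover have "0 \<le> D l k" for l k unfolding D_def by (rule opow_opow_positive[OF A'_sym pos le])
  ultimately obtain \<mu> where \<mu>: "finite_measure \<mu>" "sets \<mu> = sets borel" "emeasure \<mu> (- {0..1}) = 0"
    "\<And>k. (\<integral>t. t ^ k \<partial>\<mu>) = D 0 k"
    using hausdorff_moment_exists[of D] by blast
  have [measurable]: "(\<lambda>t::real. M * t) \<in> measurable \<mu> borel"
    by (subst measurable_cong_sets[OF \<mu>(2) refl]) simp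
  define \<nu> where "\<nu> = distr \<mu> borel (\<lambda>t. M * t)"
  have "finite_measure \<nu>" unfolding \<nu>_def
    by (rule finite_measure.finite_measure_distr[OF \<mu>(1)]) simp
  moreover have "emeasure \<nu> (- {0..M}) = 0"
  proof -
    have "(\<lambda>t. M * t) -` (- {0..M}) = - {0..1}" using M by (auto simp: zero_le_mult_iff)
    then show ?thesis using \<mu>(3) sets_eq_imp_space_eq[OF \<mu>(2)] by (simp add: \<nu>_def emeasure_distr)
  qed
  moreover have "(\<integral>t. t ^ k \<partial>\<nu>) = inner x (opow A k x)" for k
  proof -
    have "(\<integral>t. t ^ k \<partial>\<nu>) = M ^ k * (\<integral>t. t ^ k \<partial>\<mu>)"
      by (simp add: \<nu>_def integral_distr power_mult_distrib)
    also have "\<dots> = inner x (opow A k x)"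
      using M by (simp add: \<mu>(4) D_def A'_def opow_scale power_divide)
    finally show ?thesis .
  qed
  ultimately show ?thesis
    by (intro exI[of _ \<nu>]) (auto simp: finite_borel_on_def \<nu>_def M_def)
qed

lemma bounded_borel_on_continuous:
  assumes "continuous_on UNIV f"
  shows "bounded_borel_on a b f"
proof -
  have "bounded (f ` {a..b})"
    by (rule compact_imp_bounded, rule compact_continuous_image)
       (use assms continuous_on_subset in auto)
  then show ?thesis
    using borel_measurable_continuous_onI[OF assms]
    unfolding bounded_iff bounded_borel_on_def by (metis imageI real_norm_def)
qed

text \<open>The truncation \<open>max 0 t\<close> makes the density nonnegative on the whole line,
  and on the support it is t^k.\<close>

lemma density_power:
  assumes \<nu>: "finite_borel_on 0 b \<nu>"
  defines "M \<equiv> \<lambda>k. density \<nu> (\<lambda>t. ennreal (max 0 t ^ k))"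
  shows "finite_borel_on 0 b (M k)"
    and "g \<in> borel_measurable borel \<Longrightarrow> (\<integral>t. g t \<partial>M k) = (\<integral>t. t ^ k * g t \<partial>\<nu>)"
    and "S \<in> sets borel \<Longrightarrow> measure (M k) S = (\<integral>t. t ^ k * indicator S t \<partial>\<nu>)"
proof -
  have f: "bounded_borel_on 0 b (\<lambda>t. max 0 t ^ k)" "\<And>t::real. 0 \<le> max 0 t ^ k"
    by (auto intro!: bounded_borel_on_continuous continuous_intros)
  show "finite_borel_on 0 b (M k)"
    unfolding M_def by (rule finite_borel_on_density(1)[OF \<nu> f])
  have eq: "(\<integral>t. max 0 t ^ k * g t \<partial>\<nu>) = (\<integral>t. t ^ k * g t \<partial>\<nu>)" if "g \<in> borel_measurable borel" for g
  proof (rule integral_cong_AE)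
    show "AE t in \<nu>. max 0 t ^ k * g t = t ^ k * g t"
      using finite_borel_onD(5)[OF \<nu>] by eventually_elim auto
  qed (rule finite_borel_on_measurable[OF \<nu>], use that in simp)+
  show "g \<in> borel_measurable borel \<Longrightarrow> (\<integral>t. g t \<partial>M k) = (\<integral>t. t ^ k * g t \<partial>\<nu>)"
    unfolding M_def using eq[of g] finite_borel_on_density(2)[OF \<nu> f] by simp
  show "S \<in> sets borel \<Longrightarrow> measure (M k) S = (\<integral>t. t ^ k * indicator S t \<partial>\<nu>)"
    unfolding M_def using eq[of "indicator S"] finite_borel_on_density(3)[OF \<nu> f] by simp
qed

text \<open>\<open>E S\<close> is the operator whose quadratic form is \<nu>_x(S). It exists because
  linear relations among the forms <x, A^k x> are relations among all moments, hence among the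
  measures. The commutation rule is recorded because it later puts the spectral projections of A
  into any von Neumann algebra containing A.\<close>

theorem spectral_theorem:
  assumes A: "positive_op A"
  shows "\<exists>E. is_spectral_measure A E \<and> pvm E 0 (norm A + 1) \<and>
    (\<forall>S D. A o\<^sub>L D = D o\<^sub>L A \<longrightarrow> E S o\<^sub>L D = D o\<^sub>L E S)"
proof -
  define M where "M = norm A + 1"
  have A': "A \<in> bops" "sym_op A" using A by (auto simp: positive_op_iff)
  obtain \<nu> where \<nu>: "\<And>x. finite_borel_on 0 M (\<nu> x)"
    and mom: "\<And>x k. (\<integral>t. t ^ k \<partial>\<nu> x) = inner x (opow A k x)"
    unfolding M_def using moment_measure_exists[OF A] by metis
  note \<nu>_space = finite_borel_onD(3)[OF \<nu>] and \<nu>_sets = finite_borel_onD(2)[OF \<nu>]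
  have \<nu>_UNIV: "measure (\<nu> x) UNIV = inner x x" for x
    using mom[of x 0] by (simp add: \<nu>_space)
  have "\<exists>C. sym_op C \<and> (\<forall>x. inner x (C x) = measure (\<nu> x) S) \<and>
      (\<forall>D. (\<forall>B\<in>range (opow A). B o\<^sub>L D = D o\<^sub>L B) \<longrightarrow> C o\<^sub>L D = D o\<^sub>L C)"
    if S: "S \<in> sets borel" for S
  proof (rule quadratic_form_representation)
    show "(\<Sum>(c, u)\<leftarrow>L. c * measure (\<nu> u) S) = 0"
      if L: "\<And>B. B \<in> range (opow A) \<Longrightarrow> (\<Sum>(c, u)\<leftarrow>L. c * inner u (B u)) = 0" for L
    proof -
      have "(\<Sum>(c, N)\<leftarrow>map (\<lambda>(c, u). (c, \<nu> u)) L. c * measure N S) = 0"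
      proof (rule signed_moment_zero_list[OF _ _ S])
        show "(\<Sum>(c, N)\<leftarrow>map (\<lambda>(c, u). (c, \<nu> u)) L. c * (\<integral>t. t ^ k \<partial>N)) = 0" for k
          using L[of "opow A k"] by (simp add: o_def case_prod_unfold mom)
      qed (auto intro: \<nu>)
      then show ?thesis by (simp add: o_def case_prod_unfold)
    qed
    show "\<bar>measure (\<nu> x) S\<bar> \<le> 1 * (norm x)\<^sup>2" for x
      using finite_measure.bounded_measure[OF finite_borel_onD(1)[OF \<nu>[of x]], of S] \<nu>_UNIV[of x]
      by (simp add: \<nu>_space power2_norm_eq_inner)
  qed (use A' opow_sym in auto)
  then obtain E0 where E0: "\<And>S. S \<in> sets borel \<Longrightarrow> sym_op (E0 S)"
    "\<And>S x. S \<in> sets borel \<Longrightarrow> inner x (E0 S x) = measure (\<nu> x) S"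
    "\<And>S D. S \<in> sets borel \<Longrightarrow> (\<And>k. opow A k o\<^sub>L D = D o\<^sub>L opow A k) \<Longrightarrow> E0 S o\<^sub>L D = D o\<^sub>L E0 S"
    by (metis (no_types, lifting) rangeE)
  \<comment> \<open>The value 0 off the Borel sets is the convention built into
    \<open>is_spectral_measure\<close>.\<close>
  define E where "E S = (if S \<in> sets borel then E0 S else 0)" for S
  have E_sym: "sym_op (E S)" if "S \<in> sets borel" for S using that by (simp add: E_def E0)
  have E_inner: "inner x (E S x) = measure (\<nu> x) S" if "S \<in> sets borel" for S x
    using that by (simp add: E_def E0)
  have E_comm: "E S o\<^sub>L D = D o\<^sub>L E S" if "A o\<^sub>L D = D o\<^sub>L A" for S D
    using E0(3)[of S D] opow_commute[OF that] by (auto simp: E_def blinfun_eq_iff)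
  have E_bops: "E S \<in> bops" for S
    using E_comm[of mult_i S] A' by (simp add: bops_iff_commute)
  have polar: "inner (x + y) (C (x + y)) - inner (x - y) (C (x - y)) = 4 * inner x (C y)"
    if "sym_op C" for C :: "'a \<Rightarrow>\<^sub>L 'a" and x y
    using sym_opD[OF that, of x y]
    by (simp add: blinfun.add_right blinfun.diff_right inner_add_left inner_add_right
        inner_diff_left inner_diff_right inner_commute[of y])
  text \<open>\<open>t\<^sup>k d\<nu>\<^sub>x\<close> is the polarised measure of \<open>A\<^sup>k x\<close> and \<open>x\<close>.\<close>
  have inner_opow_E: "inner (opow A k x) (E S x) = (\<integral>t. t ^ k * indicator S t \<partial>\<nu> x)"
    if S: "S \<in> sets borel" for S x k
  proof -
    let ?y = "opow A k x"
    let ?L = "[(1/4, \<nu> (?y + x)), (-1/4, \<nu> (?y - x)), (-1, density (\<nu> x) (\<lambda>t. ennreal (max 0 t ^ k)))]"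
    have "(\<Sum>(c, N)\<leftarrow>?L. c * measure N S) = 0"
    proof (rule signed_moment_zero_list[OF _ _ S])
      show "finite_borel_on 0 M N" if "(c, N) \<in> set ?L" for c N
        using that \<nu> density_power(1)[OF \<nu>] by auto
      fix j
      have "(\<integral>t. t ^ j \<partial>density (\<nu> x) (\<lambda>t. ennreal (max 0 t ^ k))) = inner x (opow A (k + j) x)"
        by (simp add: density_power(2)[OF \<nu>] mom flip: power_add)
      then show "(\<Sum>(c, N)\<leftarrow>?L. c * (\<integral>t. t ^ j \<partial>N)) = 0"
        using polar[OF opow_sym[OF A'(2)], of ?y x j] sym_opD[OF opow_sym[OF A'(2)], of k x "opow A j x"]
        by (simp add: mom opow_add)
    qed
    moreover have "measure (\<nu> (?y + x)) S - measure (\<nu> (?y - x)) S = 4 * inner ?y (E S x)"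
      using polar[OF E_sym[OF S], of ?y x] by (simp only: E_inner[OF S])
    ultimately show ?thesis by (simp add: density_power(3)[OF \<nu> S])
  qed
  have E_idem: "E S (E S x) = E S x" if S: "S \<in> sets borel" for S x
  proof -
    note ind = bounded_borel_on_indicator[OF S, of 0 M]
    have nn: "0 \<le> indicat_real S t" for t by simp
    \<comment> \<open>The measure 1_S d\<nu>_x and the polarisation of \<nu> at (x, E S x) both have
      the moments <A^k x, E S x>. Evaluating them on the set S gives idempotence.\<close>
    have "inner x (E S (E S x)) = measure (\<nu> x) S" for x
    proof -
      let ?y = "E S x"
      let ?L = "[(1/4, \<nu> (x + ?y)), (-1/4, \<nu> (x - ?y)), (-1, density (\<nu> x) (\<lambda>t. ennreal (indicat_real S t)))]"
      have "(\<Sum>(c, N)\<leftarrow>?L. c * measure N S) = 0"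
      proof (rule signed_moment_zero_list[OF _ _ S])
        show "finite_borel_on 0 M N" if "(c, N) \<in> set ?L" for c N
          using that \<nu> finite_borel_on_density(1)[OF \<nu> ind nn] by auto
        fix k
        have "(\<integral>t. t ^ k \<partial>density (\<nu> x) (\<lambda>t. ennreal (indicat_real S t))) = inner (opow A k x) ?y"
          using inner_opow_E[OF S] by (simp add: finite_borel_on_density(2)[OF \<nu> ind nn] mult.commute)
        then show "(\<Sum>(c, N)\<leftarrow>?L. c * (\<integral>t. t ^ k \<partial>N)) = 0"
          using polar[OF opow_sym[OF A'(2)], of x ?y k] sym_opD[OF opow_sym[OF A'(2)], of k x ?y]
          by (simp add: mom)
      qed
      moreover have "measure (density (\<nu> x) (\<lambda>t. ennreal (indicat_real S t))) S = measure (\<nu> x) S"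
        using finite_borel_on_density(3)[OF \<nu> ind nn S, of x] S \<nu>_sets \<nu>_space
        by (simp flip: indicator_inter_arith)
      moreover have "measure (\<nu> (x + ?y)) S - measure (\<nu> (x - ?y)) S = 4 * inner x (E S ?y)"
        using polar[OF E_sym[OF S], of x ?y] by (simp only: E_inner[OF S])
      ultimately show ?thesis by simp
    qed
    then have "E S o\<^sub>L E S = E S"
      by (intro sym_op_eqI[OF sym_op_compose[OF E_sym[OF S] E_sym[OF S] refl] E_sym[OF S]]) (simp add: E_inner[OF S])
    then show ?thesis by (simp add: blinfun_eq_iff)
  qed
  have E_proj: "projection (E S)" if "S \<in> sets borel" for S
    using that E_bops E_idem E_sym by (simp add: projection_iff)
  have E_Un: "E (S \<union> T) = E S + E T" if S: "S \<in> sets borel" and T: "T \<in> sets borel" and "S \<inter> T = {}" for S T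
  proof (rule sym_op_eqI)
    show "sym_op (E S + E T)" using E_sym[OF S] E_sym[OF T]
      by (simp add: sym_op_def blinfun.add_left inner_add_left inner_add_right)
    fix x
    show "inner x (E (S \<union> T) x) = inner x ((E S + E T) x)"
      using S T that(3) finite_measure.finite_measure_Union[OF finite_borel_onD(1)[OF \<nu>[of x]], of S T]
      by (simp add: blinfun.add_left inner_add_right E_inner \<nu>_sets)
  qed (use S T in \<open>auto intro: E_sym\<close>)
  have E_UNIV: "E UNIV = id_blinfun"
    by (rule sym_op_eqI) (auto simp: E_sym E_inner \<nu>_UNIV, simp add: sym_op_def)
  have E_supp: "E {0..M} = id_blinfun"
  proof (rule sym_op_eqI)
    show "inner x (E {0..M} x) = inner x (id_blinfun x)" for x
    proof -
      have "measure (\<nu> x) (- {0..M}) = 0" using finite_borel_onD(4)[OF \<nu>[of x]] by (simp add: measure_def)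
      moreover have "measure (\<nu> x) (- {0..M}) = measure (\<nu> x) UNIV - measure (\<nu> x) {0..M}"
        using finite_measure.finite_measure_compl[OF finite_borel_onD(1)[OF \<nu>[of x]], of "{0..M}"]
        by (simp add: \<nu>_sets \<nu>_space Compl_eq_Diff_UNIV)
      ultimately show ?thesis by (simp add: E_inner \<nu>_UNIV)
    qed
  qed (auto simp: E_sym, simp add: sym_op_def)
  have E_sums: "(\<lambda>n. E (F n) x) sums E (\<Union>n. F n) x"
    if F: "range F \<subseteq> sets borel" "disjoint_family F" for F :: "nat \<Rightarrow> real set" and x
  proof -
    define U where "U = (\<Union>n. F n)"
    define G where "G n = (\<Union>i<n. F i)" for n
    have Fb: "F i \<in> sets borel" for i using F by auto
    have U: "U \<in> sets borel" and G: "G n \<in> sets borel" for n unfolding U_def G_def using Fb by auto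
    have E_empty: "E {} = 0" using E_Un[of "{}" "{}"] by simp
    have partial: "(\<Sum>i<n. E (F i) x) = E (G n) x" for n
    proof (induction n)
      case (Suc n)
      have "F i \<inter> F n = {}" if "i < n" for i using F(2) that by (simp add: disjoint_family_on_def)
      then have "G n \<inter> F n = {}" by (auto simp: G_def)
      moreover have "G (Suc n) = G n \<union> F n" by (auto simp: G_def lessThan_Suc)
      ultimately show ?case using Suc by (simp add: E_Un G Fb blinfun.add_left)
    qed (simp add: G_def E_empty)
    have "(\<lambda>n. measure (\<nu> x) (G n)) \<longlonglongrightarrow> measure (\<nu> x) (\<Union>n. G n)"
      by (rule finite_measure.finite_Lim_measure_incseq[OF finite_borel_onD(1)[OF \<nu>]])
         (use G in \<open>auto simp: \<nu>_sets incseq_def G_def intro: less_le_trans\<close>)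
    moreover have "(\<Union>n. G n) = U" by (auto simp: G_def U_def)
    ultimately have lim: "(\<lambda>n. measure (\<nu> x) U - measure (\<nu> x) (G n)) \<longlonglongrightarrow> measure (\<nu> x) U - measure (\<nu> x) U"
      by (intro tendsto_intros) simp
    \<comment> \<open>The squared norm of a remainder is the measure of the remaining set, so
      continuity of the measure gives convergence in norm of the partial sums.\<close>
    have norm_eq: "(norm (E (G n) x - E U x))\<^sup>2 = measure (\<nu> x) U - measure (\<nu> x) (G n)" for n
    proof -
      have sub: "G n \<subseteq> U" by (auto simp: G_def U_def)
      then have "E U = E (G n) + E (U - G n)" using E_Un[of "G n" "U - G n"] U G by (simp add: Un_absorb1)
      then have "(norm (E (G n) x - E U x))\<^sup>2 = (norm (E (U - G n) x))\<^sup>2" by (simp add: blinfun.add_left)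
      also have "\<dots> = measure (\<nu> x) (U - G n)"
        using projectionD(4)[OF E_proj, of "U - G n" x] U G by (simp add: E_inner)
      also have "\<dots> = measure (\<nu> x) U - measure (\<nu> x) (G n)"
        using sub U G by (intro finite_measure.finite_measure_Diff[OF finite_borel_onD(1)[OF \<nu>]]) (auto simp: \<nu>_sets)
      finally show ?thesis .
    qed
    have "(\<lambda>n. (norm (E (G n) x - E U x))\<^sup>2) \<longlonglongrightarrow> 0" using lim by (simp add: norm_eq)
    then have "(\<lambda>n. sqrt ((norm (E (G n) x - E U x))\<^sup>2)) \<longlonglongrightarrow> sqrt 0" by (intro tendsto_intros)
    then have "(\<lambda>n. E (G n) x) \<longlonglongrightarrow> E U x" by (simp add: tendsto_norm_zero_iff LIM_zero_iff)
    then show ?thesis by (simp add: sums_def partial U_def)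
  qed
  have pvm: "pvm E 0 M" by standard (auto intro: E_proj E_UNIV E_supp E_sums)
  interpret pvm E 0 M by (rule pvm)
  have V_eq: "vector_measure E x = \<nu> x" for x
  proof (rule measure_eqI)
    fix S assume "S \<in> sets (vector_measure E x)"
    then have "S \<in> sets borel" by (simp add: sets_V)
    then show "emeasure (vector_measure E x) S = emeasure (\<nu> x) S"
      using finite_measure.emeasure_eq_measure[OF finite_borel_onD(1)[OF \<nu>]]
      by (simp add: emeasure_V E_inner)
  qed (simp add: sets_V \<nu>_sets)
  have "is_spectral_measure A E"
    unfolding is_spectral_measure_def
  proof (intro conjI ballI allI impI)
    show "\<exists>R. E {- R..R} = id_blinfun"
    proof (intro exI[of _ M] E_subset_supp)
      have "0 \<le> M" using norm_ge_zero[of A] unfolding M_def by linarith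
      then show "{0..M} \<subseteq> {- M..M}" by auto
    qed simp
    show "cinner x (A x) = complex_of_real (\<integral>s. s \<partial>vector_measure E x)" for x
      using mom[of x 1] by (simp add: cinner_sym[OF A'] V_eq)
    show "E S = 0" if "S \<notin> sets borel" for S using that by (simp add: E_def)
  qed (simp_all add: E_proj E_UNIV E_sums)
  with pvm E_comm show ?thesis unfolding M_def by blast
qed

section \<open>Functional calculus of positive operators\<close>

lemma (in pvm) pvm_widen: "c \<le> a \<Longrightarrow> b \<le> d \<Longrightarrow> pvm E c d"
  by standard (auto intro: proj UNIV_eq sums E_subset_supp)

lemma (in pvm) E_cong:
  assumes "S \<in> sets borel" "T \<in> sets borel" "S \<inter> {a..b} = T \<inter> {a..b}"
  shows "E S = E T"
  using E_Int[of S "{a..b}"] E_Int[of T "{a..b}"] assms by (simp add: blinfun_eq_iff supp)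

lemma (in pvm) psi_power:
  assumes A: "sym_op A" "\<And>x. inner x (A x) = (\<integral>t. t \<partial>V x)"
  shows "psi (\<lambda>t. t ^ k) = opow A k"
proof (induction k)
  case 0
  have "psi (\<lambda>t. 1) = id_blinfun"
    by (rule psi_eqI[OF bounded_borel_on_const]) (simp_all add: sym_op_def measure_V space_V UNIV_eq)
  then show ?case by simp
next
  case (Suc k)
  have bb: "bounded_borel_on a b (\<lambda>t. t)" "bounded_borel_on a b (\<lambda>t. t ^ k)"
    by (auto intro!: bounded_borel_on_continuous continuous_intros)
  have "psi (\<lambda>t. t) = A" by (rule psi_eqI[OF bb(1)]) (use A in auto)
  then show ?case using psi_mult[OF bb(2) bb(1)] Suc by simp
qed

lemma is_spectral_measure_pvm:
  assumes "is_spectral_measure A E"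
  obtains R where "pvm E (- R) R"
proof -
  from assms obtain R where "E {- R..R} = id_blinfun" by (auto simp: is_spectral_measure_def)
  with assms have "pvm E (- R) R" by unfold_locales (auto simp: is_spectral_measure_def)
  with that show ?thesis .
qed

lemma is_spectral_measure_inner:
  assumes "is_spectral_measure A E"
  shows "inner x (A x) = (\<integral>t. t \<partial>vector_measure E x)"
  using assms by (simp add: is_spectral_measure_def inner_eq_Re_cinner)

text \<open>By multiplicativity of \<open>psi\<close> every spectral measure of A has the moments
  <x, A^k x>, which determine its vector measures. The definition only provides some bounded support
  for each, so both are first placed in a common interval.\<close>

lemma spectral_measure_unique:
  assumes A: "positive_op A" and E: "is_spectral_measure A E" and E': "is_spectral_measure A E'"
  shows "E = E'"
proof
  fix S
  show "E S = E' S"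
  proof (cases "S \<in> sets borel")
    case S: True
    obtain R R' where R: "pvm E (- R) R" "pvm E' (- R') R'"
      using is_spectral_measure_pvm E E' by metis
    define M where "M = max R R'"
    interpret E: pvm E "- M" M by (rule pvm.pvm_widen[OF R(1)]) (auto simp: M_def)
    interpret E': pvm E' "- M" M by (rule pvm.pvm_widen[OF R(2)]) (auto simp: M_def)
    have sym: "sym_op A" using A by (simp add: positive_op_iff)
    have bb: "bounded_borel_on (- M) M (\<lambda>t. t ^ k)" for k
      by (auto intro!: bounded_borel_on_continuous continuous_intros)
    have "inner x (E S x) = inner x (E' S x)" for x
    proof -
      have mom: "(\<integral>t. t ^ k \<partial>E.V x) = (\<integral>t. t ^ k \<partial>E'.V x)" for k
        using E.psi_power[OF sym is_spectral_measure_inner[OF E], of k]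
          E'.psi_power[OF sym is_spectral_measure_inner[OF E'], of k]
        by (metis E.psi_inner[OF bb] E'.psi_inner[OF bb])
      have "(\<Sum>(c, N)\<leftarrow>[(1, E.V x), (-1, E'.V x)]. c * measure N S) = 0"
        by (rule signed_moment_zero_list[where a = "- M" and b = M, OF _ _ S]) (auto simp: E.V_finite_borel E'.V_finite_borel mom)
      then show ?thesis using S by (simp add: E.measure_V E'.measure_V)
    qed
    then show ?thesis using E.E_sym E'.E_sym S by (intro sym_op_eqI) auto
  qed (use E E' in \<open>simp add: is_spectral_measure_def\<close>)
qed

lemma spectral_measure_eqI: "positive_op A \<Longrightarrow> is_spectral_measure A E \<Longrightarrow> spectral_measure A = E"
  unfolding spectral_measure_def by (rule the_equality) (auto intro: spectral_measure_unique)

lemma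
  assumes "positive_op A"
  shows is_spectral_measure_spectral_measure: "is_spectral_measure A (spectral_measure A)"
    and pvm_spectral_measure: "pvm (spectral_measure A) 0 (norm A + 1)"
    and spectral_measure_commute: "A o\<^sub>L D = D o\<^sub>L A \<Longrightarrow> spectral_measure A S o\<^sub>L D = D o\<^sub>L spectral_measure A S"
  using spectral_theorem[OF assms] spectral_measure_eqI[OF assms] by auto

lemma spectral_measure_projection:
  "positive_op A \<Longrightarrow> S \<in> sets borel \<Longrightarrow> projection (spectral_measure A S)"
  using pvm.proj[OF pvm_spectral_measure] .

text \<open>The interval [0, |A| + 1] carries the spectral measure of a positive A.\<close>

abbreviation admissible :: "('h::chilbert_space \<Rightarrow>\<^sub>L 'h) \<Rightarrow> (real \<Rightarrow> real) \<Rightarrow> bool" where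
  "admissible A \<equiv> bounded_borel_on 0 (norm A + 1)"

lemma fun_calc_eq_psi:
  assumes A: "positive_op A" and f: "admissible A f"
  shows "fun_calc f A = pvm.psi (spectral_measure A) f"
proof -
  interpret pvm "spectral_measure A" 0 "norm A + 1" by (rule pvm_spectral_measure[OF A])
  show ?thesis
    unfolding fun_calc_def
  proof (rule the_equality)
    show "psi f \<in> bops \<and> (\<forall>x. cinner x (psi f x) = complex_of_real (\<integral>t. f t \<partial>V x))"
      using psi_bops[OF f] psi_sym[OF f] by (simp add: cinner_sym psi_inner[OF f])
    fix B assume B: "B \<in> bops \<and> (\<forall>x. cinner x (B x) = complex_of_real (\<integral>t. f t \<partial>V x))"
    have "psi f = B"
      by (rule psi_eqI[OF f]) (use B in \<open>auto intro!: sym_op_of_real_form simp: inner_eq_Re_cinner\<close>)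
    then show "B = psi f" by simp
  qed
qed

section \<open>Rules of the functional calculus for one positive operator\<close>

context
  fixes A :: "'h::chilbert_space \<Rightarrow>\<^sub>L 'h"
  assumes A: "positive_op A"
begin

interpretation pvm "spectral_measure A" 0 "norm A + 1" by (rule pvm_spectral_measure[OF A])

lemma fun_calc_sym: "admissible A f \<Longrightarrow> sym_op (fun_calc f A)"
  and fun_calc_bops: "admissible A f \<Longrightarrow> fun_calc f A \<in> bops"
  and fun_calc_inner: "admissible A f \<Longrightarrow> inner x (fun_calc f A x) = (\<integral>t. f t \<partial>vector_measure (spectral_measure A) x)"
  by (simp_all add: fun_calc_eq_psi A psi_sym psi_bops psi_inner)

lemma fun_calc_eqI:
  "admissible A f \<Longrightarrow> sym_op C \<Longrightarrow> (\<And>x. inner x (C x) = (\<integral>t. f t \<partial>vector_measure (spectral_measure A) x))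
    \<Longrightarrow> fun_calc f A = C"
  by (simp add: fun_calc_eq_psi A psi_eqI)

lemma fun_calc_positive:
  "admissible A f \<Longrightarrow> (\<And>t. 0 \<le> t \<Longrightarrow> t \<le> norm A + 1 \<Longrightarrow> 0 \<le> f t) \<Longrightarrow> positive_op (fun_calc f A)"
  by (auto simp: fun_calc_eq_psi A intro!: psi_positive)

lemma fun_calc_commute: "admissible A f \<Longrightarrow> A o\<^sub>L D = D o\<^sub>L A \<Longrightarrow> fun_calc f A o\<^sub>L D = D o\<^sub>L fun_calc f A"
  using spectral_measure_commute[OF A] by (simp add: fun_calc_eq_psi A psi_commute)

lemma fun_calc_add:
  "admissible A f \<Longrightarrow> admissible A g \<Longrightarrow> fun_calc (\<lambda>t. f t + g t) A = fun_calc f A + fun_calc g A"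
  by (simp add: fun_calc_eq_psi A psi_add bounded_borel_on_add)

lemma fun_calc_scale: "admissible A f \<Longrightarrow> fun_calc (\<lambda>t. c * f t) A = c *\<^sub>R fun_calc f A"
  using bounded_borel_on_mult[OF bounded_borel_on_const, of 0 "norm A + 1" f c]
  by (simp add: fun_calc_eq_psi A psi_scale)

lemma fun_calc_mult:
  "admissible A f \<Longrightarrow> admissible A g \<Longrightarrow> fun_calc f A o\<^sub>L fun_calc g A = fun_calc (\<lambda>t. f t * g t) A"
  by (simp add: fun_calc_eq_psi A psi_mult bounded_borel_on_mult)

lemma fun_calc_cong:
  assumes f: "admissible A f" and g: "g \<in> borel_measurable borel"
    and eq: "\<And>t. 0 \<le> t \<Longrightarrow> t \<le> norm A + 1 \<Longrightarrow> f t = g t"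
  shows "fun_calc f A = fun_calc g A"
proof -
  have "admissible A g" using f g eq by (auto simp: bounded_borel_on_def)
  with psi_cong[OF f g] eq show ?thesis by (simp add: fun_calc_eq_psi A f)
qed

lemma fun_calc_indicator: "S \<in> sets borel \<Longrightarrow> fun_calc (indicator S) A = spectral_measure A S"
  by (simp add: fun_calc_eq_psi A bounded_borel_on_indicator psi_indicator)

lemma fun_calc_id: "fun_calc (\<lambda>t. t) A = A"
  using A is_spectral_measure_inner[OF is_spectral_measure_spectral_measure[OF A]]
  by (intro fun_calc_eqI bounded_borel_on_continuous continuous_intros) (auto simp: positive_op_iff)

lemma fun_calc_one: "fun_calc (\<lambda>t. 1) A = id_blinfun"
  using fun_calc_indicator[of UNIV] by (simp add: UNIV_eq indicator_def cong: if_cong)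

lemma fun_calc_mono:
  assumes f: "admissible A f" and g: "admissible A g"
    and le: "\<And>t. 0 \<le> t \<Longrightarrow> t \<le> norm A + 1 \<Longrightarrow> f t \<le> g t"
  shows "fun_calc f A \<preceq> fun_calc g A"
proof -
  have f': "admissible A (\<lambda>t. - 1 * f t)" by (rule bounded_borel_on_mult[OF bounded_borel_on_const f])
  have "fun_calc (\<lambda>t. g t + - 1 * f t) A = fun_calc g A - fun_calc f A"
    by (simp only: fun_calc_add[OF g f'] fun_calc_scale[OF f]) simp
  then show ?thesis
    using fun_calc_positive[OF bounded_borel_on_add[OF g f']] le by (simp add: op_le_def)
qed

text \<open>The image of the spectral measure of A under f is a spectral measure of f(A), and
  uniqueness identifies the two. Composition of functions is then the change of variables for image
  measures.\<close>

lemma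
  assumes f: "admissible A f" and nonneg: "\<And>t. 0 \<le> t \<Longrightarrow> t \<le> norm A + 1 \<Longrightarrow> 0 \<le> f t"
  defines "B \<equiv> fun_calc f A"
  shows spectral_measure_fun_calc: "S \<in> sets borel \<Longrightarrow> spectral_measure B S = spectral_measure A (f -` S)"
    and fun_calc_fun_calc: "admissible B g \<Longrightarrow> admissible A (\<lambda>t. g (f t)) \<Longrightarrow> fun_calc g B = fun_calc (\<lambda>t. g (f t)) A"
proof -
  have f_meas: "f \<in> borel_measurable borel" using f by (simp add: bounded_borel_on_def)
  have B: "positive_op B" unfolding B_def by (rule fun_calc_positive[OF f nonneg])
  obtain C where C: "\<And>t. t \<in> {0..norm A + 1} \<Longrightarrow> \<bar>f t\<bar> \<le> C" using f unfolding bounded_borel_on_def by blast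
  define F where "F S = (if S \<in> sets borel then spectral_measure A (f -` S) else 0)" for S
  have vim: "f -` S \<in> sets borel" if "S \<in> sets borel" for S
    using measurable_sets[OF f_meas that] by simp
  have "f t \<in> {- C..C}" if "t \<in> {0..norm A + 1}" for t using C[OF that] by auto
  then interpret F0: pvm "\<lambda>S. spectral_measure A (f -` S)" "- C" C
    by (intro pvm_image f_meas)
  interpret F: pvm F "- C" C
    by standard (use F0.proj F0.UNIV_eq F0.sums F0.supp in \<open>auto simp: F_def\<close>)
  have V_eq: "vector_measure F x = distr (vector_measure (spectral_measure A) x) borel f" for x
  proof (rule measure_eqI)
    fix S assume "S \<in> sets (vector_measure F x)"
    then have S: "S \<in> sets borel" by (simp add: F.sets_V)
    have f': "f \<in> measurable (vector_measure (spectral_measure A) x) borel"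
      by (rule finite_borel_on_measurable[OF V_finite_borel f_meas])
    show "emeasure (vector_measure F x) S = emeasure (distr (vector_measure (spectral_measure A) x) borel f) S"
      using S by (simp add: emeasure_distr[OF f' S] space_V F.emeasure_V emeasure_V[OF vim] F_def)
  qed (simp add: F.sets_V)
  have int: "(\<integral>t. g t \<partial>vector_measure F x) = (\<integral>t. g (f t) \<partial>vector_measure (spectral_measure A) x)"
    if "g \<in> borel_measurable borel" for g :: "real \<Rightarrow> real" and x
    unfolding V_eq using that
    by (intro integral_distr finite_borel_on_measurable[OF V_finite_borel f_meas]) auto
  have "is_spectral_measure B F"
    unfolding is_spectral_measure_def
  proof (intro conjI ballI allI impI)
    show "\<exists>R. F {- R..R} = id_blinfun" using F.supp by blast
    show "cinner x (B x) = complex_of_real (\<integral>s. s \<partial>vector_measure F x)" for x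
      using B by (simp add: positive_op_iff cinner_sym int) (simp add: B_def fun_calc_inner[OF f])
    show "F UNIV = id_blinfun" by (simp add: F_def UNIV_eq)
    show "F S = 0" if "S \<notin> sets borel" for S using that by (simp add: F_def)
  qed (simp_all add: F.proj F.sums)
  then have eq: "spectral_measure B = F" by (rule spectral_measure_eqI[OF B])
  then show "S \<in> sets borel \<Longrightarrow> spectral_measure B S = spectral_measure A (f -` S)" by (simp add: F_def)
  show "fun_calc g B = fun_calc (\<lambda>t. g (f t)) A" if g: "admissible B g" "admissible A (\<lambda>t. g (f t))"
  proof -
    interpret B: pvm "spectral_measure B" 0 "norm B + 1" by (rule pvm_spectral_measure[OF B])
    show ?thesis
      using g(1) unfolding fun_calc_eq_psi[OF B g(1)]
      by (intro B.psi_eqI[OF g(1)] fun_calc_sym g) (simp add: fun_calc_inner[OF g(2)] eq int bounded_borel_on_def)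
  qed
qed

end

section \<open>Powers and the absolute value\<close>

lemma admissible_powr: "0 < p \<Longrightarrow> admissible A (\<lambda>t. t powr p)"
  unfolding bounded_borel_on_def
  by (intro conjI exI[of _ "(norm A + 1) powr p"]) (auto intro!: powr_mono2)

lemma op_powr_positive: "positive_op A \<Longrightarrow> 0 < p \<Longrightarrow> positive_op (op_powr A p)"
  unfolding op_powr_def by (intro fun_calc_positive admissible_powr) auto

lemma op_powr_op_powr:
  assumes A: "positive_op A" and p: "0 < p" and r: "0 < r"
  shows "op_powr (op_powr A p) r = op_powr A (p * r)"
proof -
  have "op_powr (op_powr A p) r = fun_calc (\<lambda>t. (t powr p) powr r) A"
    unfolding op_powr_def
    using p r by (intro fun_calc_fun_calc[OF A] admissible_powr) (simp_all add: powr_powr admissible_powr)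
  then show ?thesis by (simp add: powr_powr op_powr_def)
qed

lemma op_powr_one:
  assumes "positive_op A"
  shows "op_powr A 1 = A"
proof -
  have "op_powr A 1 = fun_calc (\<lambda>t. t) A"
    unfolding op_powr_def by (rule fun_calc_cong[OF assms admissible_powr]) auto
  then show ?thesis by (simp add: fun_calc_id[OF assms])
qed

lemma op_powr_two:
  assumes A: "positive_op A"
  shows "A o\<^sub>L A = op_powr A 2"
proof -
  have id: "admissible A (\<lambda>t. t)" by (intro bounded_borel_on_continuous continuous_intros)
  have "A o\<^sub>L A = fun_calc (\<lambda>t. t * t) A"
    using fun_calc_mult[OF A id id] by (simp add: fun_calc_id[OF A])
  also have "\<dots> = op_powr A 2"
    unfolding op_powr_def
    by (rule fun_calc_cong[OF A bounded_borel_on_mult[OF id id]]) (auto simp: powr_numeral power2_eq_square)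
  finally show ?thesis .
qed

lemma op_abs_positive:
  assumes A: "positive_op A"
  shows "op_abs A = A"
proof -
  have "cadjoint A = A" using A by (simp add: positive_op_iff cadjoint_sym)
  then show ?thesis
    by (simp add: op_abs_def op_powr_two[OF A] op_powr_op_powr[OF A] op_powr_one[OF A])
qed

lemma cadjoint_compose_positive:
  assumes "A \<in> bops"
  shows "positive_op (cadjoint A o\<^sub>L A)"
  using assms
  by (auto simp: positive_op_iff bops_intros cadjoint_bops sym_op_def cadjoint_inner cadjoint_inner_right)

lemma positive_op_abs: "A \<in> bops \<Longrightarrow> positive_op (op_abs A)"
  unfolding op_abs_def by (intro op_powr_positive cadjoint_compose_positive) auto

text \<open>For t \<ge> 0 the square root of t exceeds s exactly when t > s^2. The right-hand side
  is the usable one: the form of \<open>cadjoint A o\<^sub>L A\<close> is |A x|^2, to which the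
  estimates for sums apply.\<close>

lemma spectral_measure_op_abs:
  assumes A: "A \<in> bops" and s: "0 \<le> s"
  shows "spectral_measure (op_abs A) {s<..} = spectral_measure (cadjoint A o\<^sub>L A) {s\<^sup>2<..}"
proof -
  let ?H = "cadjoint A o\<^sub>L A"
  have H: "positive_op ?H" by (rule cadjoint_compose_positive[OF A])
  interpret pvm "spectral_measure ?H" 0 "norm ?H + 1" by (rule pvm_spectral_measure[OF H])
  have "spectral_measure (op_abs A) {s<..} = spectral_measure ?H ((\<lambda>t. t powr (1/2)) -` {s<..})"
    unfolding op_abs_def op_powr_def by (intro spectral_measure_fun_calc[OF H] admissible_powr) auto
  also have "\<dots> = spectral_measure ?H {s\<^sup>2<..}"
  proof (rule E_cong)
    have "(\<lambda>t. t powr (1/2)) \<in> borel_measurable (borel :: real measure)" by measurable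
    from measurable_sets[OF this, of "{s<..}"] show "(\<lambda>t. t powr (1/2)) -` {s<..} \<in> sets (borel :: real measure)" by simp
    have "s < t powr (1/2) \<longleftrightarrow> s\<^sup>2 < t" if "0 \<le> t" for t
      using that s by (simp add: powr_half_sqrt) (metis real_sqrt_less_iff real_sqrt_unique)
    then show "(\<lambda>t. t powr (1/2)) -` {s<..} \<inter> {0..norm ?H + 1} = {s\<^sup>2<..} \<inter> {0..norm ?H + 1}" by auto
  qed simp
  finally show ?thesis .
qed

section \<open>Traces and spectral projections\<close>

lemma op_le_iff:
  assumes "A \<in> bops" "B \<in> bops" "sym_op A" "sym_op B"
  shows "A \<preceq> B \<longleftrightarrow> (\<forall>x. inner x (A x) \<le> inner x (B x))"
proof -
  have "sym_op (B - A)"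
    using assms(3,4) by (simp add: sym_op_def blinfun.diff_left inner_diff_left inner_diff_right)
  then show ?thesis
    using bops_intros(4)[OF assms(2,1)] by (simp add: op_le_def positive_op_iff blinfun.diff_left inner_diff_right)
qed

lemma op_le_inner: "A \<preceq> B \<Longrightarrow> inner x (A x) \<le> inner x (B x)"
  by (simp add: op_le_def positive_op_iff blinfun.diff_left inner_diff_right)

text \<open>On [0, |A| + 1] the function t is at most s plus |A| + 1 times the indicator of t > s,
  and the calculus is monotone.\<close>

lemma inner_spectral_upper:
  assumes A: "positive_op A" and s: "0 \<le> s"
  shows "inner x (A x) \<le> s * (norm x)\<^sup>2 + (norm A + 1) * inner x (spectral_measure A {s<..} x)"
proof -
  have bb: "admissible A (\<lambda>t. t)" by (intro bounded_borel_on_continuous continuous_intros)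
  have bb': "admissible A (\<lambda>t. s * 1)" "admissible A (\<lambda>t. (norm A + 1) * indicator {s<..} t)"
    "admissible A (\<lambda>t. 1)" "admissible A (indicator {s<..})"
    by (auto intro!: bounded_borel_on_mult bounded_borel_on_const bounded_borel_on_indicator)
  have "fun_calc (\<lambda>t. t) A \<preceq> fun_calc (\<lambda>t. s * 1 + (norm A + 1) * indicator {s<..} t) A"
    by (rule fun_calc_mono[OF A bb bounded_borel_on_add[OF bb'(1,2)]]) (use s in \<open>auto split: split_indicator\<close>)
  also have "fun_calc (\<lambda>t. s * 1 + (norm A + 1) * indicator {s<..} t) A
      = s *\<^sub>R id_blinfun + (norm A + 1) *\<^sub>R spectral_measure A {s<..}"
    by (simp only: fun_calc_add[OF A bb'(1,2)] fun_calc_scale[OF A] bb' fun_calc_one[OF A] fun_calc_indicator[OF A borel_open[OF open_greaterThan]])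
  finally have "A \<preceq> s *\<^sub>R id_blinfun + (norm A + 1) *\<^sub>R spectral_measure A {s<..}"
    by (simp only: fun_calc_id[OF A])
  from op_le_inner[OF this, of x] show ?thesis
    by (simp add: blinfun.add_left blinfun.scaleR_left inner_add_right power2_norm_eq_inner)
qed

text \<open>The vector measure of such an x gives no mass to the complement of
  \<open>{s<..}\<close>, so the mean of t is at least s times its total mass.\<close>

lemma inner_spectral_lower:
  assumes A: "positive_op A" and x: "spectral_measure A {s<..} x = x"
  shows "s * (norm x)\<^sup>2 \<le> inner x (A x)"
proof -
  interpret pvm "spectral_measure A" 0 "norm A + 1" by (rule pvm_spectral_measure[OF A])
  interpret finite_measure "V x" using finite_borel_onD(1)[OF V_finite_borel] .
  have "measure (V x) (- {s<..}) = 0"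
    using finite_measure_compl[of "{s<..}"] x
    by (simp add: sets_V space_V measure_V UNIV_eq Compl_eq_Diff_UNIV)
  then have AE: "AE t in V x. s \<le> t"
    by (intro AE_I[where N = "- {s<..}"]) (auto simp: emeasure_eq_measure sets_V)
  have bb: "bounded_borel_on 0 (norm A + 1) (\<lambda>t. t)" by (intro bounded_borel_on_continuous continuous_intros)
  have "s * (norm x)\<^sup>2 = (\<integral>t. s \<partial>V x)"
    by (simp add: space_V measure_V UNIV_eq power2_norm_eq_inner)
  also have "\<dots> \<le> (\<integral>t. t \<partial>V x)"
    by (rule integral_mono_AE[OF _ bounded_borel_on_integrable[OF V_finite_borel bb] AE]) simp
  also have "\<dots> = inner x (A x)" using fun_calc_inner[OF A bb] by (simp add: fun_calc_id[OF A])
  finally show ?thesis .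
qed

section \<open>Von Neumann algebras are closed under spectral calculus\<close>

context
  fixes N :: "('h::chilbert_space \<Rightarrow>\<^sub>L 'h) set"
  assumes vN: "von_neumann_algebra N"
begin

text \<open>The bicommutant condition as a membership test: a complex-linear operator that commutes
  with whatever commutes with A lies in N as soon as A does. Spectral projections and functions of A
  pass this test by the commutation rules.\<close>

lemma vN_iff: "A \<in> N \<longleftrightarrow> A \<in> bops \<and> (\<forall>B\<in>commutant N. A o\<^sub>L B = B o\<^sub>L A)"
proof -
  have "commutant (commutant N) = N" using vN by (simp add: von_neumann_algebra_def)
  then have "A \<in> N \<longleftrightarrow> A \<in> commutant (commutant N)" by simp
  also have "\<dots> \<longleftrightarrow> A \<in> bops \<and> (\<forall>B\<in>commutant N. A o\<^sub>L B = B o\<^sub>L A)" by (auto simp: commutant_def)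
  finally show ?thesis .
qed

lemma vN_bops: "A \<in> N \<Longrightarrow> A \<in> bops" by (simp add: vN_iff)

lemma vN_cadjoint: "A \<in> N \<Longrightarrow> cadjoint A \<in> N"
  using vN by (simp add: von_neumann_algebra_def)

lemma vN_intros:
  "id_blinfun \<in> N" "0 \<in> N" "A \<in> N \<Longrightarrow> B \<in> N \<Longrightarrow> A + B \<in> N"
  "A \<in> N \<Longrightarrow> B \<in> N \<Longrightarrow> A - B \<in> N" "A \<in> N \<Longrightarrow> r *\<^sub>R A \<in> N" "A \<in> N \<Longrightarrow> B \<in> N \<Longrightarrow> A o\<^sub>L B \<in> N"
  by (simp_all add: vN_iff bops_intros blinfun_eq_iff blinfun.add_left blinfun.add_right blinfun.diff_left
      blinfun.diff_right blinfun.scaleR_left blinfun.scaleR_right)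

lemma vN_spectral_measure:
  assumes A: "A \<in> N" "positive_op A" and S: "S \<in> sets borel"
  shows "spectral_measure A S \<in> N"
  using A projectionD(1)[OF spectral_measure_projection[OF A(2) S]] spectral_measure_commute[OF A(2)]
  by (simp add: vN_iff)

lemma vN_fun_calc:
  assumes A: "A \<in> N" "positive_op A" and f: "admissible A f"
  shows "fun_calc f A \<in> N"
  using A fun_calc_bops[OF A(2) f] fun_calc_commute[OF A(2) f] by (simp add: vN_iff)

lemma vN_op_abs: "A \<in> N \<Longrightarrow> op_abs A \<in> pos_part N"
  unfolding pos_part_def op_abs_def op_powr_def
  using positive_op_abs[OF vN_bops]
  by (simp add: vN_fun_calc vN_intros vN_cadjoint cadjoint_compose_positive vN_bops admissible_powr op_abs_def op_powr_def)

end

lemma pos_partD: "A \<in> pos_part N \<Longrightarrow> A \<in> N" "A \<in> pos_part N \<Longrightarrow> positive_op A"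
  by (auto simp: pos_part_def)

section \<open>The trace as a measure on the spectrum\<close>

locale trace_algebra =
  fixes N :: "('h::chilbert_space \<Rightarrow>\<^sub>L 'h) set" and \<tau> :: "('h \<Rightarrow>\<^sub>L 'h) \<Rightarrow> ennreal"
  assumes vN: "von_neumann_algebra N" and fns: "fns_trace N \<tau>"
begin

lemma tau_add: "A \<in> pos_part N \<Longrightarrow> B \<in> pos_part N \<Longrightarrow> \<tau> (A + B) = \<tau> A + \<tau> B"
  and tau_scale: "A \<in> pos_part N \<Longrightarrow> 0 \<le> r \<Longrightarrow> \<tau> (r *\<^sub>R A) = ennreal r * \<tau> A"
  and tau_commute: "X \<in> N \<Longrightarrow> \<tau> (cadjoint X o\<^sub>L X) = \<tau> (X o\<^sub>L cadjoint X)"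
  using fns by (auto simp: fns_trace_def trace_on_def)

lemma zero_pos_part: "0 \<in> pos_part N"
  using vN_intros(2)[OF vN] by (simp add: pos_part_def positive_op_iff bops_intros sym_op_def)

lemma tau_zero: "\<tau> 0 = 0"
  using tau_scale[OF zero_pos_part, of 0] by simp

lemma tau_mono:
  assumes "A \<in> pos_part N" "B \<in> pos_part N" "A \<preceq> B"
  shows "\<tau> A \<le> \<tau> B"
proof -
  have "B - A \<in> pos_part N" using assms vN_intros[OF vN] by (auto simp: pos_part_def op_le_def)
  then have "\<tau> (A + (B - A)) = \<tau> A + \<tau> (B - A)" by (rule tau_add[OF assms(1)])
  then show ?thesis by simp
qed

text \<open>Normality in the form used throughout: the weak limit of an increasing sequence is its
  least upper bound.\<close>

lemma tau_SUP:
  assumes A: "\<And>n::nat. A n \<in> pos_part N" and B: "B \<in> pos_part N"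
    and mono: "\<And>m n x. m \<le> n \<Longrightarrow> inner x (A m x) \<le> inner x (A n x)"
    and lim: "\<And>x. (\<lambda>n. inner x (A n x)) \<longlonglongrightarrow> inner x (B x)"
  shows "\<tau> B = (SUP n. \<tau> (A n))"
proof -
  have facts: "C \<in> bops \<and> sym_op C" if "C \<in> pos_part N" for C
    using that by (auto simp: pos_part_def positive_op_iff)
  have le: "C \<preceq> D \<longleftrightarrow> (\<forall>x. inner x (C x) \<le> inner x (D x))" if "C \<in> pos_part N" "D \<in> pos_part N" for C D
    using facts[OF that(1)] facts[OF that(2)] by (intro op_le_iff) auto
  have "is_lub_in (pos_part N) (range A) B"
    unfolding is_lub_in_def
  proof (intro conjI ballI impI B)
    show "C \<preceq> B" if "C \<in> range A" for C
    proof -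
      from that obtain n where C: "C = A n" by auto
      have "inner x (A n x) \<le> inner x (B x)" for x
        by (rule LIMSEQ_le_const[OF lim]) (use mono in blast)
      then show ?thesis using le[OF A B] by (simp add: C)
    qed
    show "B \<preceq> R" if R: "R \<in> pos_part N" "\<forall>C\<in>range A. C \<preceq> R" for R
    proof -
      have "inner x (B x) \<le> inner x (R x)" for x
        by (rule LIMSEQ_le_const2[OF lim]) (use R le[OF A R(1)] in auto)
      then show ?thesis using le[OF B R(1)] by simp
    qed
  qed
  moreover have "\<exists>C\<in>range A. X \<preceq> C \<and> Y \<preceq> C" if "X \<in> range A" "Y \<in> range A" for X Y
  proof -
    from that obtain i j where "X = A i" "Y = A j" by auto
    then show ?thesis using le[OF A A] mono by (intro bexI[of _ "A (max i j)"]) auto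
  qed
  moreover have "range A \<subseteq> pos_part N" "range A \<noteq> {}" using A by auto
  moreover have "normal_trace N \<tau>" using fns by (simp add: fns_trace_def)
  ultimately have "\<tau> B = (SUP C\<in>range A. \<tau> C)"
    unfolding normal_trace_def by blast
  then show ?thesis by (simp add: image_comp o_def)
qed

definition spectral_trace :: "('h \<Rightarrow>\<^sub>L 'h) \<Rightarrow> real measure" where
  "spectral_trace T = measure_of UNIV (sets borel) (\<lambda>S. \<tau> (spectral_measure T S))"

lemma sets_spectral_trace [simp, measurable_cong]: "sets (spectral_trace T) = sets borel"
  and space_spectral_trace [simp]: "space (spectral_trace T) = UNIV"
  using sets.sigma_sets_eq[of "borel :: real measure"] by (simp_all add: spectral_trace_def)

lemma spectral_measure_pos_part:
  assumes T: "T \<in> pos_part N" and S: "S \<in> sets borel"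
  shows "spectral_measure T S \<in> pos_part N" "spectral_measure T S \<in> projections N"
  using spectral_measure_projection[OF pos_partD(2)[OF T] S] vN_spectral_measure[OF vN pos_partD[OF T] S]
  by (auto simp: pos_part_def projections_def dest: projectionD(5))

text \<open>Countable additivity is normality applied to the increasing finite unions.\<close>

lemma emeasure_spectral_trace:
  assumes T: "T \<in> pos_part N" and S: "S \<in> sets borel"
  shows "emeasure (spectral_trace T) S = \<tau> (spectral_measure T S)"
  unfolding spectral_trace_def
proof (rule emeasure_measure_of_sigma)
  interpret pvm "spectral_measure T" 0 "norm T + 1" by (rule pvm_spectral_measure[OF pos_partD(2)[OF T]])
  show "sigma_algebra UNIV (sets (borel :: real measure))"
    using sets.sigma_algebra_axioms[of "borel :: real measure"] by simp
  show "positive (sets borel) (\<lambda>S. \<tau> (spectral_measure T S))"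
    by (simp add: positive_def E_empty tau_zero)
  show "countably_additive (sets borel) (\<lambda>S. \<tau> (spectral_measure T S))"
  proof (rule countably_additiveI)
    fix F :: "nat \<Rightarrow> real set" assume F: "range F \<subseteq> sets borel" "disjoint_family F"
    define U where "U = (\<Union>n. F n)"
    define G where "G n = (\<Union>i<n. F i)" for n
    have Fb: "F i \<in> sets borel" for i using F by auto
    have U: "U \<in> sets borel" and G: "G n \<in> sets borel" for n unfolding U_def G_def using Fb by auto
    have disj: "G n \<inter> F n = {}" for n
    proof -
      have "F i \<inter> F n = {}" if "i < n" for i using F(2) that by (simp add: disjoint_family_on_def)
      then show ?thesis by (auto simp: G_def)
    qed
    have G_Suc: "spectral_measure T (G (Suc n)) = spectral_measure T (G n) + spectral_measure T (F n)" for n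
    proof -
      have "G (Suc n) = G n \<union> F n" by (auto simp: G_def lessThan_Suc)
      then show ?thesis using E_Un[OF G Fb disj] by simp
    qed
    have G_0: "spectral_measure T (G 0) = 0" by (simp add: G_def E_empty)
    have part: "(\<Sum>i<n. \<tau> (spectral_measure T (F i))) = \<tau> (spectral_measure T (G n))" for n
      by (induction n) (simp_all add: G_0 tau_zero G_Suc tau_add spectral_measure_pos_part[OF T] G Fb)
    have part_x: "(\<Sum>i<n. spectral_measure T (F i) x) = spectral_measure T (G n) x" for n x
      by (induction n) (simp_all add: G_0 G_Suc blinfun.add_left)
    have "\<tau> (spectral_measure T U) = (SUP n. \<tau> (spectral_measure T (G n)))"
    proof (rule tau_SUP)
      show "(\<lambda>n. inner x (spectral_measure T (G n) x)) \<longlonglongrightarrow> inner x (spectral_measure T U x)" for x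
        using sums[OF F, of x] unfolding sums_def part_x U_def[symmetric] by (intro tendsto_inner tendsto_const)
      fix m n :: nat and x assume "m \<le> n"
      then have "G m \<subseteq> G n" by (auto simp: G_def intro: less_le_trans)
      then show "inner x (spectral_measure T (G m) x) \<le> inner x (spectral_measure T (G n) x)"
        using finite_measure.finite_measure_mono[OF finite_borel_onD(1)[OF V_finite_borel], of "G m" "G n" x] G
        by (simp add: measure_V sets_V)
    qed (use U G in \<open>auto intro: spectral_measure_pos_part[OF T]\<close>)
    then show "(\<Sum>n. \<tau> (spectral_measure T (F n))) = \<tau> (spectral_measure T (\<Union>n. F n))"
      by (simp add: suminf_eq_SUP part U_def)
  qed
qed (rule S)

lemma fun_calc_pos_part:
  assumes "T \<in> pos_part N" "admissible T f" "\<And>t. 0 \<le> t \<Longrightarrow> t \<le> norm T + 1 \<Longrightarrow> 0 \<le> f t"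
  shows "fun_calc f T \<in> pos_part N"
  using assms by (auto simp: pos_part_def intro: fun_calc_positive vN_fun_calc[OF vN])

text \<open>Induction over nonnegative Borel functions. The step to monotone limits is normality,
  with weak convergence supplied by dominated convergence in each vector measure; \<open>dom\<close>
  keeps the pieces admissible, as they lie between 0 and an admissible function.\<close>

theorem tau_fun_calc:
  assumes T: "T \<in> pos_part N" and f: "f \<in> borel_measurable borel" and nonneg: "\<And>t. 0 \<le> f t"
    and adm: "admissible T f"
  shows "\<tau> (fun_calc f T) = (\<integral>\<^sup>+t. ennreal (f t) \<partial>spectral_trace T)"
proof -
  note T' = pos_partD(2)[OF T]
  interpret pvm "spectral_measure T" 0 "norm T + 1" by (rule pvm_spectral_measure[OF T'])
  have dom: "admissible T u" if "u \<in> borel_measurable borel" "\<And>t. 0 \<le> u t" "\<And>t. u t \<le> v t" "admissible T v" for u v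
  proof -
    from that(4) obtain B where "\<forall>t\<in>{0..norm T + 1}. \<bar>v t\<bar> \<le> B" by (auto simp: bounded_borel_on_def)
    then have "\<forall>t\<in>{0..norm T + 1}. \<bar>u t\<bar> \<le> B" using that(2,3) by (fastforce intro: order_trans)
    then show ?thesis using that(1) by (auto simp: bounded_borel_on_def)
  qed
  show ?thesis
    using f nonneg adm
  proof (induction rule: borel_measurable_induct_real)
    case (set S)
    have "(\<integral>\<^sup>+t. ennreal (indicat_real S t) \<partial>spectral_trace T) = (\<integral>\<^sup>+t. indicator S t \<partial>spectral_trace T)"
      by (rule nn_integral_cong) (auto split: split_indicator)
    then show ?case using set by (simp add: fun_calc_indicator[OF T'] emeasure_spectral_trace[OF T])
  next
    case (mult u c)
    show ?case
    proof (cases "c = 0")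
      case True
      have "fun_calc (\<lambda>t. 0 * (0::real)) T = 0"
        by (subst fun_calc_scale[OF T' bounded_borel_on_const]) simp
      then show ?thesis using True by (simp add: tau_zero)
    next
      case False
      with mult have c: "c > 0" by simp
      have u: "admissible T u"
        using bounded_borel_on_mult[OF bounded_borel_on_const mult.prems, of "1 / c"] c by simp
      have "fun_calc u T \<in> pos_part N" using mult u by (intro fun_calc_pos_part[OF T])
      then have "\<tau> (fun_calc (\<lambda>t. c * u t) T) = ennreal c * \<tau> (fun_calc u T)"
        using c by (simp add: fun_calc_scale[OF T' u] tau_scale)
      also have "\<dots> = (\<integral>\<^sup>+t. ennreal c * ennreal (u t) \<partial>spectral_trace T)"
        using mult u by (simp add: nn_integral_cmult)
      finally show ?thesis using c mult by (simp add: ennreal_mult)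
    qed
  next
    case (add u v)
    have u: "admissible T u" by (rule dom[OF _ _ _ add.prems]) (use add.hyps in auto)
    have v: "admissible T v" by (rule dom[OF _ _ _ add.prems]) (use add.hyps in auto)
    have "fun_calc u T \<in> pos_part N" "fun_calc v T \<in> pos_part N"
      using add.hyps u v by (auto intro!: fun_calc_pos_part[OF T])
    then have "\<tau> (fun_calc (\<lambda>t. v t + u t) T) = \<tau> (fun_calc v T) + \<tau> (fun_calc u T)"
      by (simp add: fun_calc_add[OF T' v u] tau_add)
    also have "\<dots> = (\<integral>\<^sup>+t. ennreal (v t) + ennreal (u t) \<partial>spectral_trace T)"
      using add.hyps add.IH u v by (simp add: nn_integral_add)
    finally show ?case using add.hyps by simp
  next
    case (seq U)
    have le: "U n t \<le> f t" for n t
      using seq.hyps(3,4) by (intro incseq_le) (auto simp: incseq_def le_fun_def)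
    have U: "admissible T (U n)" for n
      by (rule dom[OF _ _ _ seq.prems]) (use seq.hyps(1,2) le in auto)
    have "\<tau> (fun_calc f T) = (SUP n. \<tau> (fun_calc (U n) T))"
    proof (rule tau_SUP)
      show "fun_calc (U n) T \<in> pos_part N" for n
        using seq.hyps(2) U by (intro fun_calc_pos_part[OF T]) auto
      show "fun_calc f T \<in> pos_part N"
        using nonneg seq.prems by (intro fun_calc_pos_part[OF T]) auto
      show "inner x (fun_calc (U m) T x) \<le> inner x (fun_calc (U n) T x)" if "m \<le> n" for m n x
        by (rule op_le_inner, rule fun_calc_mono[OF T' U U])
           (use seq.hyps(3) that in \<open>auto simp: incseq_def le_fun_def\<close>)
      show "(\<lambda>n. inner x (fun_calc (U n) T x)) \<longlonglongrightarrow> inner x (fun_calc f T x)" for x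
        unfolding fun_calc_inner[OF T' U] fun_calc_inner[OF T' seq.prems]
      proof (rule integral_dominated_convergence[where w = f])
        show "f \<in> borel_measurable (V x)" "\<And>n. U n \<in> borel_measurable (V x)"
          using f seq.hyps(1) by (auto intro: finite_borel_on_measurable[OF V_finite_borel])
        show "integrable (V x) f" by (rule bounded_borel_on_integrable[OF V_finite_borel seq.prems])
        show "AE t in V x. (\<lambda>n. U n t) \<longlonglongrightarrow> f t" using seq.hyps(4) by simp
        show "AE t in V x. norm (U n t) \<le> f t" for n using seq.hyps(2) le by simp
      qed
    qed
    also have "\<dots> = (SUP n. \<integral>\<^sup>+t. ennreal (U n t) \<partial>spectral_trace T)"
      using seq.IH U by simp
    also have "\<dots> = (\<integral>\<^sup>+t. ennreal (f t) \<partial>spectral_trace T)"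
    proof (rule LIMSEQ_unique)
      have inc: "incseq (\<lambda>n t. ennreal (U n t))"
        using seq.hyps(2,3) by (auto simp: incseq_def le_fun_def intro!: ennreal_leI)
      show "(\<lambda>n. \<integral>\<^sup>+t. ennreal (U n t) \<partial>spectral_trace T) \<longlonglongrightarrow> (\<integral>\<^sup>+t. ennreal (f t) \<partial>spectral_trace T)"
        using inc seq.hyps(1,4)
        by (intro nn_integral_LIMSEQ) (auto intro!: tendsto_ennrealI)
      show "(\<lambda>n. \<integral>\<^sup>+t. ennreal (U n t) \<partial>spectral_trace T) \<longlonglongrightarrow> (SUP n. \<integral>\<^sup>+t. ennreal (U n t) \<partial>spectral_trace T)"
        using inc by (intro LIMSEQ_SUP) (auto simp: incseq_def le_fun_def intro!: nn_integral_mono)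
    qed
    finally show ?case .
  qed
qed

end

section \<open>Comparison of projections through the trace\<close>

lemma projection_norm_le: "projection P \<Longrightarrow> norm (P x) \<le> norm x"
proof -
  assume P: "projection P"
  have "(norm (P x))\<^sup>2 \<le> norm x * norm (P x)"
    using norm_cauchy_schwarz[of x "P x"] projectionD(4)[OF P, of x] by simp
  then show ?thesis by (cases "P x = 0") (auto simp: power2_eq_square)
qed

context trace_algebra
begin

text \<open>\<open>W = Q P g(PQP)\<close> with \<open>g(t) = t\<^sup>-\<^sup>1\<^sup>/\<^sup>2\<close> on \<open>(\<epsilon>, \<infinity>)\<close> is a partial isometry from the spectral projection
  into the range of \<open>Q\<close>.\<close>

lemma tau_spectral_compression_le:
  assumes P: "P \<in> projections N" and Q: "Q \<in> projections N" and e: "0 < e"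
  shows "\<tau> (spectral_measure (P o\<^sub>L Q o\<^sub>L P) {e<..}) \<le> \<tau> Q"
proof -
  have PN: "P \<in> N" "projection P" and QN: "Q \<in> N" "projection Q" using P Q by (auto simp: projections_def)
  note P' = projectionD[OF PN(2)] and Q' = projectionD[OF QN(2)]
  define X where "X = P o\<^sub>L Q o\<^sub>L P"
  have "sym_op X" using sym_opD[OF P'(3)] sym_opD[OF Q'(3)] by (simp add: sym_op_def X_def)
  moreover have "inner x (X x) = (norm (Q (P x)))\<^sup>2" for x
    using sym_opD[OF P'(3), of x] Q'(4)[of "P x"] by (simp add: X_def)
  ultimately have X: "positive_op X"
    using P'(1) Q'(1) by (simp add: positive_op_iff X_def bops_intros)
  have XN: "X \<in> N" unfolding X_def by (intro vN_intros[OF vN] PN QN)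
  define g where "g t = t powr (-1/2) * indicator {e<..} t" for t :: real
  have g_meas: "g \<in> borel_measurable borel" unfolding g_def by measurable
  have "\<bar>g t\<bar> \<le> e powr (-1/2)" for t
    using e by (auto simp: g_def intro!: powr_mono2' split: split_indicator)
  then have g: "admissible X g" using g_meas by (auto simp: bounded_borel_on_def)
  have id: "admissible X (\<lambda>t. t)" by (intro bounded_borel_on_continuous continuous_intros)
  let ?G = "fun_calc g X" and ?E = "spectral_measure X {e<..}"
  define W where "W = Q o\<^sub>L P o\<^sub>L ?G"
  have GN: "?G \<in> N" "sym_op ?G" using vN_fun_calc[OF vN XN X g] fun_calc_sym[OF X g] by auto
  have WN: "W \<in> N" unfolding W_def by (intro vN_intros[OF vN] PN QN GN)
  note W_bops = vN_bops[OF vN WN]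
  have W_adj: "cadjoint W = ?G o\<^sub>L P o\<^sub>L Q"
    by (rule cadjoint_eqI[OF W_bops])
       (simp add: W_def sym_opD[OF GN(2)] sym_opD[OF P'(3)] sym_opD[OF Q'(3)])
  have "cadjoint W o\<^sub>L W = ?G o\<^sub>L (X o\<^sub>L ?G)"
    unfolding W_adj by (simp add: W_def X_def blinfun_eq_iff Q'(2))
  also have "X o\<^sub>L ?G = fun_calc (\<lambda>t. t * g t) X"
    using fun_calc_mult[OF X id g] by (simp add: fun_calc_id[OF X])
  also have "?G o\<^sub>L fun_calc (\<lambda>t. t * g t) X = fun_calc (\<lambda>t. g t * (t * g t)) X"
    by (rule fun_calc_mult[OF X g bounded_borel_on_mult[OF id g]])
  also have "(\<lambda>t. g t * (t * g t)) = indicator {e<..}"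
  proof
    fix t
    show "g t * (t * g t) = indicator {e<..} t"
    proof (cases "e < t")
      case True
      then have "t > 0" using e by simp
      then have "t powr (-1/2) * (t * t powr (-1/2)) = t powr (-1/2 + (1 + -1/2))"
        by (simp only: powr_add powr_one)
      also have "\<dots> = 1" using \<open>t > 0\<close> by simp
      finally show ?thesis using True by (simp add: g_def)
    qed (simp add: g_def)
  qed
  also have "fun_calc (indicator {e<..}) X = ?E" by (rule fun_calc_indicator[OF X]) simp
  finally have WW: "cadjoint W o\<^sub>L W = ?E" .
  have E: "projection ?E" by (rule spectral_measure_projection[OF X]) simp
  have W_norm: "norm (W x) \<le> norm x" for x
  proof -
    have "(norm (W x))\<^sup>2 = inner x ((cadjoint W o\<^sub>L W) x)"
      by (simp add: cadjoint_inner_right[OF W_bops] power2_norm_eq_inner)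
    also have "\<dots> = (norm (?E x))\<^sup>2" using projectionD(4)[OF E] by (simp add: WW)
    also have "\<dots> \<le> (norm x)\<^sup>2" using projection_norm_le[OF E] by simp
    finally show ?thesis by simp
  qed
  have Wadj_norm: "norm (cadjoint W x) \<le> norm x" for x
  proof -
    have "(norm (cadjoint W x))\<^sup>2 = inner x (W (cadjoint W x))"
      by (simp add: cadjoint_inner[OF W_bops] power2_norm_eq_inner)
    also have "\<dots> \<le> norm x * norm (W (cadjoint W x))" by (rule norm_cauchy_schwarz)
    also have "\<dots> \<le> norm x * norm (cadjoint W x)" using W_norm by (intro mult_left_mono) auto
    finally show ?thesis by (cases "cadjoint W x = 0") (auto simp: power2_eq_square)
  qed
  have pos: "positive_op (W o\<^sub>L cadjoint W)"
    using cadjoint_compose_positive[OF cadjoint_bops[OF W_bops]] by (simp add: cadjoint_cadjoint[OF W_bops])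
  \<comment> \<open>\<open>cadjoint W\<close> is a contraction that factors through Q, so the form
    of \<open>W o\<^sub>L cadjoint W\<close> at x is |cadjoint W (Q x)|^2 \<le> |Q x|^2.\<close>
  have "W o\<^sub>L cadjoint W \<preceq> Q"
  proof (subst op_le_iff)
    show "\<forall>x. inner x ((W o\<^sub>L cadjoint W) x) \<le> inner x (Q x)"
    proof
      fix x
      have "inner x ((W o\<^sub>L cadjoint W) x) = (norm (cadjoint W x))\<^sup>2"
        by (simp add: cadjoint_inner[OF W_bops] power2_norm_eq_inner)
      also have "cadjoint W x = cadjoint W (Q x)" by (simp add: W_adj Q'(2))
      also have "(norm (cadjoint W (Q x)))\<^sup>2 \<le> (norm (Q x))\<^sup>2" using Wadj_norm by simp
      finally show "inner x ((W o\<^sub>L cadjoint W) x) \<le> inner x (Q x)" by (simp add: Q'(4))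
    qed
  qed (use pos Q' in \<open>auto simp: positive_op_iff\<close>)
  moreover have "W o\<^sub>L cadjoint W \<in> pos_part N" "Q \<in> pos_part N"
    using pos Q'(5) QN by (auto simp: pos_part_def intro: vN_intros[OF vN] WN vN_cadjoint[OF vN])
  ultimately have "\<tau> (W o\<^sub>L cadjoint W) \<le> \<tau> Q" by (intro tau_mono)
  then show ?thesis using tau_commute[OF WN] by (simp add: WW X_def)
qed

text \<open>A quantitative substitute for Kaplansky's formula \<open>\<tau>(Q \<or> R) \<le> \<tau>(Q) + \<tau>(R)\<close>: the part of
  \<open>P\<close> where \<open>PQP\<close> is large is compared with \<open>Q\<close>, the rest with \<open>R\<close>.\<close>

lemma tau_projection_le_add:
  assumes P: "P \<in> projections N" and Q: "Q \<in> projections N" and R: "R \<in> projections N" and e: "0 < e"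
    and cover: "\<And>x. P x = x \<Longrightarrow> e * (norm x)\<^sup>2 \<le> inner x (Q x) + inner x (R x)"
  shows "\<tau> P \<le> \<tau> Q + \<tau> R"
proof -
  have PN: "P \<in> N" "projection P" and QN: "Q \<in> N" "projection Q" and RN: "R \<in> N" "projection R"
    using P Q R by (auto simp: projections_def)
  note P' = projectionD[OF PN(2)] and Q' = projectionD[OF QN(2)] and R' = projectionD[OF RN(2)]
  have compression: "positive_op (S o\<^sub>L T o\<^sub>L S)" if "projection S" "projection T" for S T :: "'h \<Rightarrow>\<^sub>L 'h"
  proof -
    note S' = projectionD[OF that(1)] and T' = projectionD[OF that(2)]
    have "inner x ((S o\<^sub>L T o\<^sub>L S) x) = (norm (T (S x)))\<^sup>2" for x
      using sym_opD[OF S'(3), of x] T'(4)[of "S x"] by simp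
    then show ?thesis
      using S'(1) T'(1) sym_opD[OF S'(3)] sym_opD[OF T'(3)]
      by (simp add: positive_op_iff bops_intros sym_op_def)
  qed
  define X where "X = P o\<^sub>L Q o\<^sub>L P"
  have X: "positive_op X" unfolding X_def by (rule compression[OF PN(2) QN(2)])
  have XN: "X \<in> N" unfolding X_def by (intro vN_intros[OF vN] PN QN)
  define P1 where "P1 = spectral_measure X {e/2<..}"
  have P1: "projection P1" unfolding P1_def by (rule spectral_measure_projection[OF X]) simp
  note P1' = projectionD[OF P1]
  have P1N: "P1 \<in> N" unfolding P1_def by (rule vN_spectral_measure[OF vN XN X]) simp
  \<comment> \<open>P1 = X h(X) with h(t) = 1/t above the threshold, so the range of P1 lies in that
    of X and hence in that of P.\<close>
  have PP1: "P (P1 x) = P1 x" for x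
  proof -
    define h where "h t = indicator {e/2<..} t / t" for t :: real
    have "h \<in> borel_measurable borel" unfolding h_def by measurable
    moreover have "\<bar>h t\<bar> \<le> 2 / e" for t
      using e by (auto simp: h_def field_simps split: split_indicator)
    ultimately have h: "admissible X h" by (auto simp: bounded_borel_on_def)
    have id: "admissible X (\<lambda>t. t)" by (intro bounded_borel_on_continuous continuous_intros)
    have "(\<lambda>t. t * h t) = indicator {e/2<..}" using e by (auto simp: h_def split: split_indicator)
    then have "X o\<^sub>L fun_calc h X = P1"
      using fun_calc_mult[OF X id h] by (simp add: fun_calc_id[OF X] fun_calc_indicator[OF X] P1_def)
    then have "P1 x = X (fun_calc h X x)" by (metis blinfun_apply_blinfun_compose)
    then show ?thesis by (simp add: X_def P'(2))
  qed
  have P1P: "P1 (P x) = P1 x" for x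
  proof (rule vector_eq_ldot[THEN iffD1], intro allI)
    show "inner y (P1 (P x)) = inner y (P1 x)" for y
      by (metis PP1 P'(3) P1'(3) sym_opD)
  qed
  define P2 where "P2 = P - P1"
  have P2_apply: "P2 x = P x - P1 x" for x by (simp add: P2_def blinfun.diff_left)
  have P2: "projection P2"
    unfolding projection_iff
  proof (intro conjI allI)
    show "P2 (P2 x) = P2 x" for x
      by (simp add: P2_apply blinfun.diff_right P'(2) P1'(2) PP1 P1P)
    show "sym_op P2" using P'(3) P1'(3) by (simp add: sym_op_def P2_apply inner_diff_left inner_diff_right)
  qed (simp add: P2_def bops_intros P' P1')
  note P2' = projectionD[OF P2]
  have P2N: "P2 \<in> N" unfolding P2_def by (intro vN_intros[OF vN] PN P1N)
  define Y where "Y = P2 o\<^sub>L R o\<^sub>L P2"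
  have Y: "positive_op Y" unfolding Y_def by (rule compression[OF P2 RN(2)])
  have YN: "Y \<in> N" unfolding Y_def by (intro vN_intros[OF vN] P2N RN)
  define P3 where "P3 = spectral_measure Y {e/4<..}"
  have P3: "projection P3" unfolding P3_def by (rule spectral_measure_projection[OF Y]) simp
  note P3' = projectionD[OF P3]
  have "Y o\<^sub>L P2 = P2 o\<^sub>L Y" by (simp add: Y_def blinfun_eq_iff P2'(2))
  from spectral_measure_commute[OF Y this] have P32: "P3 (P2 x) = P2 (P3 x)" for x
    by (simp add: P3_def blinfun_eq_iff)
  \<comment> \<open>The part w of P2 x missed by P3 lies in the range of P and is killed by P1 and
    by P3, so both compressions are small on it. The thresholds e/2 and e/4 add up to less than e,
    and \<open>cover\<close> leaves only w = 0.\<close>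
  have P3P2: "P3 (P2 x) = P2 x" for x
  proof -
    define w where "w = P2 x - P3 (P2 x)"
    have w2: "P2 w = w" by (simp add: w_def blinfun.diff_right P2'(2) flip: P32)
    have w3: "P3 w = 0" by (simp add: w_def blinfun.diff_right P3'(2))
    have wP: "P w = w" using w2 by (metis P2_apply PP1 P'(2) blinfun.diff_right)
    have wP1: "P1 w = 0" using w2 wP by (metis P2_apply P1P diff_eq_eq add_0 add_cancel_left_right)
    have "inner w (R w) = inner w (Y w)"
      using sym_opD[OF P2'(3), of w "R (P2 w)"] by (simp add: Y_def w2)
    also have "\<dots> \<le> e/4 * (norm w)\<^sup>2"
      using inner_spectral_upper[OF Y, of "e/4" w] e w3 by (simp add: P3_def)
    finally have "inner w (R w) \<le> e/4 * (norm w)\<^sup>2" .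
    moreover have "inner w (Q w) = inner w (X w)"
      using sym_opD[OF P'(3), of w "Q (P w)"] by (simp add: X_def wP)
    moreover have "inner w (X w) \<le> e/2 * (norm w)\<^sup>2"
      using inner_spectral_upper[OF X, of "e/2" w] e wP1 by (simp add: P1_def)
    ultimately have "e * (norm w)\<^sup>2 \<le> e/4 * (norm w)\<^sup>2 + e/2 * (norm w)\<^sup>2"
      using cover[OF wP] by linarith
    then have "e * (norm w)\<^sup>2 \<le> 0" by simp
    then have "w = 0" using e by (simp add: mult_le_0_iff)
    then show ?thesis by (simp add: w_def)
  qed
  have P3N: "P3 \<in> N" unfolding P3_def by (rule vN_spectral_measure[OF vN YN Y]) simp
  have "P2 \<preceq> P3"
  proof (subst op_le_iff)
    show "\<forall>x. inner x (P2 x) \<le> inner x (P3 x)"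
    proof
      fix x
      have "norm (P2 x) = norm (P2 (P3 x))" by (metis P32 P3P2)
      also have "\<dots> \<le> norm (P3 x)" by (rule projection_norm_le[OF P2])
      finally show "inner x (P2 x) \<le> inner x (P3 x)" by (simp add: P2'(4) P3'(4))
    qed
  qed (use P2' P3' in auto)
  then have "\<tau> P2 \<le> \<tau> P3" using P2N P3N P2'(5) P3'(5) by (intro tau_mono) (auto simp: pos_part_def)
  also have "\<dots> \<le> \<tau> R"
    unfolding P3_def Y_def using P2N P2 R e by (intro tau_spectral_compression_le) (auto simp: projections_def)
  finally have "\<tau> P2 \<le> \<tau> R" .
  moreover have "\<tau> P1 \<le> \<tau> Q"
    unfolding P1_def X_def using P Q e by (intro tau_spectral_compression_le) auto
  moreover have "\<tau> P = \<tau> P1 + \<tau> P2"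
    using tau_add[of P1 P2] P1N P2N P1'(5) P2'(5) by (simp add: pos_part_def P2_def)
  ultimately show ?thesis by (simp add: add_mono)
qed

section \<open>Distribution functions of sums\<close>

definition dist_fun :: "('h \<Rightarrow>\<^sub>L 'h) \<Rightarrow> real \<Rightarrow> ennreal" where
  "dist_fun A s = \<tau> (spectral_measure (op_abs A) {s<..})"

text \<open>On the range of the projection belonging to |X + Y| > s' one has s'^2 |x|^2 \<le> |(X +
  Y) x|^2 \<le> 2 |X x|^2 + 2 |Y x|^2. Each of |X x|^2 and |Y x|^2 is at most s^2 |x|^2 plus
  \<open>K\<close> times the form of its own spectral projection. The strict gap 2 s < s' leaves the
  positive \<open>e\<close> of the covering condition.\<close>

lemma dist_fun_add:
  assumes X: "X \<in> N" and Y: "Y \<in> N" and s: "0 \<le> s" "2 * s < s'"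
  shows "dist_fun (X + Y) s' \<le> dist_fun X s + dist_fun Y s"
proof -
  let ?H = "\<lambda>A. cadjoint A o\<^sub>L A"
  have XY: "X + Y \<in> N" by (intro vN_intros[OF vN] X Y)
  have H: "positive_op (?H A)" "?H A \<in> N" if "A \<in> N" for A
    using cadjoint_compose_positive[OF vN_bops[OF vN that]] vN_intros[OF vN] vN_cadjoint[OF vN] that by auto
  have eq: "dist_fun A r = \<tau> (spectral_measure (?H A) {r\<^sup>2<..})" if "A \<in> N" "0 \<le> r" for A r
    using spectral_measure_op_abs[OF vN_bops[OF vN that(1)] that(2)] by (simp add: dist_fun_def)
  have proj: "spectral_measure (?H A) {r\<^sup>2<..} \<in> projections N" if "A \<in> N" for A r
    using H[OF that] by (auto simp: projections_def intro!: spectral_measure_projection vN_spectral_measure[OF vN])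
  have H_inner: "inner x (?H A x) = (norm (A x))\<^sup>2" if "A \<in> N" for A x
    by (simp add: cadjoint_inner_right[OF vN_bops[OF vN that]] power2_norm_eq_inner)
  define K where "K = max (norm (?H X) + 1) (norm (?H Y) + 1)"
  have K: "K > 0" unfolding K_def by (rule less_max_iff_disj[THEN iffD2]) (simp add: add_nonneg_pos)
  define e where "e = (s'\<^sup>2 - 4 * s\<^sup>2) / (2 * K)"
  have "(2 * s)\<^sup>2 < s'\<^sup>2" using s by (intro power_strict_mono) auto
  then have e: "e > 0" using K by (simp add: e_def power_mult_distrib)
  have "\<tau> (spectral_measure (?H (X + Y)) {s'\<^sup>2<..}) \<le>
    \<tau> (spectral_measure (?H X) {s\<^sup>2<..}) + \<tau> (spectral_measure (?H Y) {s\<^sup>2<..})"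
  proof (rule tau_projection_le_add[OF proj[OF XY] proj[OF X] proj[OF Y] e])
    fix x assume x: "spectral_measure (?H (X + Y)) {s'\<^sup>2<..} x = x"
    let ?Q = "inner x (spectral_measure (?H X) {s\<^sup>2<..} x)" and ?R = "inner x (spectral_measure (?H Y) {s\<^sup>2<..} x)"
    have up: "(norm (A x))\<^sup>2 \<le> s\<^sup>2 * (norm x)\<^sup>2 + K * inner x (spectral_measure (?H A) {s\<^sup>2<..} x)"
      if A: "A \<in> N" "norm (?H A) + 1 \<le> K" for A
    proof -
      have "0 \<le> inner x (spectral_measure (?H A) {s\<^sup>2<..} x)"
        using proj[OF A(1)] by (simp add: projections_def projectionD(4))
      then have "(norm (?H A) + 1) * inner x (spectral_measure (?H A) {s\<^sup>2<..} x)
          \<le> K * inner x (spectral_measure (?H A) {s\<^sup>2<..} x)"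
        using A(2) by (rule mult_right_mono[rotated])
      then show ?thesis using inner_spectral_upper[OF H(1)[OF A(1)], of "s\<^sup>2" x] by (simp only: H_inner[OF A(1)]) simp
    qed
    have "s'\<^sup>2 * (norm x)\<^sup>2 \<le> (norm ((X + Y) x))\<^sup>2"
      using inner_spectral_lower[OF H(1)[OF XY] x] by (simp only: H_inner[OF XY])
    also have "\<dots> \<le> 2 * (norm (X x))\<^sup>2 + 2 * (norm (Y x))\<^sup>2"
      using inner_ge_zero[of "X x - Y x"]
      by (simp add: power2_norm_eq_inner blinfun.add_left inner_add_left inner_add_right inner_diff_left
          inner_diff_right inner_commute)
    also have "\<dots> \<le> 4 * s\<^sup>2 * (norm x)\<^sup>2 + 2 * K * (?Q + ?R)"
      using up[OF X] up[OF Y] by (simp add: K_def algebra_simps)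
    finally have "(s'\<^sup>2 - 4 * s\<^sup>2) * (norm x)\<^sup>2 \<le> 2 * K * (?Q + ?R)" by (simp add: algebra_simps)
    then show "e * (norm x)\<^sup>2 \<le> ?Q + ?R" using K by (simp add: e_def field_simps)
  qed
  then show ?thesis using s by (simp add: eq XY X Y)
qed

end

section \<open>Decreasing rearrangements\<close>

definition rearr :: "(real \<Rightarrow> ennreal) \<Rightarrow> real \<Rightarrow> real" where
  "rearr n t = Inf {s. 0 \<le> s \<and> n s \<le> ennreal t}"

text \<open>Abstracts the distribution function of a bounded operator. \<open>M\<close> is a level
  above the spectrum; it makes the infimum in \<open>rearr\<close> one over a nonempty set.\<close>

definition tail_fun :: "real \<Rightarrow> (real \<Rightarrow> ennreal) \<Rightarrow> bool" where
  "tail_fun M n \<longleftrightarrow> 0 \<le> M \<and> n M = 0 \<and> (\<forall>r s. 0 \<le> r \<longrightarrow> r \<le> s \<longrightarrow> n s \<le> n r)"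

context
  fixes M :: real and n :: "real \<Rightarrow> ennreal"
  assumes n: "tail_fun M n"
begin

lemma rearr_le: "0 \<le> s \<Longrightarrow> n s \<le> ennreal t \<Longrightarrow> rearr n t \<le> s"
  unfolding rearr_def by (rule cInf_lower) (auto intro: bdd_belowI[of _ 0])

lemma rearr_nonempty: "M \<in> {s. 0 \<le> s \<and> n s \<le> ennreal t}"
  using n by (simp add: tail_fun_def)

lemma rearr_nonneg: "0 \<le> rearr n t"
  unfolding rearr_def using rearr_nonempty[of t] by (intro cInf_greatest) auto

lemma rearr_le_bound: "rearr n t \<le> M"
  using n by (intro rearr_le) (auto simp: tail_fun_def)

lemma less_rearrD: "0 \<le> s \<Longrightarrow> s < rearr n t \<Longrightarrow> ennreal t < n s"
  using rearr_le[of s t] by (meson not_le)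

lemma rearr_lessD:
  assumes "rearr n t < s"
  shows "n s \<le> ennreal t"
proof -
  obtain r where "r \<in> {s. 0 \<le> s \<and> n s \<le> ennreal t}" "r < s"
    using cInf_lessD[OF _ assms[unfolded rearr_def]] rearr_nonempty[of t] by blast
  then show ?thesis using n unfolding tail_fun_def by (auto intro: order_trans[of "n s" "n r"])
qed

lemma rearr_antimono: "t \<le> t' \<Longrightarrow> rearr n t' \<le> rearr n t"
  unfolding rearr_def using rearr_nonempty[of t]
  by (intro cInf_superset_mono) (auto intro: bdd_belowI[of _ 0] order_trans ennreal_leI)

lemma rearr_measurable: "rearr n \<in> borel_measurable borel"
proof -
  have "mono (\<lambda>t. - rearr n t)" by (intro monoI) (simp add: rearr_antimono)
  then have "(\<lambda>t. - (- rearr n t)) \<in> borel_measurable borel"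
    by (intro borel_measurable_uminus borel_measurable_mono)
  then show ?thesis by simp
qed

end

text \<open>The argument uses levels slightly above the infimum, which need not be attained:
  \<open>tail_fun\<close> does not include right-continuity.\<close>

lemma rearr_mono:
  assumes "tail_fun M n" "tail_fun M' n'" "\<And>s. 0 \<le> s \<Longrightarrow> n s \<le> n' s"
  shows "rearr n t \<le> rearr n' t"
proof (rule field_le_epsilon)
  fix e :: real assume "e > 0"
  then have "n' (rearr n' t + e) \<le> ennreal t" by (intro rearr_lessD[OF assms(2)]) simp
  moreover have "0 \<le> rearr n' t + e" using rearr_nonneg[OF assms(2), of t] \<open>e > 0\<close> by simp
  ultimately show "rearr n t \<le> rearr n' t + e"
    using assms(3) by (intro rearr_le[OF assms(1)]) (auto intro: order_trans)
qed

lemma emeasure_lborel_atLeast: "emeasure lborel {a::real..} = \<infinity>"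
proof -
  have "emeasure lborel {a..a + real k} \<le> emeasure lborel {a..}" for k
    by (intro emeasure_mono) auto
  then have "of_nat k \<le> emeasure lborel {a..}" for k by (simp add: ennreal_of_nat_eq_real_of_nat)
  then show ?thesis
    using ennreal_Ex_less_of_nat[of "emeasure lborel {a..}"] by (metis infinity_ennreal_def not_le top.not_eq_extremum)
qed

text \<open>Equimeasurability: under Lebesgue measure on the half-line the rearrangement has the
  same tails as m. If a tail above some positive level is infinite, both integrals are infinite.
  Otherwise m and the image measure are compared above a level d > 0, where they are finite, and d
  is sent to 0.\<close>

theorem nn_integral_powr_eq_rearr:
  fixes m :: "real measure" and p M :: real
  defines "n \<equiv> \<lambda>s. emeasure m {s<..}"
  assumes sets_m: "sets m = sets borel" and neg: "emeasure m {..<0} = 0" and n: "tail_fun M n" and p: "0 < p"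
  shows "(\<integral>\<^sup>+s. ennreal (s powr p) \<partial>m) = (\<integral>\<^sup>+t\<in>{0..}. ennreal (rearr n t powr p) \<partial>lborel)"
proof (cases "\<forall>d>0. n d < \<infinity>")
  case False
  then obtain d where d: "d > 0" "n d = \<infinity>" by (metis infinity_ennreal_def top.not_eq_extremum)
  have "rearr n t \<ge> d" for t
    using rearr_lessD[OF n, of t d] d by (intro leI) (auto simp: top_unique)
  then have "(\<integral>\<^sup>+(t::real). ennreal (d powr p) * indicator {0..} t \<partial>lborel) \<le> (\<integral>\<^sup>+t\<in>{0..}. ennreal (rearr n t powr p) \<partial>lborel)"
    using d p by (intro nn_integral_mono) (auto intro!: ennreal_leI powr_mono2 split: split_indicator)
  then have 1: "(\<integral>\<^sup>+t\<in>{0..}. ennreal (rearr n t powr p) \<partial>lborel) = \<infinity>"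
    using d p by (simp add: nn_integral_cmult_indicator emeasure_lborel_atLeast ennreal_mult_top top_unique)
  have "(\<integral>\<^sup>+s. ennreal (d powr p) * indicator {d<..} s \<partial>m) \<le> (\<integral>\<^sup>+s. ennreal (s powr p) \<partial>m)"
    using d p by (intro nn_integral_mono) (auto split: split_indicator intro!: ennreal_leI powr_mono2)
  then have "(\<integral>\<^sup>+s. ennreal (s powr p) \<partial>m) = \<infinity>"
    using d p sets_m by (simp add: nn_integral_cmult_indicator ennreal_mult_top top_unique n_def)
  with 1 show ?thesis by simp
next
  case True
  let ?\<mu> = "rearr n"
  note \<mu>_meas [measurable] = rearr_measurable[OF n]
  have space_m: "space m = UNIV" using sets_eq_imp_space_eq[OF sets_m] by simp
  define L where "L = density lborel (indicator {0::real..})"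
  \<comment> \<open>Tails over open half-lines are right-continuous, by continuity from below along
    r + 1/k. Hence r < \<mu>_t holds exactly when t < n r.\<close>
  have level: "emeasure lborel ({0..} \<inter> {t. r < ?\<mu> t}) = n r" if r: "0 \<le> r" for r
  proof -
    have "r < ?\<mu> t" if t: "ennreal t < n r" for t
    proof (rule ccontr)
      assume "\<not> r < ?\<mu> t"
      then have *: "n (r + 1 / real (Suc k)) \<le> ennreal t" for k
        by (intro rearr_lessD[OF n] le_less_trans[OF _ less_add_same_cancel1[THEN iffD2]]) (simp_all add: not_less)
      have "(\<Union>k. {r + 1 / real (Suc k)<..}) = {r<..}"
      proof (intro equalityI subsetI)
        fix s assume "s \<in> {r<..}"
        then obtain k where "1 / real (Suc k) < s - r" using nat_approx_posE[of "s - r"] by auto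
        then show "s \<in> (\<Union>k. {r + 1 / real (Suc k)<..})" by (auto intro!: exI[of _ k])
      next
        fix s assume "s \<in> (\<Union>k. {r + 1 / real (Suc k)<..})"
        then obtain k where "r + 1 / real (Suc k) < s" by auto
        moreover have "0 < 1 / real (Suc k)" by simp
        ultimately show "s \<in> {r<..}" unfolding greaterThan_iff by linarith
      qed
      moreover have "(SUP k. emeasure m {r + 1 / real (Suc k)<..}) = emeasure m (\<Union>k. {r + 1 / real (Suc k)<..})"
      proof (rule SUP_emeasure_incseq)
        show "incseq (\<lambda>k. {r + 1 / real (Suc k)<..})"
          by (auto simp: incseq_def intro!: order_le_less_trans[OF add_left_mono] divide_left_mono)
      qed (auto simp: sets_m)
      ultimately have "n r = (SUP k. n (r + 1 / real (Suc k)))" by (simp add: n_def)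
      also have "\<dots> \<le> ennreal t" by (rule SUP_least) (rule *)
      finally show False using t by simp
    qed
    then have eq: "{0..} \<inter> {t. r < ?\<mu> t} = {t. 0 \<le> t \<and> ennreal t < n r}"
      using less_rearrD[OF n r] by auto
    show ?thesis
    proof (cases "n r" rule: ennreal_cases)
      case (real x)
      then have "{t. 0 \<le> t \<and> ennreal t < n r} = {0..<x}" by (auto simp: ennreal_less_iff)
      then show ?thesis using real by (simp add: eq)
    next
      case top
      have "{t. 0 \<le> t \<and> ennreal t < n r} = {0..}" using top by auto
      then show ?thesis using top by (simp add: eq emeasure_lborel_atLeast)
    qed
  qed
  \<comment> \<open>Both restrictions give \<open>n (max s d)\<close> to the half-line above s. This
    is finite since d > 0, and half-lines generate the Borel sets.\<close>
  have density_eq: "density m (indicator {d<..}) = density (distr L borel ?\<mu>) (indicator {d<..})" if d: "d > 0" for d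
  proof -
    define \<Omega> E where "\<Omega> = (UNIV :: real set)" and "E = range (\<lambda>s::real. {s<..})"
    have em1: "emeasure (density m (indicator {d<..})) {s<..} = n (max s d)" for s
    proof -
      have "{d<..} \<inter> {s<..} = {max s d<..}" by auto
      then show ?thesis by (simp add: emeasure_restricted sets_m n_def)
    qed
    have em2: "emeasure (density (distr L borel ?\<mu>) (indicator {d<..})) {s<..} = n (max s d)" for s
    proof -
      have "{d<..} \<inter> {s<..} = {max s d<..}" by auto
      then have "emeasure (density (distr L borel ?\<mu>) (indicator {d<..})) {s<..} = emeasure (distr L borel ?\<mu>) {max s d<..}"
        by (simp add: emeasure_restricted)
      also have "\<dots> = emeasure L {t. max s d < ?\<mu> t}"
        by (subst emeasure_distr) (auto simp: L_def vimage_def)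
      also have "\<dots> = emeasure lborel ({0..} \<inter> {t. max s d < ?\<mu> t})"
        unfolding L_def by (subst emeasure_restricted) auto
      finally show ?thesis using level[of "max s d"] d by simp
    qed
    have borel_eq: "sets borel = sigma_sets \<Omega> E"
      by (simp add: borel_Ioi \<Omega>_def E_def)
    show ?thesis
    proof (rule measure_eqI_generator_eq[where E = E and \<Omega> = \<Omega> and A = "\<lambda>k. {- real k<..}"])
      have "{r<..} \<inter> {s<..} = {max r s<..}" for r s :: real by auto
      then show "Int_stable E" by (auto simp: E_def Int_stable_def)
      show "emeasure (density m (indicator {d<..})) X = emeasure (density (distr L borel ?\<mu>) (indicator {d<..})) X"
        if "X \<in> E" for X using that em1 em2 by (auto simp: E_def)
      show "(\<Union>k. {- real k<..}) = \<Omega>"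
      proof -
        have "\<exists>k. - real k < x" for x using reals_Archimedean2[of "- x"] by (metis minus_less_iff)
        then show ?thesis by (auto simp: \<Omega>_def)
      qed
      show "emeasure (density m (indicator {d<..})) {- real k<..} \<noteq> \<infinity>" for k
        using True d by (auto simp: em1 less_top[symmetric] less_max_iff_disj)
    qed (auto simp: \<Omega>_def E_def sets_m borel_eq[unfolded \<Omega>_def E_def])
  qed
  define f where "f k s = indicator {1 / real (Suc k)<..} s * ennreal (s powr p)" for k and s :: real
  \<comment> \<open>The limit sees only positive s; nothing is lost at 0 because
    \<open>0 powr p = 0\<close>.\<close>
  define f' where "f' s = indicator {0<..} s * ennreal (s powr p)" for s :: real
  have f_meas [measurable]: "f k \<in> borel_measurable borel" for k unfolding f_def by measurable
  have f_inc: "f i s \<le> f j s" if "i \<le> j" for i j s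
  proof -
    have "1 / real (Suc j) \<le> 1 / real (Suc i)" using that by (intro divide_left_mono) auto
    then show ?thesis by (auto simp: f_def split: split_indicator)
  qed
  have f_lim: "(\<lambda>k. f k s) \<longlonglongrightarrow> f' s" for s
  proof (cases "0 < s")
    case True
    then obtain K where K: "1 / real (Suc K) < s" using nat_approx_posE by blast
    have "\<forall>\<^sub>F k in sequentially. f k s = f' s"
      using eventually_ge_at_top[of K]
    proof eventually_elim
      case (elim k)
      have "1 / real (Suc k) \<le> 1 / real (Suc K)" using elim by (intro divide_left_mono) auto
      then show ?case using K True by (simp add: f_def f'_def)
    qed
    then show ?thesis by (rule tendsto_eventually)
  next
    case False
    then have "f k s = 0" for k using order_less_trans[of 0 "1 / real (Suc k)" s] by (auto simp: f_def split: split_indicator)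
    then show ?thesis using False by (simp add: f'_def)
  qed
  have f_eq: "(\<integral>\<^sup>+s. f k s \<partial>m) = (\<integral>\<^sup>+t. indicator {0..} t * f k (?\<mu> t) \<partial>lborel)" for k
  proof -
    have "(\<integral>\<^sup>+s. f k s \<partial>m) = (\<integral>\<^sup>+s. ennreal (s powr p) \<partial>density m (indicator {1 / real (Suc k)<..}))"
      unfolding f_def by (subst nn_integral_density) (auto simp: sets_m cong: measurable_cong_sets)
    also have "\<dots> = (\<integral>\<^sup>+s. ennreal (s powr p) \<partial>density (distr L borel ?\<mu>) (indicator {1 / real (Suc k)<..}))"
      by (subst density_eq) auto
    also have "\<dots> = (\<integral>\<^sup>+s. f k s \<partial>distr L borel ?\<mu>)"
      unfolding f_def by (subst nn_integral_density) auto
    also have "\<dots> = (\<integral>\<^sup>+t. f k (?\<mu> t) \<partial>L)"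
      by (subst nn_integral_distr) (auto simp: L_def f_meas)
    also have "\<dots> = (\<integral>\<^sup>+t. indicator {0..} t * f k (?\<mu> t) \<partial>lborel)"
      unfolding L_def by (subst nn_integral_density) (auto intro: measurable_compose[OF \<mu>_meas f_meas])
    finally show ?thesis .
  qed
  have "(\<lambda>k. \<integral>\<^sup>+s. f k s \<partial>m) \<longlonglongrightarrow> (\<integral>\<^sup>+s. f' s \<partial>m)"
    by (rule nn_integral_LIMSEQ) (auto simp: incseq_def le_fun_def f_inc f_lim measurable_cong_sets[OF sets_m refl] f_meas)
  moreover have "(\<lambda>k. \<integral>\<^sup>+t. indicator {0..} t * f k (?\<mu> t) \<partial>lborel) \<longlonglongrightarrow> (\<integral>\<^sup>+t. indicator {0..} t * f' (?\<mu> t) \<partial>lborel)"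
  proof (rule nn_integral_LIMSEQ)
    show "(\<lambda>k. indicator {0..} t * f k (?\<mu> t)) \<longlonglongrightarrow> indicator {0..} t * f' (?\<mu> t)" for t
      using f_lim[of "?\<mu> t"] by (auto split: split_indicator)
    show "incseq (\<lambda>k t. indicator {0..} t * f k (?\<mu> t))"
      by (auto simp: incseq_def le_fun_def f_inc mult_left_mono)
  qed measurable
  ultimately have eq: "(\<integral>\<^sup>+s. f' s \<partial>m) = (\<integral>\<^sup>+t. indicator {0..} t * f' (?\<mu> t) \<partial>lborel)"
    unfolding f_eq by (rule LIMSEQ_unique)
  have "AE s in m. 0 \<le> s"
    by (rule AE_I[where N = "{..<0}"]) (use neg in \<open>auto simp: sets_m\<close>)
  then have "(\<integral>\<^sup>+s. ennreal (s powr p) \<partial>m) = (\<integral>\<^sup>+s. f' s \<partial>m)"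
    by (intro nn_integral_cong_AE, elim eventually_mono) (auto simp: f'_def split: split_indicator)
  also note eq
  also have "(\<integral>\<^sup>+t. indicator {0..} t * f' (?\<mu> t) \<partial>lborel) = (\<integral>\<^sup>+t\<in>{0..}. ennreal (?\<mu> t powr p) \<partial>lborel)"
  proof (rule nn_integral_cong)
    fix t
    show "indicator {0..} t * f' (?\<mu> t) = ennreal (?\<mu> t powr p) * indicator {0..} t"
      using rearr_nonneg[OF n, of t] by (cases "?\<mu> t = 0") (auto simp: f'_def split: split_indicator)
  qed
  finally show ?thesis .
qed

section \<open>From the zeta function to logarithmic means\<close>

definition power_integral :: "(real \<Rightarrow> real) \<Rightarrow> real \<Rightarrow> ennreal" where
  "power_integral \<mu> p = (\<integral>\<^sup>+t\<in>{0..}. ennreal (\<mu> t powr p) \<partial>lborel)"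

definition partial_integral :: "(real \<Rightarrow> real) \<Rightarrow> real \<Rightarrow> real \<Rightarrow> ennreal" where
  "partial_integral \<mu> q u = (\<integral>\<^sup>+t\<in>{0..u}. ennreal (\<mu> t powr q) \<partial>lborel)"

lemma powr_le_interpolate:
  fixes x l p q :: real
  assumes "0 \<le> x" "0 < l" "0 < q" "q < p"
  shows "x powr q \<le> l powr q + l powr (q - p) * x powr p"
proof (cases "x \<le> l")
  case True
  then have "x powr q \<le> l powr q" using assms by (intro powr_mono2) auto
  then show ?thesis by (smt (verit) mult_nonneg_nonneg powr_ge_zero)
next
  case False
  then have "x powr (q - p) \<le> l powr (q - p)" using assms by (intro powr_mono2') auto
  then have "x powr (q - p) * x powr p \<le> l powr (q - p) * x powr p" by (intro mult_right_mono) auto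
  moreover have "x powr (q - p) * x powr p = x powr q" by (simp flip: powr_add)
  ultimately show ?thesis by (smt (verit) powr_ge_zero)
qed

text \<open>Interpolation at the level \<open>l = u powr (- 1 / q)\<close>: l^q = 1/u integrates to
  1 over [0,u], and l^(q-p) = e^(1/q) because (p - q) ln u = 1. The 3 is a bound for e.\<close>

lemma partial_integral_le_power_integral:
  fixes \<mu> :: "real \<Rightarrow> real"
  assumes \<mu>: "\<mu> \<in> borel_measurable borel" "\<And>t. 0 \<le> \<mu> t" and q: "1 \<le> q" and u: "1 < u"
  shows "partial_integral \<mu> q u \<le> 1 + 3 * power_integral \<mu> (q + 1 / ln u)"
proof -
  define p where "p = q + 1 / ln u"
  define l where "l = u powr (- 1 / q)"
  have ln: "ln u > 0" using u by simp
  have p: "q < p" using ln by (simp add: p_def)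
  have "l powr q = u powr (- 1 / q * q)" by (simp only: l_def powr_powr)
  also have "- 1 / q * q = - 1" using q by simp
  finally have lq: "l powr q = 1 / u" using u by (simp add: powr_minus_divide)
  have "l powr (q - p) = u powr ((1 / ln u) / q)" using q by (simp add: l_def powr_powr p_def mult.commute)
  also have "\<dots> = exp (1 / q)" using u ln q by (simp add: powr_def)
  also have "\<dots> \<le> exp 1" using q by simp
  also have "\<dots> \<le> 3" by (rule exp_le)
  finally have lp: "l powr (q - p) \<le> 3" .
  have "ennreal (\<mu> t powr q) * indicator {0..u} t
      \<le> ennreal (1 / u) * indicator {0..u} t + 3 * (ennreal (\<mu> t powr p) * indicator {0..} t)" for t
  proof (cases "t \<in> {0..u}")
    case True
    have "\<mu> t powr q \<le> 1 / u + 3 * \<mu> t powr p"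
      using powr_le_interpolate[of "\<mu> t" l q p] \<mu>(2) u q p lq mult_right_mono[OF lp, of "\<mu> t powr p"]
      by (simp add: l_def)
    then have "ennreal (\<mu> t powr q) \<le> ennreal (1 / u + 3 * \<mu> t powr p)" by (rule ennreal_leI)
    also have "\<dots> = ennreal (1 / u) + 3 * ennreal (\<mu> t powr p)"
      using u by (simp add: ennreal_mult' flip: ennreal_numeral)
    finally show ?thesis using True by simp
  qed simp
  then have "partial_integral \<mu> q u \<le> (\<integral>\<^sup>+t. ennreal (1 / u) * indicator {0..u} t
      + 3 * (ennreal (\<mu> t powr p) * indicator {0..} t) \<partial>lborel)"
    unfolding partial_integral_def by (rule nn_integral_mono)
  also have "\<dots> = (\<integral>\<^sup>+t. ennreal (1 / u) * indicator {0..u} t \<partial>lborel) + 3 * power_integral \<mu> p"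
    using \<mu>(1) by (subst nn_integral_add) (auto simp: nn_integral_cmult power_integral_def)
  also have "(\<integral>\<^sup>+t. ennreal (1 / u) * indicator {0..u} t \<partial>lborel) = 1"
    using u by (simp add: nn_integral_cmult_indicator flip: ennreal_mult)
  finally show ?thesis by (simp add: p_def)
qed

text \<open>For p = q + 1/ln u the factor 1/(p - q) is ln u, so the partial integral is at most 1 +
  3 K ln u; the 1 is absorbed into a fourth K ln u once K ln u \<ge> 1.\<close>

lemma log_mean_le_of_zeta_le:
  assumes \<mu>: "\<mu> \<in> borel_measurable borel" "\<And>t. 0 \<le> \<mu> t" and q: "1 \<le> q" and K: "0 < K"
    and ev: "\<forall>\<^sub>F p in at_right q. ennreal (p - q) * power_integral \<mu> p \<le> ennreal K"
  shows "\<forall>\<^sub>F u in at_top. partial_integral \<mu> q u / ennreal (ln (1 + u)) \<le> ennreal (4 * K)"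
proof -
  have lim: "filterlim (\<lambda>u. q + 1 / ln u) (at_right q) at_top"
    unfolding filterlim_at
  proof
    show "\<forall>\<^sub>F u in at_top. q + 1 / ln u \<in> {q<..} \<and> q + 1 / ln u \<noteq> q"
      using eventually_gt_at_top[of 1] by eventually_elim auto
    have "((\<lambda>u::real. 1 / ln u) \<longlongrightarrow> 0) at_top"
      by (intro tendsto_divide_0[OF tendsto_const] filterlim_at_top_imp_at_infinity ln_at_top)
    from tendsto_add[OF tendsto_const this, of q] show "((\<lambda>u. q + 1 / ln u) \<longlongrightarrow> q) at_top" by simp
  qed
  have "\<forall>\<^sub>F u in at_top. ln u \<ge> 1 / K"
    using ln_at_top unfolding filterlim_at_top by blast
  moreover have "\<forall>\<^sub>F u in at_top. ennreal ((q + 1 / ln u) - q) * power_integral \<mu> (q + 1 / ln u) \<le> ennreal K"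
    using ev lim unfolding filterlim_iff by blast
  ultimately show ?thesis
    using eventually_gt_at_top[of 1]
  proof eventually_elim
    case (elim u)
    then have ln: "ln u > 0" by simp
    let ?I = "power_integral \<mu> (q + 1 / ln u)"
    have "?I = ennreal (ln u) * (ennreal (1 / ln u) * ?I)"
      using ln by (simp flip: mult.assoc ennreal_mult)
    also have "\<dots> \<le> ennreal (ln u) * ennreal K" using elim by (intro mult_left_mono) auto
    finally have "3 * ?I \<le> 3 * (ennreal (ln u) * ennreal K)" by (rule mult_left_mono) simp
    also have "\<dots> = ennreal (3 * (ln u * K))" using ln K by (simp add: ennreal_mult')
    finally have I: "3 * ?I \<le> ennreal (3 * (ln u * K))" .
    have "partial_integral \<mu> q u \<le> 1 + 3 * ?I"
      using elim by (intro partial_integral_le_power_integral \<mu> q) auto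
    also have "\<dots> \<le> ennreal 1 + ennreal (3 * (ln u * K))" using I by (intro add_mono) auto
    also have "\<dots> = ennreal (1 + 3 * (ln u * K))" using ln K by (intro ennreal_plus[symmetric]) auto
    also have "\<dots> \<le> ennreal (4 * K * ln (1 + u))"
    proof (rule ennreal_leI)
      have "1 \<le> ln u * K" using elim K by (simp add: field_simps)
      moreover have "ln u * K \<le> ln (1 + u) * K" using elim K by (intro mult_right_mono) auto
      ultimately show "1 + 3 * (ln u * K) \<le> 4 * K * ln (1 + u)" by (simp add: algebra_simps)
    qed
    finally have "partial_integral \<mu> q u \<le> ennreal (4 * K * ln (1 + u))" .
    then have "partial_integral \<mu> q u / ennreal (ln (1 + u)) \<le> ennreal (4 * K * ln (1 + u)) / ennreal (ln (1 + u))"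
      by (rule divide_right_mono_ennreal)
    also have "\<dots> = ennreal (4 * K)" using elim K by (subst divide_ennreal) auto
    finally show ?case .
  qed
qed

section \<open>From logarithmic means to the zeta function\<close>

lemma nn_integral_powr_tail:
  assumes "0 < a" "0 < t"
  shows "(\<integral>\<^sup>+v. ennreal (a * v powr (- a - 1)) * indicator {t..} v \<partial>lborel) = ennreal (t powr (- a))"
proof -
  have "(\<integral>\<^sup>+v. ennreal (a * v powr (- a - 1)) * indicator {t..} v \<partial>lborel) = ennreal (0 - (- (t powr (- a))))"
  proof (rule nn_integral_FTC_atLeast[where F = "\<lambda>v. - (v powr (- a))"])
    show "((\<lambda>v. - (v powr (- a))) has_real_derivative a * v powr (- a - 1)) (at v)" if "t \<le> v" for v
      using that assms by (auto intro!: derivative_eq_intros)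
    have "((\<lambda>v. v powr (- a)) \<longlongrightarrow> 0) at_top"
      using assms by (intro tendsto_neg_powr filterlim_ident) auto
    from tendsto_minus[OF this] show "((\<lambda>v. - (v powr (- a))) \<longlongrightarrow> 0) at_top" by simp
  qed (use assms in auto)
  then show ?thesis by simp
qed

text \<open>An antiderivative is -v^(-a) (1 + ln v + 1/a). The summand 1/a is the simple pole that
  the factor p - q later cancels.\<close>

lemma nn_integral_powr_log:
  assumes a: "0 < a"
  shows "(\<integral>\<^sup>+v. ennreal (a * v powr (- a - 1) * (1 + ln v)) * indicator {1..} v \<partial>lborel) = ennreal (1 + 1 / a)"
proof -
  have "(\<integral>\<^sup>+v. ennreal (a * v powr (- a - 1) * (1 + ln v)) * indicator {1..} v \<partial>lborel)
      = ennreal (0 - (- (1 powr (- a) * (1 + ln 1 + 1 / a))))"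
  proof (rule nn_integral_FTC_atLeast[where F = "\<lambda>v. - (v powr (- a) * (1 + ln v + 1 / a))"])
    fix v :: real assume v: "1 \<le> v"
    have "v powr (- a) * (1 / v) = v powr (- a - 1)"
      using v by (simp add: powr_diff)
    then show "((\<lambda>v. - (v powr (- a) * (1 + ln v + 1 / a))) has_real_derivative a * v powr (- a - 1) * (1 + ln v)) (at v)"
      using v a by (auto intro!: derivative_eq_intros simp: field_simps)
  next
    have "((\<lambda>v. - (v powr (- a) * (1 + ln v + 1 / a))) \<longlongrightarrow> 0) at_top"
      using a by real_asymp
    then show "((\<lambda>v. - (v powr (- a) * (1 + ln v + 1 / a))) \<longlongrightarrow> 0) at_top" .
  qed (use a in auto)
  then show ?thesis by (simp add: add.commute)
qed

text \<open>Integration by parts: \<open>t\<^sup>-\<^sup>a\<close> is written as the integral of \<open>a v\<^sup>-\<^sup>a\<^sup>-\<^sup>1\<close> over \<open>v \<ge> t\<close>.\<close>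

lemma weighted_tail_le:
  fixes x :: "real \<Rightarrow> real"
  assumes x: "x \<in> borel_measurable borel" "\<And>t. 0 \<le> x t" and a: "0 < a" and b: "1 \<le> b" and K: "0 \<le> K"
    and bound: "\<And>v. b \<le> v \<Longrightarrow> (\<integral>\<^sup>+t\<in>{0..v}. ennreal (x t) \<partial>lborel) \<le> ennreal (K * ln (1 + v))"
  shows "(\<integral>\<^sup>+t\<in>{b..}. ennreal (x t * t powr (- a)) \<partial>lborel) \<le> ennreal (K * (1 + 1 / a))"
proof -
  note [measurable] = x(1)
  define w where "w v = a * v powr (- a - 1)" for v
  have [measurable]: "w \<in> borel_measurable borel" unfolding w_def by measurable
  have w_nonneg: "0 \<le> w v" for v using a by (simp add: w_def)
  have "(\<integral>\<^sup>+t\<in>{b..}. ennreal (x t * t powr (- a)) \<partial>lborel)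
      = (\<integral>\<^sup>+t. (\<integral>\<^sup>+v. ennreal (x t) * ennreal (w v) * indicator {b..} t * indicator {t..} v \<partial>lborel) \<partial>lborel)"
  proof (rule nn_integral_cong)
    fix t
    have "(\<integral>\<^sup>+v. ennreal (x t) * ennreal (w v) * indicator {b..} t * indicator {t..} v \<partial>lborel)
        = (ennreal (x t) * indicator {b..} t) * (\<integral>\<^sup>+v. ennreal (w v) * indicator {t..} v \<partial>lborel)"
      by (subst nn_integral_cmult[symmetric]) (auto intro!: nn_integral_cong simp: mult_ac)
    also have "\<dots> = ennreal (x t * t powr (- a)) * indicator {b..} t"
      using nn_integral_powr_tail[OF a, of t] x(2) b
      by (auto simp: w_def ennreal_mult split: split_indicator)
    finally show "ennreal (x t * t powr (- a)) * indicator {b..} t =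
       (\<integral>\<^sup>+v. ennreal (x t) * ennreal (w v) * indicator {b..} t * indicator {t..} v \<partial>lborel)" by simp
  qed
  also have "\<dots> = (\<integral>\<^sup>+v. (\<integral>\<^sup>+t. ennreal (x t) * ennreal (w v) * indicator {b..} t * indicator {t..} v \<partial>lborel) \<partial>lborel)"
  proof (rule lborel_pair.Fubini'[symmetric])
    \<comment> \<open>The indicator of the moving half-line is rewritten as that of a fixed
      half-plane to obtain joint measurability.\<close>
    have "(\<lambda>(t, v). ennreal (x t) * ennreal (w v) * indicator {b..} t * indicator {z. fst z \<le> snd z} (t, v))
        \<in> borel_measurable (borel \<Otimes>\<^sub>M borel)"
      by measurable
    also have "(\<lambda>(t, v). ennreal (x t) * ennreal (w v) * indicator {b..} t * indicator {z. fst z \<le> snd z} (t, v))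
       = (\<lambda>(t, v). ennreal (x t) * ennreal (w v) * indicator {b..} t * indicator {t..} v)"
      by (auto simp: fun_eq_iff split: split_indicator)
    finally show "(\<lambda>(t, v). ennreal (x t) * ennreal (w v) * indicator {b..} t * indicator {t..} v)
        \<in> borel_measurable (lborel \<Otimes>\<^sub>M lborel)" by simp
  qed
  also have "\<dots> \<le> (\<integral>\<^sup>+v. ennreal K * (ennreal (w v * (1 + ln v)) * indicator {1..} v) \<partial>lborel)"
  proof (rule nn_integral_mono)
    fix v
    show "(\<integral>\<^sup>+t. ennreal (x t) * ennreal (w v) * indicator {b..} t * indicator {t..} v \<partial>lborel)
        \<le> ennreal K * (ennreal (w v * (1 + ln v)) * indicator {1..} v)"
    proof (cases "b \<le> v")
      case False
      then have "(\<integral>\<^sup>+t. ennreal (x t) * ennreal (w v) * indicator {b..} t * indicator {t..} v \<partial>lborel) = (\<integral>\<^sup>+(t::real). 0 \<partial>lborel)"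
        by (intro nn_integral_cong) (auto split: split_indicator)
      then show ?thesis by simp
    next
      case True
      have "(\<integral>\<^sup>+t. ennreal (x t) * ennreal (w v) * indicator {b..} t * indicator {t..} v \<partial>lborel)
          \<le> (\<integral>\<^sup>+t. ennreal (w v) * (ennreal (x t) * indicator {0..v} t) \<partial>lborel)"
        using b by (intro nn_integral_mono) (auto simp: mult_ac split: split_indicator)
      also have "\<dots> = ennreal (w v) * (\<integral>\<^sup>+t\<in>{0..v}. ennreal (x t) \<partial>lborel)"
        by (rule nn_integral_cmult) measurable
      also have "\<dots> \<le> ennreal (w v) * ennreal (K * ln (1 + v))"
        using bound[OF True] by (rule mult_left_mono) simp
      also have "\<dots> \<le> ennreal (w v) * ennreal (K * (1 + ln v))"
      proof (intro mult_left_mono ennreal_leI)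
        have v: "1 \<le> v" using True b by simp
        \<comment> \<open>For v \<ge> 1 one has 1 + v \<le> 2 v \<le> e v, which gives the weight 1
          + ln v integrated in \<open>nn_integral_powr_log\<close>.\<close>
        have "ln (1 + v) \<le> ln (exp 1 * v)"
        proof (subst ln_le_cancel_iff)
          have "2 * v \<le> exp 1 * v" using exp_ge_add_one_self[of 1] v by (intro mult_right_mono) auto
          then show "1 + v \<le> exp 1 * v" by (rule order_trans[rotated]) (use v in simp)
        qed (use v in auto)
        also have "\<dots> = 1 + ln v" using v by (simp add: ln_mult)
        finally show "ln (1 + v) \<le> 1 + ln v" .
      qed (use K in auto)
      also have "\<dots> = ennreal K * ennreal (w v * (1 + ln v))"
        using K w_nonneg True b by (simp add: mult_ac flip: ennreal_mult)
      finally show ?thesis using True b by simp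
    qed
  qed
  also have "\<dots> = ennreal K * ennreal (1 + 1 / a)"
    using nn_integral_powr_log[OF a] by (subst nn_integral_cmult) (auto simp: w_def)
  also have "\<dots> = ennreal (K * (1 + 1 / a))" using K a by (simp add: ennreal_mult)
  finally show ?thesis .
qed

text \<open>Beyond b, monotonicity gives t \<mu>_t^q \<le> K ln (1 + t) \<le> 2 K sqrt t. With p = q
  + q d the surplus factor (\<mu>_t^q)^d is at most (2K)^d t^(-d/2), and
  \<open>weighted_tail_le\<close> with a = d/2 yields 1 + 2q/(p - q). Trading the logarithm for a
  square root only affects the rate d/2, that is, a constant in front of the pole. Below b the bound
  \<open>C\<close> is enough.\<close>

lemma power_integral_le:
  fixes \<mu> :: "real \<Rightarrow> real"
  assumes \<mu>: "\<mu> \<in> borel_measurable borel" "\<And>t. 0 \<le> \<mu> t" "\<And>t. \<mu> t \<le> C" and dec: "\<And>s t. s \<le> t \<Longrightarrow> \<mu> t \<le> \<mu> s"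
    and q: "1 \<le> q" and pq: "q < p" and K: "0 < K" and b: "1 \<le> b"
    and bound: "\<And>u. b \<le> u \<Longrightarrow> partial_integral \<mu> q u \<le> ennreal (K * ln (1 + u))"
  shows "power_integral \<mu> p \<le> ennreal (b * C powr p + (2 * K) powr (p / q - 1) * (K * (1 + 2 * q / (p - q))))"
proof -
  note [measurable] = \<mu>(1)
  define d where "d = p / q - 1"
  have d: "d > 0" using pq q by (simp add: d_def)
  have p_eq: "p = q + q * d" using q by (simp add: d_def field_simps)
  have x_le: "\<mu> t powr q \<le> 2 * K * t powr (- 1 / 2)" if t: "b \<le> t" for t
  proof -
    have "ennreal (t * \<mu> t powr q) = (\<integral>\<^sup>+s. ennreal (\<mu> t powr q) * indicator {0..t} s \<partial>lborel)"
      using t b by (simp add: nn_integral_cmult_indicator ennreal_mult mult.commute)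
    also have "\<dots> \<le> partial_integral \<mu> q t"
      unfolding partial_integral_def using \<mu>(2) q
      by (intro nn_integral_mono) (auto intro!: ennreal_leI powr_mono2 dec split: split_indicator)
    also have "\<dots> \<le> ennreal (K * ln (1 + t))" by (rule bound[OF t])
    finally have "t * \<mu> t powr q \<le> K * ln (1 + t)"
      using K t b by (subst (asm) ennreal_le_iff) auto
    also have "ln (1 + t) \<le> 2 * sqrt t"
    proof -
      have "ln (1 + t) \<le> ln ((1 + sqrt t)\<^sup>2)"
        using t b by (subst ln_le_cancel_iff) (auto simp: power2_eq_square algebra_simps add_pos_nonneg)
      also have "\<dots> = 2 * ln (1 + sqrt t)" using t b by (subst ln_realpow) (auto simp: add_pos_nonneg)
      also have "\<dots> \<le> 2 * sqrt t" using t b by (intro mult_left_mono ln_add_one_self_le_self) auto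
      finally show ?thesis .
    qed
    finally have "t * \<mu> t powr q \<le> K * (2 * sqrt t)" using K by simp
    also have "\<dots> = 2 * K * t powr (1 / 2)" using t b by (subst powr_half_sqrt) auto
    finally have "t * \<mu> t powr q \<le> 2 * K * t powr (1 / 2)" .
    moreover have "t powr (1/2) = t * t powr (- 1 / 2)"
    proof -
      have "t powr (1/2) = t powr (1 + - 1 / 2)" by simp
      also have "\<dots> = t * t powr (- 1 / 2)" using t b by (subst powr_add) simp
      finally show ?thesis .
    qed
    ultimately have "t * \<mu> t powr q \<le> t * (2 * K * t powr (- 1 / 2))" by (simp add: mult_ac)
    then show ?thesis using t b by (simp add: mult_le_cancel_left)
  qed
  have pt: "\<mu> t powr p \<le> (2 * K) powr d * (\<mu> t powr q * t powr (- (d / 2)))" if t: "b \<le> t" for t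
  proof -
    have "\<mu> t powr p = \<mu> t powr q * (\<mu> t powr q) powr d" by (simp add: powr_powr p_eq powr_add)
    also have "\<dots> \<le> \<mu> t powr q * (2 * K * t powr (- 1 / 2)) powr d"
      using d x_le[OF t] by (intro mult_left_mono powr_mono2) auto
    also have "(2 * K * t powr (- 1 / 2)) powr d = (2 * K) powr d * t powr (- (d / 2))"
      using K t b by (simp add: powr_mult powr_powr)
    finally show ?thesis by (simp add: mult_ac)
  qed
  have "power_integral \<mu> p \<le> (\<integral>\<^sup>+t. ennreal (C powr p) * indicator {0..b} t
      + ennreal ((2 * K) powr d) * (ennreal (\<mu> t powr q * t powr (- (d / 2))) * indicator {b..} t) \<partial>lborel)"
    unfolding power_integral_def
  proof (rule nn_integral_mono)
    fix t
    have 1: "ennreal (\<mu> t powr p) \<le> ennreal (C powr p)"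
      using \<mu> q pq by (intro ennreal_leI powr_mono2) auto
    have 2: "ennreal (\<mu> t powr p) \<le> ennreal ((2 * K) powr d) * ennreal (\<mu> t powr q * t powr (- (d / 2)))" if "b \<le> t"
      using pt[OF that] by (simp add: ennreal_leI flip: ennreal_mult)
    consider "t < 0" | "0 \<le> t" "t \<le> b" | "b < t" by linarith
    then show "ennreal (\<mu> t powr p) * indicator {0..} t \<le> ennreal (C powr p) * indicator {0..b} t
      + ennreal ((2 * K) powr d) * (ennreal (\<mu> t powr q * t powr (- (d / 2))) * indicator {b..} t)"
    proof cases
      case 2
      then show ?thesis using 1 by (auto intro: add_increasing2)
    next
      case 3
      then show ?thesis using 2 b by auto
    qed simp
  qed
  also have "\<dots> = ennreal (C powr p) * ennreal b
      + ennreal ((2 * K) powr d) * (\<integral>\<^sup>+t\<in>{b..}. ennreal (\<mu> t powr q * t powr (- (d / 2))) \<partial>lborel)"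
    using b by (subst nn_integral_add) (auto simp: nn_integral_cmult nn_integral_cmult_indicator)
  also have "\<dots> \<le> ennreal (C powr p) * ennreal b + ennreal ((2 * K) powr d) * ennreal (K * (1 + 1 / (d / 2)))"
  proof (intro add_left_mono mult_left_mono weighted_tail_le)
    show "(\<integral>\<^sup>+t\<in>{0..v}. ennreal (\<mu> t powr q) \<partial>lborel) \<le> ennreal (K * ln (1 + v))" if "b \<le> v" for v
      using bound[OF that] by (simp add: partial_integral_def)
  qed (use d K b in auto)
  also have "\<dots> = ennreal (b * C powr p + (2 * K) powr d * (K * (1 + 1 / (d / 2))))"
    using d K b by (simp add: mult.commute flip: ennreal_mult ennreal_plus)
  also have "1 / (d / 2) = 2 * q / (p - q)" using q pq by (simp add: d_def field_simps)
  finally show ?thesis by (simp add: d_def)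
qed

text \<open>After multiplication by p - q the bound tends to 2 q K as p decreases to q: the
  contribution of [0,b] disappears and (2K)^(p/q - 1) tends to 1. The additional K is the room
  needed for an eventual inequality.\<close>

lemma zeta_le_of_log_mean_le:
  fixes \<mu> :: "real \<Rightarrow> real"
  assumes \<mu>: "\<mu> \<in> borel_measurable borel" "\<And>t. 0 \<le> \<mu> t" "\<And>t. \<mu> t \<le> C" and dec: "\<And>s t. s \<le> t \<Longrightarrow> \<mu> t \<le> \<mu> s"
    and q: "1 \<le> q" and K: "0 < K"
    and ev: "\<forall>\<^sub>F u in at_top. partial_integral \<mu> q u / ennreal (ln (1 + u)) \<le> ennreal K"
  shows "\<forall>\<^sub>F p in at_right q. ennreal (p - q) * power_integral \<mu> p \<le> ennreal ((2 * q + 1) * K)"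
proof -
  obtain b0 where b0: "\<And>u. b0 \<le> u \<Longrightarrow> partial_integral \<mu> q u / ennreal (ln (1 + u)) \<le> ennreal K"
    using ev by (auto simp: eventually_at_top_linorder)
  define b where "b = max b0 1"
  have b: "1 \<le> b" by (simp add: b_def)
  have bound: "partial_integral \<mu> q u \<le> ennreal (K * ln (1 + u))" if u: "b \<le> u" for u
  proof -
    have ln: "ln (1 + u) > 0" using u b by simp
    have "partial_integral \<mu> q u = partial_integral \<mu> q u / ennreal (ln (1 + u)) * ennreal (ln (1 + u))"
      using ln by (simp add: ennreal_divide_times)
    also have "\<dots> \<le> ennreal K * ennreal (ln (1 + u))"
      using b0[of u] u by (intro mult_right_mono) (auto simp: b_def)
    finally show ?thesis using K ln by (simp add: ennreal_mult)
  qed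
  \<comment> \<open>A positive bound has powers that are continuous in the exponent.\<close>
  define C' where "C' = max C 1"
  have C': "C' > 0" "\<And>t. \<mu> t \<le> C'" using \<mu>(3) by (auto simp: C'_def intro: le_max_iff_disj[THEN iffD2])
  let ?g = "\<lambda>p. (p - q) * (b * C' powr p) + (2 * K) powr (p / q - 1) * (K * ((p - q) + 2 * q))"
  have "(?g \<longlongrightarrow> (q - q) * (b * C' powr q) + (2 * K) powr (q / q - 1) * (K * ((q - q) + 2 * q))) (at_right q)"
    using q K C' by (intro tendsto_intros) auto
  then have "(?g \<longlongrightarrow> 2 * q * K) (at_right q)" using q K by (simp add: mult_ac)
  then have "\<forall>\<^sub>F p in at_right q. ?g p < (2 * q + 1) * K"
    using K by (intro order_tendstoD(2)) (auto simp: algebra_simps)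
  then show ?thesis
    using eventually_at_right_less[of q]
  proof eventually_elim
    case (elim p)
    have "ennreal (p - q) * power_integral \<mu> p
        \<le> ennreal (p - q) * ennreal (b * C' powr p + (2 * K) powr (p / q - 1) * (K * (1 + 2 * q / (p - q))))"
      using elim by (intro mult_left_mono power_integral_le[OF \<mu>(1,2) C'(2) dec q _ K b bound]) auto
    also have "\<dots> = ennreal ((p - q) * (b * C' powr p + (2 * K) powr (p / q - 1) * (K * (1 + 2 * q / (p - q)))))"
      using elim by (intro ennreal_mult'[symmetric]) auto
    also have "(p - q) * (b * C' powr p + (2 * K) powr (p / q - 1) * (K * (1 + 2 * q / (p - q)))) = ?g p"
      using elim by (simp add: field_simps)
    also have "ennreal (?g p) \<le> ennreal ((2 * q + 1) * K)" using elim by (intro ennreal_leI) auto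
    finally show ?case .
  qed
qed

section \<open>Equivalence of the seminorms\<close>

lemma epowr_top [simp]: "epowr top a = top"
  by (simp add: epowr_def)

lemma epowr_ennreal: "0 \<le> x \<Longrightarrow> epowr (ennreal x) a = ennreal (x powr a)"
  by (simp add: epowr_def)

lemma epowr_mono: "x \<le> y \<Longrightarrow> 0 < a \<Longrightarrow> epowr x a \<le> epowr y a"
  by (cases x; cases y) (auto simp: epowr_ennreal powr_mono2 top_unique intro!: ennreal_leI)

lemma epowr_one: "epowr x 1 = x"
  by (cases x) (auto simp: epowr_ennreal)

lemma epowr_epowr: "0 < a \<Longrightarrow> 0 < b \<Longrightarrow> epowr (epowr x a) b = epowr x (a * b)"
  by (cases x) (auto simp: epowr_ennreal powr_powr)

lemma epowr_cmult: "0 < c \<Longrightarrow> 0 < a \<Longrightarrow> epowr (ennreal c * x) a = ennreal (c powr a) * epowr x a"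
  by (cases x) (auto simp: epowr_ennreal powr_mult ennreal_mult_top simp flip: ennreal_mult)

lemma epowr_less_top: "epowr x a < \<infinity> \<longleftrightarrow> x < \<infinity>"
  by (cases x) (auto simp: epowr_ennreal)

text \<open>Turns an implication between eventual bounds at positive finite levels into an
  inequality of limsups. It is applied at l + e, and e tends to 0; \<alpha> > 0 makes the limit
  correct also for l = 0. An infinite limsup of f makes the claim trivial.\<close>

lemma Limsup_transfer:
  fixes f :: "'a \<Rightarrow> ennreal" and g :: "'b \<Rightarrow> ennreal"
  assumes c: "0 < c" and \<alpha>: "0 < \<alpha>"
    and transfer: "\<And>K. 0 < K \<Longrightarrow> \<forall>\<^sub>F x in F. f x \<le> ennreal K \<Longrightarrow> \<forall>\<^sub>F y in G. g y \<le> ennreal (c * K powr \<alpha>)"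
  shows "Limsup G g \<le> ennreal c * epowr (Limsup F f) \<alpha>"
proof (cases "Limsup F f")
  case (real l)
  have "Limsup G g \<le> ennreal (c * (l + e) powr \<alpha>)" if e: "e > 0" for e
  proof (rule Limsup_bounded, rule transfer)
    have "Limsup F f < ennreal (l + e)" using real e by (simp add: ennreal_less_iff)
    then have "\<forall>\<^sub>F x in F. f x < ennreal (l + e)" by (rule Limsup_lessD)
    then show "\<forall>\<^sub>F x in F. f x \<le> ennreal (l + e)" by eventually_elim simp
  qed (use real e in simp)
  then have "\<forall>\<^sub>F e in at_right 0. Limsup G g \<le> ennreal (c * (l + e) powr \<alpha>)"
    by (auto simp: eventually_at_filter)
  moreover have "((\<lambda>e. ennreal (c * (l + e) powr \<alpha>)) \<longlongrightarrow> ennreal (c * (l + 0) powr \<alpha>)) (at_right 0)"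
  proof (intro tendsto_ennrealI tendsto_mult tendsto_powr' tendsto_add tendsto_const tendsto_ident_at)
    have "\<forall>\<^sub>F e in at_right 0. 0 \<le> l + e" using real by (auto simp: eventually_at_filter)
    then show "l + 0 \<noteq> 0 \<or> 0 < \<alpha> \<and> (\<forall>\<^sub>F e in at_right 0. 0 \<le> l + e)" using \<alpha> by simp
  qed
  ultimately have "Limsup G g \<le> ennreal (c * (l + 0) powr \<alpha>)"
    by (intro tendsto_lowerbound[of _ _ "at_right (0::real)"]) auto
  then show ?thesis using real c by (simp add: epowr_ennreal ennreal_mult)
next
  case top
  then show ?thesis using c by (simp add: ennreal_mult_top)
qed

text \<open>K^p tends to K^q, and the factor 2 absorbs the moving exponent.\<close>

lemma eventually_le_of_root_le:
  assumes q: "1 \<le> q" and K: "0 < K" and ev: "\<forall>\<^sub>F p in at_right q. epowr (\<zeta> p) (1 / p) \<le> ennreal K"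
  shows "\<forall>\<^sub>F p in at_right q. \<zeta> p \<le> ennreal (2 * K powr q)"
proof -
  have "((\<lambda>p. K powr p) \<longlongrightarrow> K powr q) (at_right q)" using K by (intro tendsto_intros) auto
  then have "\<forall>\<^sub>F p in at_right q. K powr p < 2 * K powr q" using K by (intro order_tendstoD(2)) auto
  with ev show ?thesis
    using eventually_at_right_less[of q]
  proof eventually_elim
    case (elim p)
    then have p: "0 < p" using q by simp
    have "\<zeta> p = epowr (epowr (\<zeta> p) (1 / p)) p" using p by (simp add: epowr_epowr epowr_one)
    also have "\<dots> \<le> epowr (ennreal K) p" using elim p by (intro epowr_mono)
    also have "\<dots> \<le> ennreal (2 * K powr q)" using elim K by (auto simp: epowr_ennreal intro: ennreal_leI)
    finally show ?case .
  qed
qed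

lemma eventually_root_le_of_le:
  assumes q: "1 \<le> q" and K: "0 < K" and ev: "\<forall>\<^sub>F p in at_right q. \<zeta> p \<le> ennreal K"
  shows "\<forall>\<^sub>F p in at_right q. epowr (\<zeta> p) (1 / p) \<le> ennreal (2 * K powr (1 / q))"
proof -
  have "((\<lambda>p. K powr (1 / p)) \<longlongrightarrow> K powr (1 / q)) (at_right q)" using K q by (intro tendsto_intros) auto
  then have "\<forall>\<^sub>F p in at_right q. K powr (1 / p) < 2 * K powr (1 / q)" using K by (intro order_tendstoD(2)) auto
  with ev show ?thesis
    using eventually_at_right_less[of q]
  proof eventually_elim
    case (elim p)
    have "epowr (\<zeta> p) (1 / p) \<le> epowr (ennreal K) (1 / p)" using elim q by (intro epowr_mono) auto
    also have "\<dots> \<le> ennreal (2 * K powr (1 / q))" using elim K by (auto simp: epowr_ennreal intro: ennreal_leI)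
    finally show ?case .
  qed
qed

text \<open>The upper constant max b (1/a) secures the ordering of the two constants that
  \<open>equivalent_on\<close> demands.\<close>

lemma equivalent_onI:
  assumes a: "0 < a" and b: "0 < b"
    and f: "\<And>T. T \<in> X \<Longrightarrow> f T \<le> ennreal a * g T" and g: "\<And>T. T \<in> X \<Longrightarrow> g T \<le> ennreal b * f T"
  shows "equivalent_on X f g"
  unfolding equivalent_on_def
proof (intro exI conjI ballI)
  show "0 < 1 / a" "1 / a \<le> max b (1 / a)" using a by auto
  fix T assume T: "T \<in> X"
  have "ennreal (1 / a) * f T \<le> ennreal (1 / a) * (ennreal a * g T)" using f[OF T] by (rule mult_left_mono) simp
  also have "\<dots> = g T" using a by (simp flip: mult.assoc ennreal_mult)
  finally show "ennreal (1 / a) * f T \<le> g T" .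
  have "g T \<le> ennreal b * f T" by (rule g[OF T])
  also have "\<dots> \<le> ennreal (max b (1 / a)) * f T" by (intro mult_right_mono ennreal_leI) auto
  finally show "g T \<le> ennreal (max b (1 / a)) * f T" .
qed

section \<open>Generalised singular values and logarithmic means of operators\<close>

context trace_algebra
begin

lemma dist_fun_eq: "A \<in> N \<Longrightarrow> dist_fun A s = emeasure (spectral_trace (op_abs A)) {s<..}"
  using emeasure_spectral_trace[OF vN_op_abs[OF vN]] by (simp add: dist_fun_def)

lemma tail_fun_dist_fun:
  assumes A: "A \<in> N"
  shows "tail_fun (norm (op_abs A) + 1) (dist_fun A)"
proof -
  note P = vN_op_abs[OF vN A]
  interpret pvm "spectral_measure (op_abs A)" 0 "norm (op_abs A) + 1"
    by (rule pvm_spectral_measure[OF pos_partD(2)[OF P]])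
  have "spectral_measure (op_abs A) {norm (op_abs A) + 1<..} = spectral_measure (op_abs A) {}"
    by (rule E_cong) auto
  then have "dist_fun A (norm (op_abs A) + 1) = 0" by (simp add: dist_fun_def E_empty tau_zero)
  moreover have "dist_fun A s \<le> dist_fun A r" if "r \<le> s" for r s
    using that by (auto simp: dist_fun_eq[OF A] intro!: emeasure_mono)
  ultimately show ?thesis by (simp add: tail_fun_def add_nonneg_nonneg)
qed

lemma gen_sval_eq: "gen_sval \<tau> A = rearr (dist_fun A)"
  by (simp add: fun_eq_iff gen_sval_def rearr_def dist_fun_def)

lemma gen_sval:
  assumes A: "A \<in> N"
  shows gen_sval_measurable: "gen_sval \<tau> A \<in> borel_measurable borel"
    and gen_sval_nonneg: "0 \<le> gen_sval \<tau> A t" and gen_sval_le: "gen_sval \<tau> A t \<le> norm (op_abs A) + 1"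
    and gen_sval_antimono: "t \<le> t' \<Longrightarrow> gen_sval \<tau> A t' \<le> gen_sval \<tau> A t"
  unfolding gen_sval_eq
  using rearr_measurable rearr_nonneg rearr_le_bound rearr_antimono tail_fun_dist_fun[OF A] by blast+

lemma tau_op_powr:
  assumes T: "T \<in> pos_part N" and p: "0 < p"
  shows "\<tau> (op_powr T p) = power_integral (gen_sval \<tau> T) p"
proof -
  note T' = pos_partD[OF T]
  interpret pvm "spectral_measure T" 0 "norm T + 1" by (rule pvm_spectral_measure[OF T'(2)])
  have abs: "op_abs T = T" by (rule op_abs_positive[OF T'(2)])
  have n: "dist_fun T = (\<lambda>s. emeasure (spectral_trace T) {s<..})"
    using dist_fun_eq[OF T'(1)] by (simp add: abs fun_eq_iff)
  have "spectral_measure T {..<0} = spectral_measure T {}" by (rule E_cong) auto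
  then have neg: "emeasure (spectral_trace T) {..<0} = 0"
    by (simp add: emeasure_spectral_trace[OF T] E_empty tau_zero)
  have "\<tau> (op_powr T p) = (\<integral>\<^sup>+t. ennreal (t powr p) \<partial>spectral_trace T)"
    unfolding op_powr_def using p by (intro tau_fun_calc[OF T] admissible_powr) auto
  also have "\<dots> = (\<integral>\<^sup>+t\<in>{0..}. ennreal (rearr (dist_fun T) t powr p) \<partial>lborel)"
    unfolding n using tail_fun_dist_fun[OF T'(1), unfolded n] neg p
    by (intro nn_integral_powr_eq_rearr) auto
  finally show ?thesis by (simp add: power_integral_def gen_sval_eq)
qed

definition log_mean :: "real \<Rightarrow> ('h \<Rightarrow>\<^sub>L 'h) \<Rightarrow> real \<Rightarrow> ennreal" where
  "log_mean q A u = partial_integral (gen_sval \<tau> A) q u / ennreal (ln (1 + u))"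

lemma L_norm_eq: "L_norm \<tau> q A = (SUP u\<in>{1<..}. epowr (log_mean q A u) (1 / q))"
  by (simp add: L_norm_def log_mean_def partial_integral_def)

lemma log_mean_le_L_norm:
  assumes q: "1 \<le> q" and u: "1 < u"
  shows "log_mean q A u \<le> epowr (L_norm \<tau> q A) q"
proof -
  have "epowr (log_mean q A u) (1 / q) \<le> L_norm \<tau> q A"
    unfolding L_norm_eq using u by (intro SUP_upper) auto
  then have "epowr (epowr (log_mean q A u) (1 / q)) q \<le> epowr (L_norm \<tau> q A) q"
    using q by (intro epowr_mono) auto
  then show ?thesis using q by (simp add: epowr_epowr epowr_one)
qed

lemma L_norm_le:
  assumes "1 \<le> q" "0 \<le> K" "\<And>u. 1 < u \<Longrightarrow> log_mean q A u \<le> ennreal K"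
  shows "L_norm \<tau> q A \<le> ennreal (K powr (1 / q))"
  unfolding L_norm_eq
proof (rule SUP_least)
  fix u :: real assume "u \<in> {1<..}"
  then have "epowr (log_mean q A u) (1 / q) \<le> epowr (ennreal K) (1 / q)"
    using assms by (intro epowr_mono) auto
  then show "epowr (log_mean q A u) (1 / q) \<le> ennreal (K powr (1 / q))"
    using assms(2) by (simp only: epowr_ennreal)
qed

text \<open>An estimate for moderate u: the integrand is at most C^q on an interval of length u, and
  ln (1 + u) \<ge> ln 2.\<close>

lemma log_mean_bounded:
  fixes C :: real
  assumes A: "A \<in> N" and q: "1 \<le> q" and C: "0 \<le> C" "\<And>t. gen_sval \<tau> A t \<le> C" and u: "1 < u"
  shows "log_mean q A u \<le> ennreal (C powr q * u / ln 2)"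
proof -
  have "partial_integral (gen_sval \<tau> A) q u \<le> (\<integral>\<^sup>+t. ennreal (C powr q) * indicator {0..u} t \<partial>lborel)"
    unfolding partial_integral_def using C q gen_sval_nonneg[OF A]
    by (intro nn_integral_mono) (auto intro!: ennreal_leI powr_mono2 split: split_indicator)
  also have "\<dots> = ennreal (C powr q * u)"
    using u by (simp add: nn_integral_cmult_indicator ennreal_mult)
  finally have "log_mean q A u \<le> ennreal (C powr q * u) / ennreal (ln (1 + u))"
    unfolding log_mean_def by (rule divide_right_mono_ennreal)
  also have "\<dots> = ennreal (C powr q * u / ln (1 + u))" using u by (intro divide_ennreal) auto
  also have "\<dots> \<le> ennreal (C powr q * u / ln 2)"
    using u by (intro ennreal_leI divide_left_mono mult_pos_pos) auto
  finally show ?thesis .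
qed

definition log_limsup :: "real \<Rightarrow> ('h \<Rightarrow>\<^sub>L 'h) \<Rightarrow> ennreal" where
  "log_limsup q A = Limsup at_top (log_mean q A)"

text \<open>The supremum over u > 1 can be infinite only through large u, because on bounded ranges
  of u the boundedness of A controls the mean.\<close>

lemma L_norm_finite_iff:
  assumes A: "A \<in> N" and q: "1 \<le> q"
  shows "L_norm \<tau> q A < \<infinity> \<longleftrightarrow> log_limsup q A < \<infinity>"
proof
  assume "L_norm \<tau> q A < \<infinity>"
  then have "epowr (L_norm \<tau> q A) q < \<infinity>" by (simp only: epowr_less_top)
  moreover have "log_limsup q A \<le> epowr (L_norm \<tau> q A) q"
    unfolding log_limsup_def
    by (rule Limsup_bounded) (use eventually_gt_at_top[of 1] in eventually_elim, rule log_mean_le_L_norm[OF q])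
  ultimately show "log_limsup q A < \<infinity>" by (rule le_less_trans[rotated])
next
  assume fin: "log_limsup q A < \<infinity>"
  then obtain l where l: "log_limsup q A = ennreal l" "0 \<le> l" by (cases "log_limsup q A") auto
  define K where "K = l + 1"
  have K: "log_limsup q A < ennreal K" "0 \<le> K" using l by (auto simp: K_def ennreal_less_iff)
  then have "\<forall>\<^sub>F u in at_top. log_mean q A u < ennreal K"
    unfolding log_limsup_def by (intro Limsup_lessD)
  then obtain u0 where u0: "\<And>u. u0 \<le> u \<Longrightarrow> log_mean q A u < ennreal K"
    by (auto simp: eventually_at_top_linorder)
  define C where "C = norm (op_abs A) + 1"
  have C: "0 \<le> C" by (simp add: C_def add_nonneg_nonneg)
  have "L_norm \<tau> q A \<le> ennreal (max K (C powr q * u0 / ln 2) powr (1 / q))"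
  proof (rule L_norm_le[OF q])
    fix u :: real assume u: "1 < u"
    show "log_mean q A u \<le> ennreal (max K (C powr q * u0 / ln 2))"
    proof (cases "u0 \<le> u")
      case True
      then have "log_mean q A u \<le> ennreal K" using u0 by (intro less_imp_le)
      also have "\<dots> \<le> ennreal (max K (C powr q * u0 / ln 2))" by (intro ennreal_leI) simp
      finally show ?thesis .
    next
      case False
      have "log_mean q A u \<le> ennreal (C powr q * u / ln 2)"
        using gen_sval_le[OF A] by (intro log_mean_bounded[OF A q C _ u]) (simp add: C_def)
      also have "\<dots> \<le> ennreal (max K (C powr q * u0 / ln 2))"
        using False by (intro ennreal_leI le_max_iff_disj[THEN iffD2] disjI2 divide_right_mono mult_left_mono) auto
      finally show ?thesis .
    qed
  qed (use K in auto)
  then show "L_norm \<tau> q A < \<infinity>" by (rule le_less_trans) simp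
qed

text \<open>Substituting p = q r gives p - q = q (r - 1), hence \<zeta>(q r) = q \<eta>(r). Besides
  this factor the two sides differ in the root 1/p against 1/q, which costs a factor 2.\<close>

lemma Z_norm_vs_Z1_norm:
  assumes T: "T \<in> pos_part N" and q: "1 \<le> q"
  shows "Z1_norm \<tau> (op_powr T q) \<le> 2 * epowr (Z_norm \<tau> q T) q"
    and "Z_norm \<tau> q T \<le> ennreal (2 * q powr (1 / q)) * Z_norm_plus \<tau> q T"
proof -
  define \<zeta> where "\<zeta> p = ennreal (p - q) * \<tau> (op_powr T p)" for p
  define \<eta> where "\<eta> = (\<lambda>r. ennreal (r - 1) * \<tau> (op_powr (op_powr T q) r))"
  have Z: "Z_norm \<tau> q T = Limsup (at_right q) (\<lambda>p. epowr (\<zeta> p) (1 / p))"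
    by (simp add: Z_norm_def \<zeta>_def)
  have Z1: "Z1_norm \<tau> (op_powr T q) = Limsup (at_right 1) \<eta>"
    by (simp add: Z1_norm_def \<eta>_def)
  have \<zeta>_\<eta>: "\<zeta> (q * r) = ennreal q * \<eta> r" if "1 < r" for r
  proof -
    have "op_powr (op_powr T q) r = op_powr T (q * r)"
      using q that by (intro op_powr_op_powr pos_partD(2)[OF T]) auto
    moreover have "q * r - q = q * (r - 1)" by (simp add: algebra_simps)
    ultimately show ?thesis using q that by (simp add: \<zeta>_def \<eta>_def ennreal_mult mult.assoc)
  qed
  have lim1: "filterlim (\<lambda>r. q * r) (at_right q) (at_right 1)"
    unfolding filterlim_at
  proof
    show "\<forall>\<^sub>F r in at_right 1. q * r \<in> {q<..} \<and> q * r \<noteq> q"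
      using eventually_at_right_less[of 1] by eventually_elim (use q in auto)
    have "((\<lambda>r. q * r) \<longlongrightarrow> q * 1) (at_right 1)" by (intro tendsto_intros)
    then show "((\<lambda>r. q * r) \<longlongrightarrow> q) (at_right 1)" by simp
  qed
  have lim2: "filterlim (\<lambda>p. p / q) (at_right 1) (at_right q)"
    unfolding filterlim_at
  proof
    show "\<forall>\<^sub>F p in at_right q. p / q \<in> {1<..} \<and> p / q \<noteq> 1"
      using eventually_at_right_less[of q] by eventually_elim (use q in auto)
    have "((\<lambda>p. p / q) \<longlongrightarrow> q / q) (at_right q)" using q by (intro tendsto_intros) auto
    then show "((\<lambda>p. p / q) \<longlongrightarrow> 1) (at_right q)" using q by simp
  qed
  have "Limsup (at_right 1) \<eta> \<le> ennreal 2 * epowr (Limsup (at_right q) (\<lambda>p. epowr (\<zeta> p) (1 / p))) q"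
  proof (rule Limsup_transfer)
    fix K :: real assume K: "0 < K" "\<forall>\<^sub>F p in at_right q. epowr (\<zeta> p) (1 / p) \<le> ennreal K"
    then have "\<forall>\<^sub>F p in at_right q. \<zeta> p \<le> ennreal (2 * K powr q)" by (intro eventually_le_of_root_le[OF q])
    then have "\<forall>\<^sub>F r in at_right 1. \<zeta> (q * r) \<le> ennreal (2 * K powr q)"
      using lim1 unfolding filterlim_iff by blast
    then show "\<forall>\<^sub>F r in at_right 1. \<eta> r \<le> ennreal (2 * K powr q)"
      using eventually_at_right_less[of 1]
    proof eventually_elim
      case (elim r)
      have "1 * \<eta> r \<le> ennreal q * \<eta> r" using q by (intro mult_right_mono) (auto simp: ennreal_leI[of 1 q, simplified])
      then show ?case using elim \<zeta>_\<eta>[of r] by simp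
    qed
  qed (use q in auto)
  then show "Z1_norm \<tau> (op_powr T q) \<le> 2 * epowr (Z_norm \<tau> q T) q" by (simp add: Z Z1)
  have "Limsup (at_right q) (\<lambda>p. epowr (\<zeta> p) (1 / p)) \<le> ennreal (2 * q powr (1 / q)) * epowr (Limsup (at_right 1) \<eta>) (1 / q)"
  proof (rule Limsup_transfer)
    fix K :: real assume K: "0 < K" "\<forall>\<^sub>F r in at_right 1. \<eta> r \<le> ennreal K"
    then have "\<forall>\<^sub>F p in at_right q. \<eta> (p / q) \<le> ennreal K"
      using lim2 unfolding filterlim_iff by blast
    then have "\<forall>\<^sub>F p in at_right q. \<zeta> p \<le> ennreal (q * K)"
      using eventually_at_right_less[of q]
    proof eventually_elim
      case (elim p)
      then have "\<zeta> p = ennreal q * \<eta> (p / q)" using \<zeta>_\<eta>[of "p / q"] q by simp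
      also have "\<dots> \<le> ennreal q * ennreal K" using elim by (intro mult_left_mono) auto
      finally show ?case using q by (simp add: ennreal_mult')
    qed
    then have "\<forall>\<^sub>F p in at_right q. epowr (\<zeta> p) (1 / p) \<le> ennreal (2 * (q * K) powr (1 / q))"
      using q K by (intro eventually_root_le_of_le) auto
    then show "\<forall>\<^sub>F p in at_right q. epowr (\<zeta> p) (1 / p) \<le> ennreal (2 * q powr (1 / q) * K powr (1 / q))"
      using q K by (simp add: powr_mult mult.assoc)
  qed (use q in auto)
  then show "Z_norm \<tau> q T \<le> ennreal (2 * q powr (1 / q)) * Z_norm_plus \<tau> q T"
    by (simp add: Z Z1 Z_norm_plus_def)
qed

section \<open>The zeta seminorm against the logarithmic limsup\<close>

lemma zeta_eventually_eq:
  assumes T: "T \<in> pos_part N" and q: "1 \<le> q"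
  shows "\<forall>\<^sub>F p in at_right q. ennreal (p - q) * \<tau> (op_powr T p) = ennreal (p - q) * power_integral (gen_sval \<tau> T) p"
  using eventually_at_right_less[of q] by eventually_elim (use q tau_op_powr[OF T] in auto)

text \<open>The 8 is a 2 for removing the p-th root times the 4 of
  \<open>log_mean_le_of_zeta_le\<close>.\<close>

lemma log_limsup_le_Z_norm:
  assumes T: "T \<in> pos_part N" and q: "1 \<le> q"
  shows "log_limsup q T \<le> 8 * epowr (Z_norm \<tau> q T) q"
proof -
  note TN = pos_partD(1)[OF T]
  have "Limsup at_top (log_mean q T) \<le> ennreal 8 * epowr (Z_norm \<tau> q T) q"
    unfolding Z_norm_def
  proof (rule Limsup_transfer)
    fix K :: real assume K: "0 < K"
      and ev: "\<forall>\<^sub>F p in at_right q. epowr (ennreal (p - q) * \<tau> (op_powr T p)) (1 / p) \<le> ennreal K"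
    have "\<forall>\<^sub>F p in at_right q. ennreal (p - q) * \<tau> (op_powr T p) \<le> ennreal (2 * K powr q)"
      by (rule eventually_le_of_root_le[OF q K ev])
    then have "\<forall>\<^sub>F p in at_right q. ennreal (p - q) * power_integral (gen_sval \<tau> T) p \<le> ennreal (2 * K powr q)"
      using zeta_eventually_eq[OF T q] by eventually_elim simp
    then have "\<forall>\<^sub>F u in at_top. log_mean q T u \<le> ennreal (4 * (2 * K powr q))"
      unfolding log_mean_def using K
      by (intro log_mean_le_of_zeta_le gen_sval_measurable[OF TN] gen_sval_nonneg[OF TN] q) auto
    then show "\<forall>\<^sub>F u in at_top. log_mean q T u \<le> ennreal (8 * K powr q)" by simp
  qed (use q in auto)
  then show ?thesis by (simp add: log_limsup_def)
qed

lemma zeta_le_log_mean: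
  assumes T: "T \<in> pos_part N" and q: "1 \<le> q" and K: "0 < K"
    and ev: "\<forall>\<^sub>F u in at_top. log_mean q T u \<le> ennreal K"
  shows "\<forall>\<^sub>F p in at_right q. ennreal (p - q) * \<tau> (op_powr T p) \<le> ennreal ((2 * q + 1) * K)"
proof -
  note TN = pos_partD(1)[OF T]
  have "\<forall>\<^sub>F p in at_right q. ennreal (p - q) * power_integral (gen_sval \<tau> T) p \<le> ennreal ((2 * q + 1) * K)"
    using gen_sval[OF TN] ev unfolding log_mean_def by (intro zeta_le_of_log_mean_le[OF _ _ _ _ q K]) auto
  then show ?thesis using zeta_eventually_eq[OF T q] by eventually_elim simp
qed

lemma Z_norm_le_log_limsup:
  assumes T: "T \<in> pos_part N" and q: "1 \<le> q"
  shows "Z_norm \<tau> q T \<le> ennreal (2 * (2 * q + 1) powr (1 / q)) * epowr (log_limsup q T) (1 / q)"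
  unfolding Z_norm_def log_limsup_def
proof (rule Limsup_transfer)
  fix K :: real assume K: "0 < K" and ev: "\<forall>\<^sub>F u in at_top. log_mean q T u \<le> ennreal K"
  have "\<forall>\<^sub>F p in at_right q. epowr (ennreal (p - q) * \<tau> (op_powr T p)) (1 / p)
      \<le> ennreal (2 * ((2 * q + 1) * K) powr (1 / q))"
    using q K zeta_le_log_mean[OF T q K ev] by (intro eventually_root_le_of_le) auto
  then show "\<forall>\<^sub>F p in at_right q. epowr (ennreal (p - q) * \<tau> (op_powr T p)) (1 / p)
      \<le> ennreal (2 * (2 * q + 1) powr (1 / q) * K powr (1 / q))"
    using q K by (simp add: powr_mult mult.assoc)
qed (use q in auto)

section \<open>Sums of operators and the distance to the closure of the trace class\<close>

lemma gen_sval_add: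
  assumes X: "X \<in> N" and Y: "Y \<in> N" and t: "0 \<le> t"
  shows "gen_sval \<tau> (X + Y) (2 * t) \<le> 2 * max (gen_sval \<tau> X t) (gen_sval \<tau> Y t)"
proof (rule field_le_epsilon)
  fix e :: real assume e: "0 < e"
  \<comment> \<open>The summand e/4 puts s strictly above both singular values, and a gap of e/2
    provides the strict inequality 2 s < s' in \<open>dist_fun_add\<close>; doubling e/4 and adding
    e/2 uses up e.\<close>
  define s where "s = max (gen_sval \<tau> X t) (gen_sval \<tau> Y t) + e / 4"
  have XY: "X + Y \<in> N" by (rule vN_intros(3)[OF vN X Y])
  have s: "0 \<le> s" using gen_sval_nonneg[OF X, of t] e by (simp add: s_def)
  have "dist_fun X s \<le> ennreal t" "dist_fun Y s \<le> ennreal t"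
    using e by (auto intro!: rearr_lessD[OF tail_fun_dist_fun] X Y simp: s_def gen_sval_eq)
  then have "dist_fun X s + dist_fun Y s \<le> ennreal t + ennreal t" by (rule add_mono)
  also have "\<dots> = ennreal (2 * t)" using t by (simp flip: ennreal_plus)
  finally have "dist_fun (X + Y) (2 * s + e / 2) \<le> ennreal (2 * t)"
    using dist_fun_add[OF X Y s, of "2 * s + e / 2"] e by (auto intro: order_trans)
  then have "gen_sval \<tau> (X + Y) (2 * t) \<le> 2 * s + e / 2"
    unfolding gen_sval_eq using s e by (intro rearr_le[OF tail_fun_dist_fun[OF XY]]) auto
  then show "gen_sval \<tau> (X + Y) (2 * t) \<le> 2 * max (gen_sval \<tau> X t) (gen_sval \<tau> Y t) + e"
    by (simp add: s_def)
qed

text \<open>The factor 2^q comes from the bound for singular values of a sum, where the maximum of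
  two q-th powers is at most their sum; the further 2 comes from the substitution of 2 t for t.
  Passing from v to v/2 is free since ln (1 + v/2) \<le> ln (1 + v).\<close>

lemma log_mean_add:
  assumes X: "X \<in> N" and Y: "Y \<in> N" and q: "1 \<le> q" and K: "0 \<le> K" "0 \<le> K'"
    and evX: "\<forall>\<^sub>F u in at_top. log_mean q X u \<le> ennreal K" and evY: "\<forall>\<^sub>F u in at_top. log_mean q Y u \<le> ennreal K'"
  shows "\<forall>\<^sub>F u in at_top. log_mean q (X + Y) u \<le> ennreal (2 powr (q + 1) * (K + K'))"
proof -
  have XY: "X + Y \<in> N" by (rule vN_intros(3)[OF vN X Y])
  note [measurable] = gen_sval_measurable[OF X] gen_sval_measurable[OF Y] gen_sval_measurable[OF XY]
  let ?x = "gen_sval \<tau> X" and ?y = "gen_sval \<tau> Y" and ?z = "gen_sval \<tau> (X + Y)"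
  have pt: "?z (2 * t) powr q \<le> 2 powr q * (?x t powr q + ?y t powr q)" if t: "0 \<le> t" for t
  proof -
    have "?z (2 * t) powr q \<le> (2 * max (?x t) (?y t)) powr q"
      using gen_sval_add[OF X Y t] gen_sval_nonneg[OF XY] q by (intro powr_mono2) auto
    also have "\<dots> = 2 powr q * max (?x t) (?y t) powr q"
      using gen_sval_nonneg[OF X, of t] by (subst powr_mult) auto
    also have "max (?x t) (?y t) powr q \<le> ?x t powr q + ?y t powr q" by (auto simp: max_def)
    finally show ?thesis by simp
  qed
  have main: "partial_integral ?z q (2 * u)
      \<le> ennreal (2 powr (q + 1)) * (partial_integral ?x q u + partial_integral ?y q u)" for u
  proof -
    have "partial_integral ?z q (2 * u) = ennreal 2 * (\<integral>\<^sup>+t. ennreal (?z (2 * t) powr q) * indicator {0..2 * u} (2 * t) \<partial>lborel)"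
      unfolding partial_integral_def by (subst nn_integral_real_affine[where c = 2 and t = 0]) auto
    also have "\<dots> \<le> ennreal 2 * (\<integral>\<^sup>+t. ennreal (2 powr q) * (ennreal (?x t powr q) * indicator {0..u} t
        + ennreal (?y t powr q) * indicator {0..u} t) \<partial>lborel)"
    proof (intro mult_left_mono nn_integral_mono)
      fix t
      show "ennreal (?z (2 * t) powr q) * indicator {0..2 * u} (2 * t)
        \<le> ennreal (2 powr q) * (ennreal (?x t powr q) * indicator {0..u} t + ennreal (?y t powr q) * indicator {0..u} t)"
      proof (cases "t \<in> {0..u}")
        case True
        have "ennreal (?z (2 * t) powr q) \<le> ennreal (2 powr q * (?x t powr q + ?y t powr q))"
          using pt True by (intro ennreal_leI) auto
        then show ?thesis using True by (simp add: ennreal_mult)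
      qed (auto split: split_indicator)
    qed simp
    also have "\<dots> = ennreal 2 * (ennreal (2 powr q) * (partial_integral ?x q u + partial_integral ?y q u))"
      by (simp add: nn_integral_cmult nn_integral_add partial_integral_def)
    also have "\<dots> = ennreal (2 powr (q + 1)) * (partial_integral ?x q u + partial_integral ?y q u)"
      by (simp add: powr_add mult.commute[of _ 2] ennreal_mult mult.assoc)
    finally show ?thesis .
  qed
  have half: "filterlim (\<lambda>v::real. v / 2) at_top at_top" by real_asymp
  have "\<forall>\<^sub>F v in at_top. log_mean q X (v / 2) \<le> ennreal K" "\<forall>\<^sub>F v in at_top. log_mean q Y (v / 2) \<le> ennreal K'"
    using half evX evY unfolding filterlim_iff by blast+
  then show ?thesis
    using eventually_gt_at_top[of 2]
  proof eventually_elim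
    case (elim v)
    define u where "u = v / 2"
    have u: "u > 1" "v = 2 * u" using elim by (auto simp: u_def)
    have ln: "0 < ln (1 + u)" "ln (1 + u) \<le> ln (1 + v)" using u by auto
    have part: "partial_integral \<mu> q u \<le> ennreal (C * ln (1 + v))"
      if "partial_integral \<mu> q u / ennreal (ln (1 + u)) \<le> ennreal C" "0 \<le> C" for \<mu> C
    proof -
      have "partial_integral \<mu> q u = partial_integral \<mu> q u / ennreal (ln (1 + u)) * ennreal (ln (1 + u))"
        using ln by (simp add: ennreal_divide_times)
      also have "\<dots> \<le> ennreal C * ennreal (ln (1 + v))"
        using that ln by (intro mult_mono ennreal_leI) auto
      finally show ?thesis using that ln by (simp add: ennreal_mult)
    qed
    have "partial_integral ?z q v \<le> ennreal (2 powr (q + 1)) * (partial_integral ?x q u + partial_integral ?y q u)"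
      unfolding u(2) by (rule main)
    also have "\<dots> \<le> ennreal (2 powr (q + 1)) * (ennreal (K * ln (1 + v)) + ennreal (K' * ln (1 + v)))"
      using elim(1,2) K by (intro mult_left_mono add_mono part) (auto simp: log_mean_def u_def)
    also have "\<dots> = ennreal (2 powr (q + 1) * (K + K') * ln (1 + v))"
    proof -
      have "ennreal (K * ln (1 + v)) + ennreal (K' * ln (1 + v)) = ennreal ((K + K') * ln (1 + v))"
        using K ln by (subst ennreal_plus[symmetric]) (auto simp: distrib_right)
      then show ?thesis by (simp only: ennreal_mult'[symmetric] powr_ge_zero mult.assoc)
    qed
    finally have "log_mean q (X + Y) v \<le> ennreal (2 powr (q + 1) * (K + K') * ln (1 + v)) / ennreal (ln (1 + v))"
      unfolding log_mean_def by (rule divide_right_mono_ennreal)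
    also have "\<dots> = ennreal (2 powr (q + 1) * (K + K'))"
      using K ln by (subst divide_ennreal) auto
    finally show ?case .
  qed
qed

text \<open>\<mu>_t^q \<le> C^(q-1) \<mu>_t has a finite integral while the logarithm in the
  denominator is unbounded, so trace class operators are invisible to the limsup.\<close>

lemma log_mean_L1:
  assumes B: "B \<in> L1 N \<tau>" and q: "1 \<le> q" and K: "0 < K"
  shows "\<forall>\<^sub>F u in at_top. log_mean q B u \<le> ennreal K"
proof -
  have BN: "B \<in> N" and fin: "\<tau> (op_abs B) < \<infinity>" using B by (auto simp: L1_def)
  note P = vN_op_abs[OF vN BN]
  note [measurable] = gen_sval_measurable[OF BN]
  have "op_abs (op_abs B) = op_abs B" by (rule op_abs_positive[OF pos_partD(2)[OF P]])
  then have "gen_sval \<tau> (op_abs B) = gen_sval \<tau> B" by (simp add: fun_eq_iff gen_sval_def)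
  then have "power_integral (gen_sval \<tau> B) 1 < \<infinity>"
    using fin tau_op_powr[OF P, of 1] by (simp add: op_powr_one[OF pos_partD(2)[OF P]])
  then obtain c where c: "power_integral (gen_sval \<tau> B) 1 = ennreal c" "0 \<le> c"
    by (cases "power_integral (gen_sval \<tau> B) 1") auto
  define C where "C = norm (op_abs B) + 1"
  have C: "C > 0" by (simp add: C_def add_nonneg_pos)
  define D where "D = C powr (q - 1) * c"
  have D: "0 \<le> D" using c by (simp add: D_def)
  have part: "partial_integral (gen_sval \<tau> B) q u \<le> ennreal D" for u
  proof -
    have pt: "gen_sval \<tau> B t powr q \<le> C powr (q - 1) * gen_sval \<tau> B t powr 1" for t
    proof -
      have "gen_sval \<tau> B t powr q = gen_sval \<tau> B t powr (q - 1) * gen_sval \<tau> B t powr 1"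
        by (simp only: powr_add[symmetric] diff_add_cancel)
      also have "\<dots> \<le> C powr (q - 1) * gen_sval \<tau> B t powr 1"
        using gen_sval_nonneg[OF BN] gen_sval_le[OF BN] q
        by (intro mult_right_mono powr_mono2) (auto simp: C_def)
      finally show ?thesis .
    qed
    have "partial_integral (gen_sval \<tau> B) q u
        \<le> (\<integral>\<^sup>+t. ennreal (C powr (q - 1)) * (ennreal (gen_sval \<tau> B t powr 1) * indicator {0..} t) \<partial>lborel)"
      unfolding partial_integral_def
    proof (rule nn_integral_mono)
      fix t
      have "ennreal (gen_sval \<tau> B t powr q) \<le> ennreal (C powr (q - 1) * gen_sval \<tau> B t powr 1)"
        by (rule ennreal_leI[OF pt])
      then show "ennreal (gen_sval \<tau> B t powr q) * indicator {0..u} t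
          \<le> ennreal (C powr (q - 1)) * (ennreal (gen_sval \<tau> B t powr 1) * indicator {0..} t)"
        by (auto simp: ennreal_mult split: split_indicator)
    qed
    also have "\<dots> = ennreal D"
      using c by (subst nn_integral_cmult) (auto simp: power_integral_def D_def ennreal_mult)
    finally show ?thesis .
  qed
  have "\<forall>\<^sub>F u in at_top. D / K \<le> ln u"
    using ln_at_top unfolding filterlim_at_top by blast
  then show ?thesis
    using eventually_gt_at_top[of 1]
  proof eventually_elim
    case (elim u)
    have ln: "0 < ln (1 + u)" "ln u \<le> ln (1 + u)" using elim by auto
    have "D \<le> K * ln u" using elim K by (simp add: field_simps)
    also have "\<dots> \<le> K * ln (1 + u)" using ln K by (intro mult_left_mono) auto
    finally have D_le: "D / ln (1 + u) \<le> K" using ln by (simp add: divide_le_eq)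
    have "log_mean q B u \<le> ennreal D / ennreal (ln (1 + u))"
      unfolding log_mean_def using part by (rule divide_right_mono_ennreal)
    also have "\<dots> = ennreal (D / ln (1 + u))" using D ln by (intro divide_ennreal) auto
    also have "\<dots> \<le> ennreal K" using D_le by (rule ennreal_leI)
    finally show ?case .
  qed
qed

lemma log_mean_le_L_norm_eventually:
  assumes q: "1 \<le> q" and d: "0 \<le> d" and L: "L_norm \<tau> q A \<le> ennreal d"
  shows "\<forall>\<^sub>F u in at_top. log_mean q A u \<le> ennreal (d powr q)"
  using eventually_gt_at_top[of 1]
proof eventually_elim
  case (elim u)
  have "log_mean q A u \<le> epowr (L_norm \<tau> q A) q" by (rule log_mean_le_L_norm[OF q elim])
  also have "\<dots> \<le> epowr (ennreal d) q" using L q by (intro epowr_mono) auto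
  finally show ?case using d by (simp add: epowr_ennreal)
qed

text \<open>Write T = (T - S) + (S - B) + B with S in the closure and B of trace class: the first
  two terms are small in norm, the last is invisible to the limsup. Two uses of
  \<open>log_mean_add\<close> produce c (2 c + 1), and the choice d = 2 K produces 2^q.\<close>

lemma log_limsup_le_L_dist:
  assumes T: "T \<in> N" and q: "1 \<le> q"
  defines "c \<equiv> 2 powr (q + 1)"
  shows "log_limsup q T \<le> ennreal (c * (c * 2 + 1) * 2 powr q) * epowr (L_dist \<tau> q T (L_space_0 N \<tau> q)) q"
proof -
  let ?D = "L_dist \<tau> q T (L_space_0 N \<tau> q)"
  have c: "0 < c" by (simp add: c_def)
  \<comment> \<open>The distance appears as the limsup of a constant function so that
    \<open>Limsup_transfer\<close> applies.\<close>
  have "Limsup at_top (log_mean q T) \<le> ennreal (c * (c * 2 + 1) * 2 powr q)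
      * epowr (Limsup (at_top :: real filter) (\<lambda>_. ?D)) q"
  proof (rule Limsup_transfer)
    fix K :: real assume K: "0 < K" and ev: "\<forall>\<^sub>F _ in (at_top :: real filter). ?D \<le> ennreal K"
    define d where "d = 2 * K"
    have d: "0 < d" using K by (simp add: d_def)
    have "?D \<le> ennreal K" using ev by (simp add: eventually_const_iff)
    also have "\<dots> < ennreal d" using K by (simp add: d_def ennreal_less_iff)
    finally obtain S where S: "S \<in> L_space_0 N \<tau> q" "L_norm \<tau> q (T - S) < ennreal d"
      unfolding L_dist_def by (auto simp: INF_less_iff)
    then obtain B where B: "B \<in> L1 N \<tau>" "L_norm \<tau> q (S - B) < ennreal d"
      using d by (auto simp: L_space_0_def)
    have SN: "S \<in> N" and BN: "B \<in> N" using S B by (auto simp: L_space_0_def L_space_def L1_def)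
    have diffs: "T - S \<in> N" "S - B \<in> N" "T - B \<in> N"
      using vN_intros(4)[OF vN] T SN BN by auto
    have "\<forall>\<^sub>F u in at_top. log_mean q ((T - S) + (S - B)) u \<le> ennreal (c * (d powr q + d powr q))"
      unfolding c_def using d S B
      by (intro log_mean_add diffs q log_mean_le_L_norm_eventually) (auto intro: less_imp_le)
    then have "\<forall>\<^sub>F u in at_top. log_mean q (T - B) u \<le> ennreal (c * (d powr q + d powr q))" by simp
    \<comment> \<open>Any positive bound holds eventually here; \<open>d powr q\<close> makes the
      three terms add up.\<close>
    moreover have "\<forall>\<^sub>F u in at_top. log_mean q B u \<le> ennreal (d powr q)"
      using d by (intro log_mean_L1[OF B(1) q]) auto
    ultimately have "\<forall>\<^sub>F u in at_top. log_mean q ((T - B) + B) u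
        \<le> ennreal (c * (c * (d powr q + d powr q) + d powr q))"
      using c unfolding c_def by (intro log_mean_add diffs BN q) auto
    moreover have "c * (c * (d powr q + d powr q) + d powr q) = c * (c * 2 + 1) * (2 * K) powr q"
      by (simp add: d_def algebra_simps)
    moreover have "\<dots> = c * (c * 2 + 1) * 2 powr q * K powr q"
      using K by (simp add: powr_mult)
    ultimately show "\<forall>\<^sub>F u in at_top. log_mean q T u \<le> ennreal (c * (c * 2 + 1) * 2 powr q * K powr q)"
      by (simp only: diff_add_cancel)
  qed (use q c in auto)
  then show ?thesis by (simp add: log_limsup_def Limsup_const)
qed

lemma dist_fun_fun_calc:
  assumes T: "T \<in> pos_part N" and f: "admissible T f" and nonneg: "\<And>t. 0 \<le> t \<Longrightarrow> t \<le> norm T + 1 \<Longrightarrow> 0 \<le> f t"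
  shows "dist_fun (fun_calc f T) s = \<tau> (spectral_measure T (f -` {s<..}))"
proof -
  have "positive_op (fun_calc f T)" by (rule fun_calc_positive[OF pos_partD(2)[OF T] f nonneg])
  then show ?thesis
    using spectral_measure_fun_calc[OF pos_partD(2)[OF T] f nonneg, of "{s<..}"]
    by (simp add: dist_fun_def op_abs_positive)
qed

text \<open>Used for membership in the closure: a trace class operator of finite norm approximates
  itself with error of norm 0.\<close>

lemma L_norm_zero:
  assumes q: "1 \<le> q"
  shows "L_norm \<tau> q 0 = 0"
proof -
  have zero: "(0 :: 'h \<Rightarrow>\<^sub>L 'h) \<in> N" "positive_op (0 :: 'h \<Rightarrow>\<^sub>L 'h)" using pos_partD[OF zero_pos_part] by auto
  interpret pvm "spectral_measure (0 :: 'h \<Rightarrow>\<^sub>L 'h)" 0 "norm (0 :: 'h \<Rightarrow>\<^sub>L 'h) + 1"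
    by (rule pvm_spectral_measure[OF zero(2)])
  have calc: "fun_calc (\<lambda>t. 0 * 1) (0 :: 'h \<Rightarrow>\<^sub>L 'h) = 0"
    by (subst fun_calc_scale[OF zero(2) bounded_borel_on_const]) simp
  have "dist_fun 0 s = 0" if "0 \<le> s" for s
    using dist_fun_fun_calc[OF zero_pos_part, of "\<lambda>t. 0 * 1" s] that calc
    by (simp add: bounded_borel_on_const E_empty tau_zero)
  then have "gen_sval \<tau> 0 t \<le> 0" for t
    unfolding gen_sval_eq by (intro rearr_le[OF tail_fun_dist_fun[OF zero(1)]]) auto
  then have "gen_sval \<tau> 0 t = 0" for t using gen_sval_nonneg[OF zero(1), of t] by (simp add: antisym)
  then have "log_mean q 0 u = 0" for u by (simp add: log_mean_def partial_integral_def)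
  then show ?thesis by (simp add: L_norm_eq epowr_def)
qed

lemma log_mean_mono:
  assumes A: "A \<in> N" and B: "B \<in> N" and q: "1 \<le> q" and le: "\<And>s. 0 \<le> s \<Longrightarrow> dist_fun A s \<le> dist_fun B s"
  shows "log_mean q A u \<le> log_mean q B u"
proof -
  have "gen_sval \<tau> A t \<le> gen_sval \<tau> B t" for t
    unfolding gen_sval_eq by (rule rearr_mono[OF tail_fun_dist_fun[OF A] tail_fun_dist_fun[OF B] le])
  then have "partial_integral (gen_sval \<tau> A) q u \<le> partial_integral (gen_sval \<tau> B) q u"
    unfolding partial_integral_def using gen_sval_nonneg[OF A] q
    by (intro nn_integral_mono mult_right_mono ennreal_leI powr_mono2) auto
  then show ?thesis unfolding log_mean_def by (rule divide_right_mono_ennreal)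
qed

text \<open>The part of \<open>T\<close> above a small spectral level is \<open>L\<^sub>1\<close>; the rest has small norm at small
  \<open>u\<close> because it is small in operator norm, and at large \<open>u\<close> because it is dominated by \<open>T\<close>.\<close>

lemma L_dist_le:
  assumes T: "T \<in> pos_part N" and q: "1 \<le> q" and K: "0 < K"
    and ev: "\<forall>\<^sub>F u in at_top. log_mean q T u \<le> ennreal K"
  shows "L_dist \<tau> q T (L_space_0 N \<tau> q) \<le> ennreal (K powr (1 / q))"
proof -
  note TN = pos_partD(1)[OF T] and T' = pos_partD(2)[OF T]
  obtain u0 where u0': "\<And>u. u0 \<le> u \<Longrightarrow> log_mean q T u \<le> ennreal K"
    using ev by (auto simp: eventually_at_top_linorder)
  define u1 where "u1 = max u0 2"
  have u1: "1 < u1" "\<And>u. u1 \<le> u \<Longrightarrow> log_mean q T u \<le> ennreal K" using u0' by (auto simp: u1_def)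
  \<comment> \<open>Chosen so that e^q u1 / ln 2 = K: with it the bound of
    \<open>log_mean_bounded\<close> gives K for all u below \<open>u1\<close>.\<close>
  define e where "e = (K * ln 2 / u1) powr (1 / q)"
  have e: "0 < e" using K u1 by (simp add: e_def)
  have e_q: "e powr q * u1 / ln 2 = K" using q K u1 by (simp add: e_def powr_powr)
  have id: "admissible T (\<lambda>t. t)" by (intro bounded_borel_on_continuous continuous_intros)
  let ?f = "\<lambda>t. t * indicator {e<..} t :: real" and ?g = "\<lambda>t. t * indicator {..e} t :: real"
  have fg: "admissible T ?f" "admissible T ?g"
    by (auto intro!: bounded_borel_on_mult[OF id] bounded_borel_on_indicator)
  have fg_nonneg: "0 \<le> ?f t" "0 \<le> ?g t" if "0 \<le> t" for t using that by (auto split: split_indicator)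
  define B C where "B = fun_calc ?f T" and "C = fun_calc ?g T"
  have B: "B \<in> pos_part N" and C: "C \<in> pos_part N"
    unfolding B_def C_def using fg fg_nonneg by (auto intro!: fun_calc_pos_part[OF T])
  note BN = pos_partD(1)[OF B] and CN = pos_partD(1)[OF C]
  have "(\<lambda>t. ?f t + ?g t) = (\<lambda>t. t)" by (auto simp: fun_eq_iff split: split_indicator)
  then have "T = B + C"
    using fun_calc_add[OF T' fg] fun_calc_id[OF T'] by (simp add: B_def C_def)
  then have TBC: "T - B = C" by (metis add_diff_cancel_left')
  have n_T: "dist_fun T s = \<tau> (spectral_measure T {s<..})" for s
    by (simp add: dist_fun_def op_abs_positive[OF T'])
  have sub: "dist_fun (fun_calc h T) s \<le> dist_fun T s"
    if "admissible T h" "\<And>t. 0 \<le> t \<Longrightarrow> 0 \<le> h t" "h -` {s<..} \<subseteq> {s<..}" for h s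
  proof -
    have "h \<in> borel_measurable borel" using that(1) by (simp add: bounded_borel_on_def)
    from measurable_sets[OF this, of "{s<..}"] have "h -` {s<..} \<in> sets borel" by simp
    then show ?thesis
      using that emeasure_mono[of "h -` {s<..}" "{s<..}" "spectral_trace T"]
      by (simp add: dist_fun_fun_calc[OF T] n_T emeasure_spectral_trace[OF T])
  qed
  have B_le: "dist_fun B s \<le> dist_fun T s" and C_le: "dist_fun C s \<le> dist_fun T s" if "0 \<le> s" for s
    unfolding B_def C_def using that fg fg_nonneg by (auto intro!: sub split: split_indicator_asm)
  have "?g -` {e<..} = {}" using e by (auto split: split_indicator_asm)
  moreover have "spectral_measure T {} = 0" by (rule pvm.E_empty[OF pvm_spectral_measure[OF T']])
  ultimately have "dist_fun C e = 0"
    unfolding C_def using fg fg_nonneg by (subst dist_fun_fun_calc[OF T]) (simp_all add: tau_zero)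
  then have C_small: "gen_sval \<tau> C t \<le> e" for t
    unfolding gen_sval_eq using e by (intro rearr_le[OF tail_fun_dist_fun[OF CN]]) auto
  have "log_mean q C u \<le> ennreal K" if u: "1 < u" for u
  proof (cases "u1 \<le> u")
    case True
    have "log_mean q C u \<le> log_mean q T u" by (rule log_mean_mono[OF CN TN q C_le])
    then show ?thesis using u1(2)[OF True] by (rule order_trans)
  next
    case False
    have "log_mean q C u \<le> ennreal (e powr q * u / ln 2)"
      using e by (intro log_mean_bounded[OF CN q _ C_small u]) auto
    also have "\<dots> \<le> ennreal (e powr q * u1 / ln 2)"
      using False by (intro ennreal_leI divide_right_mono mult_left_mono) auto
    finally show ?thesis by (simp only: e_q)
  qed
  then have norm_C: "L_norm \<tau> q C \<le> ennreal (K powr (1 / q))" using K by (intro L_norm_le[OF q]) auto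
  \<comment> \<open>This yields one exponent p > q with \<tau>(T^p) finite, from which the upper
    part B of T is shown to be of trace class.\<close>
  have "\<forall>\<^sub>F p in at_right q. ennreal (p - q) * \<tau> (op_powr T p) \<le> ennreal ((2 * q + 1) * K)"
    by (rule zeta_le_log_mean[OF T q K ev])
  then have "\<forall>\<^sub>F p in at_right q. q < p \<and> ennreal (p - q) * \<tau> (op_powr T p) \<le> ennreal ((2 * q + 1) * K)"
    using eventually_at_right_less[of q] by eventually_elim auto
  then obtain p where p: "q < p" "ennreal (p - q) * \<tau> (op_powr T p) \<le> ennreal ((2 * q + 1) * K)"
    using eventually_happens'[OF trivial_limit_at_right_real] by blast
  have fin_p: "\<tau> (op_powr T p) < \<infinity>"
  proof (rule ccontr)
    assume "\<not> \<tau> (op_powr T p) < \<infinity>"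
    then have "\<tau> (op_powr T p) = top" by (metis infinity_ennreal_def top.not_eq_extremum)
    then show False using p by (simp add: ennreal_mult_top top_unique)
  qed
  define M where "M = norm T + 1"
  have M: "0 \<le> M" by (simp add: M_def add_nonneg_nonneg)
  have h: "admissible T (\<lambda>t. (M * e powr (- p)) * t powr p)"
    using p q by (intro bounded_borel_on_mult bounded_borel_on_const admissible_powr) auto
  \<comment> \<open>Above e one has t \<le> M and (t/e)^p \<ge> 1, so the cut-off identity lies
    below M (t/e)^p; below e it is 0.\<close>
  have "B \<preceq> fun_calc (\<lambda>t. (M * e powr (- p)) * t powr p) T"
    unfolding B_def
  proof (rule fun_calc_mono[OF T' fg(1) h])
    fix t assume t: "0 \<le> t" "t \<le> norm T + 1"
    show "?f t \<le> (M * e powr (- p)) * t powr p"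
    proof (cases "e < t")
      case True
      have "e powr p \<le> t powr p" using True e p q by (intro powr_mono2) auto
      then have "1 \<le> e powr (- p) * t powr p" using e by (simp add: powr_minus field_simps)
      then have "M * 1 \<le> M * (e powr (- p) * t powr p)" using M by (rule mult_left_mono)
      then show ?thesis using True t by (simp add: M_def mult.assoc)
    qed (use M in simp)
  qed
  moreover have "fun_calc (\<lambda>t. (M * e powr (- p)) * t powr p) T = (M * e powr (- p)) *\<^sub>R op_powr T p"
    unfolding op_powr_def using p q by (intro fun_calc_scale[OF T'] admissible_powr) auto
  moreover have pow: "op_powr T p \<in> pos_part N"
    unfolding op_powr_def using p q by (intro fun_calc_pos_part[OF T] admissible_powr) auto
  moreover have "fun_calc (\<lambda>t. (M * e powr (- p)) * t powr p) T \<in> pos_part N"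
    using h M by (intro fun_calc_pos_part[OF T]) auto
  ultimately have "\<tau> B \<le> ennreal (M * e powr (- p)) * \<tau> (op_powr T p)"
    using tau_mono[OF B, of "(M * e powr (- p)) *\<^sub>R op_powr T p"] tau_scale[OF pow, of "M * e powr (- p)"] M by simp
  also have "\<dots> < \<infinity>" using fin_p by (simp add: ennreal_mult_less_top)
  finally have B_L1: "B \<in> L1 N \<tau>" by (simp add: L1_def BN op_abs_positive[OF pos_partD(2)[OF B]])
  have "log_limsup q B \<le> ennreal K"
    unfolding log_limsup_def
  proof (rule Limsup_bounded)
    show "\<forall>\<^sub>F u in at_top. log_mean q B u \<le> ennreal K"
      using ev log_mean_mono[OF BN TN q B_le] by (auto elim!: eventually_mono intro: order_trans)
  qed
  then have "L_norm \<tau> q B < \<infinity>" using L_norm_finite_iff[OF BN q] by (simp add: le_less_trans)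
  then have "B \<in> L_space_0 N \<tau> q"
    using B_L1 BN by (auto simp: L_space_0_def L_space_def L_norm_zero[OF q] intro!: bexI[of _ B])
  then have "L_dist \<tau> q T (L_space_0 N \<tau> q) \<le> L_norm \<tau> q (T - B)"
    unfolding L_dist_def by (rule INF_lower)
  then show ?thesis using norm_C by (simp add: TBC)
qed

lemma L_dist_le_log_limsup:
  assumes T: "T \<in> pos_part N" and q: "1 \<le> q"
  shows "L_dist \<tau> q T (L_space_0 N \<tau> q) \<le> epowr (log_limsup q T) (1 / q)"
proof -
  let ?D = "L_dist \<tau> q T (L_space_0 N \<tau> q)"
  have "Limsup (at_top :: real filter) (\<lambda>_. ?D) \<le> ennreal 1 * epowr (Limsup at_top (log_mean q T)) (1 / q)"
    using L_dist_le[OF T q] q by (intro Limsup_transfer) auto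
  then show ?thesis by (simp add: log_limsup_def Limsup_const)
qed

end

theorem corollary4p7:
  fixes N :: "('h::chilbert_space \<Rightarrow>\<^sub>L 'h) set"
    and \<tau> :: "('h \<Rightarrow>\<^sub>L 'h) \<Rightarrow> ennreal"
    and q :: real
  assumes separable: "\<exists>D::'h set. countable D \<and> closure D = UNIV"
    and vN: "semifinite_von_neumann_algebra N"
    and trace: "fns_trace N \<tau>"
    and q: "q \<ge> 1"
  shows "equivalent_on (Z_space N \<tau> q) (Z_norm_plus \<tau> q) (Z_norm \<tau> q)
    \<and> Z_space N \<tau> q = L_space_pos N \<tau> q
    \<and> ((factor N \<and> type_I N \<and> standard_trace N \<tau>) \<or> non_atomic N \<tau> \<longrightarrow>
         equivalent_on (Z_space N \<tau> q) (\<lambda>T. L_dist \<tau> q T (L_space_0 N \<tau> q)) (Z_norm \<tau> q))"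
proof -
  interpret trace_algebra N \<tau>
    using vN trace by unfold_locales (simp_all add: semifinite_von_neumann_algebra_def)
  have q0: "0 < q" using q by simp
  have pos: "T \<in> pos_part N" if "T \<in> Z_space N \<tau> q" for T using that by (simp add: Z_space_def)
  \<comment> \<open>Removes the q-th powers in the comparison lemmas, so that the bounds become
    linear in the seminorms.\<close>
  have root: "epowr (ennreal c * epowr x q) (1 / q) = ennreal (c powr (1 / q)) * x" if "0 < c" for c x
    using that q0 by (simp add: epowr_cmult epowr_epowr epowr_one)
  have "equivalent_on (Z_space N \<tau> q) (Z_norm_plus \<tau> q) (Z_norm \<tau> q)"
  proof (rule equivalent_onI[where a = "2 powr (1 / q)" and b = "2 * q powr (1 / q)"])
    fix T assume T: "T \<in> Z_space N \<tau> q"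
    have "Z_norm_plus \<tau> q T \<le> epowr (ennreal 2 * epowr (Z_norm \<tau> q T) q) (1 / q)"
      unfolding Z_norm_plus_def using Z_norm_vs_Z1_norm(1)[OF pos[OF T] q] q0 by (intro epowr_mono) auto
    then show "Z_norm_plus \<tau> q T \<le> ennreal (2 powr (1 / q)) * Z_norm \<tau> q T" using root[of 2] by simp
    show "Z_norm \<tau> q T \<le> ennreal (2 * q powr (1 / q)) * Z_norm_plus \<tau> q T"
      by (rule Z_norm_vs_Z1_norm(2)[OF pos[OF T] q])
  qed (use q in auto)
  moreover have "Z_space N \<tau> q = L_space_pos N \<tau> q"
  proof -
    \<comment> \<open>Both conditions amount to finiteness of \<open>log_limsup\<close>.\<close>
    have "Z_norm \<tau> q T < \<infinity> \<longleftrightarrow> L_norm \<tau> q T < \<infinity>" if T: "T \<in> pos_part N" for T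
    proof -
      have "log_limsup q T < \<infinity>" if "Z_norm \<tau> q T < \<infinity>"
      proof -
        have "epowr (Z_norm \<tau> q T) q < \<infinity>" using that by (simp only: epowr_less_top)
        then have "8 * epowr (Z_norm \<tau> q T) q < \<infinity>" by (simp add: ennreal_mult_less_top)
        with log_limsup_le_Z_norm[OF T q] show ?thesis by (rule le_less_trans)
      qed
      moreover have "Z_norm \<tau> q T < \<infinity>" if "log_limsup q T < \<infinity>"
      proof -
        have "epowr (log_limsup q T) (1 / q) < \<infinity>" using that by (simp only: epowr_less_top)
        then have "ennreal (2 * (2 * q + 1) powr (1 / q)) * epowr (log_limsup q T) (1 / q) < \<infinity>"
          by (simp add: ennreal_mult_less_top)
        with Z_norm_le_log_limsup[OF T q] show ?thesis by (rule le_less_trans)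
      qed
      ultimately show ?thesis using L_norm_finite_iff[OF pos_partD(1)[OF T] q] by blast
    qed
    then show ?thesis by (auto simp: Z_space_def L_space_pos_def)
  qed
  moreover have "equivalent_on (Z_space N \<tau> q) (\<lambda>T. L_dist \<tau> q T (L_space_0 N \<tau> q)) (Z_norm \<tau> q)"
  proof -
    let ?D = "\<lambda>T. L_dist \<tau> q T (L_space_0 N \<tau> q)"
    define c where "c = 2 powr (q + 1) * (2 powr (q + 1) * 2 + 1) * 2 powr q"
    have c: "0 < c" unfolding c_def by (intro mult_pos_pos add_pos_pos) auto
    show ?thesis
    \<comment> \<open>Both estimates pass through the q-th root of \<open>log_limsup\<close>, so
      their constants are products of those of the two halves; the distance is at most that root
      with constant 1.\<close>
    proof (rule equivalent_onI[where a = "8 powr (1 / q)" and b = "2 * (2 * q + 1) powr (1 / q) * c powr (1 / q)"])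
    fix T assume T: "T \<in> Z_space N \<tau> q"
    have "?D T \<le> epowr (log_limsup q T) (1 / q)" by (rule L_dist_le_log_limsup[OF pos[OF T] q])
    also have "\<dots> \<le> epowr (ennreal 8 * epowr (Z_norm \<tau> q T) q) (1 / q)"
      using log_limsup_le_Z_norm[OF pos[OF T] q] q0 by (intro epowr_mono) auto
    finally show "?D T \<le> ennreal (8 powr (1 / q)) * Z_norm \<tau> q T" using root[of 8] by simp
    have "log_limsup q T \<le> ennreal c * epowr (?D T) q"
      unfolding c_def by (rule log_limsup_le_L_dist[OF pos_partD(1)[OF pos[OF T]] q])
    then have "epowr (log_limsup q T) (1 / q) \<le> epowr (ennreal c * epowr (?D T) q) (1 / q)"
      using q0 by (intro epowr_mono) auto
    then have "epowr (log_limsup q T) (1 / q) \<le> ennreal (c powr (1 / q)) * ?D T" using root[OF c] by simp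
    then have "ennreal (2 * (2 * q + 1) powr (1 / q)) * epowr (log_limsup q T) (1 / q)
       \<le> ennreal (2 * (2 * q + 1) powr (1 / q)) * (ennreal (c powr (1 / q)) * ?D T)"
      by (rule mult_left_mono) simp
    with Z_norm_le_log_limsup[OF pos[OF T] q]
    have "Z_norm \<tau> q T \<le> ennreal (2 * (2 * q + 1) powr (1 / q)) * (ennreal (c powr (1 / q)) * ?D T)"
      by (rule order_trans)
    then show "Z_norm \<tau> q T \<le> ennreal (2 * (2 * q + 1) powr (1 / q) * c powr (1 / q)) * ?D T"
      by (simp add: ennreal_mult mult.assoc)
    qed (use q c in auto)
  qed
  ultimately show ?thesis by blast
qed

end
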